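(* Let $E$ be a separable Banach space and $I=[0,1]$. Let $a_2,a_1,a_0\colon I\to\mathbb{R}$ be continuous with $a_2(t)\neq0$ on $I$, let $b_{ij},c_{ij}\in\mathbb{R}$ ($i,j=1,2$), $d_1,d_2\in E$, and set $B_1x=b_{11}x(0)+b_{12}x'(0)+c_{11}x(1)+c_{12}x'(1)$, $B_2x=b_{21}x(0)+b_{22}x'(0)+c_{21}x(1)+c_{22}x'(1)$. Assume that the scalar problem $a_2x''+a_1x'+a_0x=0$, $B_1x=0$, $B_2x=0$ has only the trivial solution, and let $G\in C(I\times I,\mathbb{R})$ be its Green's function. Let $F\colon I\times E\multimap E$ satisfy: (h1) $F(t,x)$ is nonempty, closed and bounded for every $(t,x)$; (h2) $F(\cdot,x)$ is Lebesgue measurable for every $x\in E$; (h3) there is $\mu\in L^1(I,\mathbb{R})$ with $d_H(F(t,x),F(t,y))\leq\mu(t)|x-y|$ for all $x,y\in E$ and a.a. $t$; (h4) there is $\alpha\in L^1(I,\mathbb{R})$ with $d(0,F(t,0))\leq\alpha(t)$ for a.a. $t$. Assume $\|\mu\|_{L^1}<\big(\sup_{(t,s)\in I^2}|G(t,s)|\big)^{-1}$. Then the solution set $S_F$ of the boundary value problem $a_2(t)x''+a_1(t)x'+a_0(t)x\in F(t,x)$ a.e. on $I$, $B_1x=d_1$, $B_2x=d_2$ is a retract of the space $W^{2,1}(0,1;E)$.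
   Context: $W^{2,1}(0,1;E)$ is the Bochner–Sobolev space of $u\in L^1(I,E)$ with $u',u''\in L^1(I,E)$. A solution is $x\in W^{2,1}(0,1;E)$ with $B_1x=d_1$, $B_2x=d_2$ and $a_2(t)x''(t)+a_1(t)x'(t)+a_0(t)x(t)\in F(t,x(t))$ for a.a. $t$. The Green's function $G$ is the unique continuous function on $I\times I$ such that for each $u\in L^1(I,E)$, $x(t)=\int_0^1G(t,s)u(s)\,ds$ is the unique $x\in W^{2,1}(0,1;E)$ with $a_2x''+a_1x'+a_0x=u$, $B_1x=0$, $B_2x=0$. $F(\cdot,x)$ Lebesgue measurable means $\{t\colon F(t,x)\cap A\neq\emptyset\}$ is Lebesgue measurable for every open $A\subset E$. $d_H$ is the Hausdorff distance between closed bounded sets and $d(0,A)=\inf\{|y|\colon y\in A\}$. *)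

theory Defs
  imports "HOL-Analysis.Analysis"
begin

abbreviation I01 :: "real set" where "I01 \<equiv> {0..1}"

definition hausd :: "'a::metric_space set \<Rightarrow> 'a set \<Rightarrow> real" where
  "hausd A B = max (SUP a\<in>A. infdist a B) (SUP b\<in>B. infdist b A)"

definition der1 :: "(real \<Rightarrow> 'a::real_normed_vector) \<Rightarrow> real \<Rightarrow> 'a" where
  "der1 x t = vector_derivative x (at t within I01)"

definition is_der2 :: "(real \<Rightarrow> 'a::{banach,second_countable_topology}) \<Rightarrow> (real \<Rightarrow> 'a) \<Rightarrow> bool" where
  "is_der2 x u \<longleftrightarrow>
     integrable (lebesgue_on I01) u \<and>
     (\<forall>t\<in>I01. (x has_vector_derivative der1 x t) (at t within I01)) \<and>
     (\<forall>t\<in>I01. der1 x t = der1 x 0 + integral\<^sup>L (lebesgue_on {0..t}) u)"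

text \<open>The Sobolev space W^{2,1}(0,1;E). Elements are functions on I, normalised to 0 outside I
  (every element of W^{2,1} has a unique C^1 representative on I).\<close>
definition W21 :: "(real \<Rightarrow> 'a::{banach,second_countable_topology}) set" where
  "W21 = {x. (\<forall>t. t \<notin> I01 \<longrightarrow> x t = 0) \<and> integrable (lebesgue_on I01) x \<and>
              integrable (lebesgue_on I01) (der1 x) \<and> (\<exists>u. is_der2 x u)}"

definition der2 :: "(real \<Rightarrow> 'a::{banach,second_countable_topology}) \<Rightarrow> real \<Rightarrow> 'a" where
  "der2 x = (SOME u. is_der2 x u)"

definition W21_norm :: "(real \<Rightarrow> 'a::{banach,second_countable_topology}) \<Rightarrow> real" where
  "W21_norm x = integral\<^sup>L (lebesgue_on I01) (\<lambda>t. norm (x t))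
              + integral\<^sup>L (lebesgue_on I01) (\<lambda>t. norm (der1 x t))
              + integral\<^sup>L (lebesgue_on I01) (\<lambda>t. norm (der2 x t))"

definition W21_retract :: "(real \<Rightarrow> 'a::{banach,second_countable_topology}) set \<Rightarrow> bool" where
  "W21_retract S \<longleftrightarrow> S \<subseteq> W21 \<and>
     (\<exists>r. (\<forall>x\<in>W21. r x \<in> S) \<and> (\<forall>x\<in>S. r x = x) \<and>
          (\<forall>x\<in>W21. \<forall>e>0. \<exists>d>0. \<forall>y\<in>W21. W21_norm (y - x) < d \<longrightarrow> W21_norm (r y - r x) < e))"

definition bop :: "real \<Rightarrow> real \<Rightarrow> real \<Rightarrow> real \<Rightarrow> (real \<Rightarrow> 'a::real_normed_vector) \<Rightarrow> 'a" where
  "bop b1 b2 c1 c2 x = b1 *\<^sub>R x 0 + b2 *\<^sub>R der1 x 0 + c1 *\<^sub>R x 1 + c2 *\<^sub>R der1 x 1"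

definition Lop :: "(real \<Rightarrow> real) \<Rightarrow> (real \<Rightarrow> real) \<Rightarrow> (real \<Rightarrow> real) \<Rightarrow>
   (real \<Rightarrow> 'a::{banach,second_countable_topology}) \<Rightarrow> real \<Rightarrow> 'a" where
  "Lop a2 a1 a0 x t = a2 t *\<^sub>R der2 x t + a1 t *\<^sub>R der1 x t + a0 t *\<^sub>R x t"

end

theory Submission
  imports Defs
begin

text \<open>
  Let \<open>L x = a\<^sub>2 x'' + a\<^sub>1 x' + a\<^sub>0 x\<close> and let \<open>T u\<close> solve \<open>L x = u\<close> with boundary data \<open>d\<^sub>1, d\<^sub>2\<close>. Since \<open>L\<close> and \<open>T\<close> are
  continuous between \<open>W\<^sup>2\<^sup>,\<^sup>1\<close> and \<open>L\<^sup>1\<close>, it suffices to retract \<open>L\<^sup>1\<close> onto the set of \<open>u\<close> with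
  \<open>u(t) \<in> F(t, T u(t))\<close> a.e., that is, onto the zero set of the residual
  \<open>e(u) = \<integral> d(u(t), F(t, T u(t))) dt\<close>. The retraction is the limit of the iterates of one continuous map
  \<open>R\<close> on \<open>L\<^sup>1\<close> with \<open>R u = u\<close> if \<open>e(u) = 0\<close>, \<open>\<parallel>R u - u\<parallel> \<le> 2 e(u)\<close> and \<open>e(R u) \<le> q e(u)\<close> for some \<open>q < 1\<close>.

  To build \<open>R\<close>, let \<open>\<psi>\<^sub>k\<close> be dense in \<open>L\<^sup>1\<close> and let \<open>v\<^sub>k(t)\<close> be a measurable almost nearest point to
  \<open>\<psi>\<^sub>k(t)\<close> in \<open>F(t, T \<psi>\<^sub>k(t))\<close>. Then \<open>R u\<close> equals \<open>v\<^sub>k\<close> on the set of those \<open>t\<close> for which the fractional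
  part of \<open>\<tau>(u) t\<close> lies in an interval whose length is the value at \<open>u\<close> of the \<open>k\<close>-th member of a
  partition of unity subordinate to small balls around the \<open>\<psi>\<^sub>k\<close>. For a large frequency \<open>\<tau>(u)\<close>
  these sets are equidistributed, which makes the patched \<open>\<psi>\<^sub>k\<close> close to \<open>u\<close> in \<open>L\<^sup>1\<close>; this replaces
  Lyapunov's convexity theorem in the usual selection theorems for decomposable sets.
\<close>

section \<open>Integrable functions on the unit interval\<close>

text \<open>The values of \<open>F\<close> need not be convex, so a partition of unity cannot
  average selections: an average of points of \<open>F t x\<close> may leave the set. What survives
  in L1 is decomposability: patching selections along measurable sets gives a selection again. The
  weights therefore become lengths of time intervals. Their end points move continuously with
  \<open>u\<close>, and so does the patched function in L1, although its value at a single
  \<open>t\<close> jumps. The smallness condition gives the factor \<open>q\<close>. Replacing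
  \<open>u\<close> by nearly nearest points of \<open>F t (T u t)\<close> moves it in L1 by about
  \<open>e(u)\<close>. This moves \<open>T u\<close> uniformly by at most sup \<open>|G|\<close>
  times as much, and the set at time \<open>t\<close> by \<open>\<mu> t\<close> times that.
  Integration leaves the factor \<open>\<parallel>\<mu>\<parallel>\<close> sup \<open>|G|\<close>
  below 1, and all other errors have to be small multiples of \<open>e(u)\<close>; hence radii
  proportional to the residual. The obstacle is that \<open>v k\<close> belongs to
  \<open>\<psi> k\<close>, which is close to \<open>u\<close> in L1 but perhaps not at a given
  \<open>t\<close>. An arbitrary patching could collect the bad times of every
  \<open>\<psi> k\<close>; equidistribution excludes this.\<close>

abbreviation L01 :: "real measure" where "L01 \<equiv> lebesgue_on I01"

abbreviation integral01 :: "(real \<Rightarrow> 'a::{banach,second_countable_topology}) \<Rightarrow> 'a" where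
  "integral01 \<equiv> integral\<^sup>L L01"

definition L1norm :: "(real \<Rightarrow> 'a::{banach,second_countable_topology}) \<Rightarrow> real" where
  "L1norm f = integral01 (\<lambda>t. norm (f t))"

abbreviation L1_tendsto ::
  "(nat \<Rightarrow> real \<Rightarrow> 'a::{banach,second_countable_topology}) \<Rightarrow> (real \<Rightarrow> 'a) \<Rightarrow> bool" where
  "L1_tendsto s f \<equiv> (\<lambda>n. L1norm (\<lambda>t. s n t - f t)) \<longlonglongrightarrow> 0"

lemma finite_measure_L01: "finite_measure L01"
  by (rule finite_measure_lebesgue_on) auto

lemma measure_L01_space [simp]: "measure L01 I01 = 1"
  by (simp add: measure_restrict_space)

lemma integrable_L01_const [simp, intro]:
  "integrable L01 (\<lambda>t. c :: 'a::{banach,second_countable_topology})"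
  using finite_measure.integrable_const[OF finite_measure_L01] .

lemma integral_L01_const [simp]:
  "integral01 (\<lambda>t. c :: 'a::{banach,second_countable_topology}) = c"
  by simp

lemma L1norm_nonneg [simp]: "0 \<le> L1norm f"
  by (simp add: L1norm_def)

lemma L1norm_cong_AE:
  assumes "AE t in L01. f t = g t" "f \<in> borel_measurable L01" "g \<in> borel_measurable L01"
  shows "L1norm f = L1norm g"
  unfolding L1norm_def using assms by (intro integral_cong_AE) auto

lemma L1norm_commute: "L1norm (\<lambda>t. f t - g t) = L1norm (\<lambda>t. g t - f t)"
  by (simp add: L1norm_def norm_minus_commute)

lemma L1norm_add_le:
  assumes "integrable L01 f" "integrable L01 g"
  shows "L1norm (\<lambda>t. f t + g t) \<le> L1norm f + L1norm g"
proof -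
  have "L1norm (\<lambda>t. f t + g t) \<le> integral01 (\<lambda>t. norm (f t) + norm (g t))"
    unfolding L1norm_def using assms by (intro integral_mono) (auto intro: norm_triangle_ineq)
  then show ?thesis using assms by (simp add: L1norm_def)
qed

lemma L1norm_triangle:
  assumes "integrable L01 f" "integrable L01 g" "integrable L01 h"
  shows "L1norm (\<lambda>t. f t - h t) \<le> L1norm (\<lambda>t. f t - g t) + L1norm (\<lambda>t. g t - h t)"
  using L1norm_add_le[of "\<lambda>t. f t - g t" "\<lambda>t. g t - h t"] assms by simp

lemma norm_integral_le_L1norm:
  "norm (integral01 f) \<le> L1norm f"
  by (simp add: L1norm_def integral_norm_bound)

lemma L1norm_dominated_convergence:
  assumes [measurable]: "f \<in> borel_measurable L01" "\<And>i. s i \<in> borel_measurable L01"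
    and w: "integrable L01 w"
    and lim: "AE t in L01. (\<lambda>i. s i t) \<longlonglongrightarrow> f t"
    and bd: "\<And>i. AE t in L01. norm (s i t) \<le> w t"
  shows "L1_tendsto s f"
proof -
  have int: "integrable L01 f" by (rule integrable_dominated_convergence[OF _ _ w lim bd]) auto
  have "(\<lambda>i. integral01 (\<lambda>t. norm (s i t - f t))) \<longlonglongrightarrow> integral01 (\<lambda>t. 0::real)"
  proof (rule integral_dominated_convergence[where w="\<lambda>t. w t + norm (f t)"])
    show "integrable L01 (\<lambda>t. w t + norm (f t))" using w int by auto
    show "AE t in L01. (\<lambda>i. norm (s i t - f t)) \<longlonglongrightarrow> 0"
      using lim by eventually_elim (simp add: tendsto_norm_zero LIM_zero)
    show "AE t in L01. norm (norm (s i t - f t)) \<le> w t + norm (f t)" for i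
      using bd[of i] by eventually_elim (simp, metis add_right_mono norm_triangle_ineq4 order_trans)
  qed auto
  then show ?thesis by (simp add: L1norm_def)
qed

section \<open>Borel approximation, density of step functions and separability of L1\<close>

lemma borel_measurable_L01:
  assumes "f \<in> borel_measurable borel"
  shows "f \<in> borel_measurable L01"
  using assms by (simp add: measurable_completion measurable_restrict_space1)

lemma integrable_L01_indicator:
  assumes "A \<in> sets borel"
  shows "integrable L01 (\<lambda>t. indicator A t *\<^sub>R (c :: 'a::{banach,second_countable_topology}))"
proof (rule Bochner_Integration.integrable_bound[OF integrable_L01_const[of "norm c"]])
  show "(\<lambda>t. indicator A t *\<^sub>R c) \<in> borel_measurable L01"
    using assms by (intro borel_measurable_L01 borel_measurable_scaleR borel_measurable_indicator) auto
qed (auto simp: indicator_def)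

lemma AE_L01_null_set:
  assumes "N \<in> null_sets lborel"
  shows "AE t in L01. t \<notin> N"
proof -
  have "AE t in lebesgue. t \<notin> N" using assms by (intro AE_completion AE_not_in)
  then show ?thesis by (auto simp: AE_restrict_space_iff elim!: eventually_mono)
qed

text \<open>Intervals generate only the Borel sets, so the null part of a Lebesgue set has to be
  split off before an induction over Borel sets applies.\<close>

lemma L01_set_AE_borel:
  assumes "A \<in> sets L01"
  obtains S where "S \<in> sets borel" "AE t in L01. indicator S t = (indicator A t :: real)"
proof -
  have "A \<in> sets lebesgue" using assms by (auto simp: sets_restrict_space_iff)
  then obtain S N N' where S: "A = S \<union> N" "S \<in> sets lborel" "N \<subseteq> N'" "N' \<in> null_sets lborel"
    by (elim sets_completionE)
  have "AE t in L01. indicator S t = (indicator A t :: real)"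
    using AE_L01_null_set[OF S(4)] by eventually_elim (use S in \<open>auto simp: indicator_def\<close>)
  then show ?thesis using S(2) by (intro that) simp_all
qed

text \<open>Density of step functions in L1, put as an induction rule: indicators of intervals
  generate those of Borel sets by complements and disjoint unions, and these generate all integrable
  functions. It serves both separability and equidistribution.\<close>

lemma L1_interval_induct [consumes 1, case_names interval add lim]:
  fixes P :: "(real \<Rightarrow> 'a::{banach,second_countable_topology}) \<Rightarrow> bool"
  assumes f: "integrable L01 f"
    and interval: "\<And>a b c. 0 \<le> a \<Longrightarrow> a \<le> b \<Longrightarrow> b \<le> 1 \<Longrightarrow> P (\<lambda>t. indicator {a..b} t *\<^sub>R c)"
    and add: "\<And>f g. integrable L01 f \<Longrightarrow> integrable L01 g \<Longrightarrow> P f \<Longrightarrow> P g \<Longrightarrow> P (\<lambda>t. f t + g t)"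
    and lim: "\<And>f s. integrable L01 f \<Longrightarrow> (\<And>i::nat. integrable L01 (s i)) \<Longrightarrow> (\<And>i. P (s i)) \<Longrightarrow>
                L1_tendsto s f \<Longrightarrow> P f"
  shows "P f"
proof -
  \<comment> \<open>A constant sequence converges in L1 to every function that agrees with it almost
    everywhere, so closure under limits already allows changes on null sets.\<close>
  have cong: "P g" if "P f" "integrable L01 f" "integrable L01 g" "AE t in L01. f t = g t" for f g
  proof (rule lim[where s="\<lambda>i. f"])
    have "L1norm (\<lambda>t. f t - g t) = L1norm (\<lambda>t. 0::'a)"
      using that by (intro L1norm_cong_AE) auto
    then show "L1_tendsto (\<lambda>i. f) g" by (simp add: L1norm_def)
  qed (use that in auto)
  have zero: "P (\<lambda>t. 0)" using interval[of 0 0 0] by simp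
  \<comment> \<open>The quantifier over \<open>c\<close> belongs to the induction statement, because
    the complement step uses the hypothesis for \<open>- c\<close>.\<close>
  have borel: "\<forall>c. P (\<lambda>t. indicator A t *\<^sub>R c)" if "A \<in> sets borel" for A
    using that
  proof (induction rule: borel_set_induct)
    case empty then show ?case using zero by simp
  next
    case (interval a b)
    show ?case
    proof (cases "max a 0 \<le> min b 1")
      case True
      show ?thesis
      proof
        fix c
        have "P (\<lambda>t. indicator {max a 0..min b 1} t *\<^sub>R c)" using True by (intro assms(2)) auto
        then show "P (\<lambda>t. indicator {a..b} t *\<^sub>R c)"
        proof (rule cong)
          show "AE t in L01. indicator {max a 0..min b 1} t *\<^sub>R c = indicator {a..b} t *\<^sub>R c"
            by (rule AE_I2) (auto simp: indicator_def)
        qed (rule integrable_L01_indicator, simp)+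
      qed
    next
      case False
      show ?thesis
      proof
        fix c
        show "P (\<lambda>t. indicator {a..b} t *\<^sub>R c)"
        proof (rule cong[OF zero])
          show "AE t in L01. 0 = indicator {a..b} t *\<^sub>R c"
            using False by (intro AE_I2) (auto simp: indicator_def)
          show "integrable L01 (\<lambda>t. indicator {a..b} t *\<^sub>R c)"
            by (rule integrable_L01_indicator) simp
        qed simp
      qed
    qed
  next
    case (compl A)
    show ?case
    proof
      fix c
      have "P (\<lambda>t. indicator {0..1} t *\<^sub>R c + indicator A t *\<^sub>R (- c))"
      proof (rule add)
        show "P (\<lambda>t. indicator {0..1} t *\<^sub>R c)" by (rule assms(2)) auto
        show "P (\<lambda>t. indicator A t *\<^sub>R (- c))" using compl(2) by blast
      qed (rule integrable_L01_indicator, use compl(1) in simp)+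
      then show "P (\<lambda>t. indicator (- A) t *\<^sub>R c)"
      proof (rule cong)
        show "AE t in L01. indicator {0..1} t *\<^sub>R c + indicator A t *\<^sub>R (- c) = indicator (- A) t *\<^sub>R c"
          by (rule AE_I2) (auto simp: indicator_def)
        show "integrable L01 (\<lambda>t. indicator {0..1} t *\<^sub>R c + indicator A t *\<^sub>R (- c))"
          using compl(1) by (intro Bochner_Integration.integrable_add integrable_L01_indicator) auto
        show "integrable L01 (\<lambda>t. indicator (- A) t *\<^sub>R c)"
          using compl(1) by (intro integrable_L01_indicator) auto
      qed
    qed
  next
    case (union A)
    show ?case
    proof
      fix c
      have fin: "P (\<lambda>t. \<Sum>i<n. indicator (A i) t *\<^sub>R c) \<and> integrable L01 (\<lambda>t. \<Sum>i<n. indicator (A i) t *\<^sub>R c)" for n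
      proof (induction n)
        case 0 then show ?case using zero by simp
      next
        case (Suc n)
        have A: "integrable L01 (\<lambda>t. indicator (A n) t *\<^sub>R c)"
          using union(2) by (rule integrable_L01_indicator)
        have "P (\<lambda>t. (\<Sum>i<n. indicator (A i) t *\<^sub>R c) + indicator (A n) t *\<^sub>R c)"
          using Suc A union(3)[of n] by (intro add) blast+
        moreover have "integrable L01 (\<lambda>t. (\<Sum>i<n. indicator (A i) t *\<^sub>R c) + indicator (A n) t *\<^sub>R c)"
          using Suc A by (intro Bochner_Integration.integrable_add) blast+
        ultimately show ?case by (simp only: sum.lessThan_Suc)
      qed
      have eq: "(\<Sum>i<n. indicator (A i) t *\<^sub>R c) = indicator (\<Union>i<n. A i) t *\<^sub>R c" for n t
      proof -
        have "indicator (\<Union>i<n. A i) t = (\<Sum>i<n. indicator (A i) t :: real)"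
          using union(1) by (intro indicator_UN_disjoint) (auto simp: disjoint_family_on_def)
        then show ?thesis by (simp add: scaleR_sum_left)
      qed
      show "P (\<lambda>t. indicator (\<Union>i. A i) t *\<^sub>R c)"
      proof (rule lim[where s="\<lambda>n t. \<Sum>i<n. indicator (A i) t *\<^sub>R c"])
        show "(\<lambda>n. L1norm (\<lambda>t. (\<Sum>i<n. indicator (A i) t *\<^sub>R c) - indicator (\<Union>i. A i) t *\<^sub>R c)) \<longlonglongrightarrow> 0"
        proof (rule L1norm_dominated_convergence[where w="\<lambda>t. norm c"])
          show "AE t in L01. (\<lambda>n. \<Sum>i<n. indicator (A i) t *\<^sub>R c) \<longlonglongrightarrow> indicator (\<Union>i. A i) t *\<^sub>R c"
          proof (rule AE_I2)
            fix t
            show "(\<lambda>n. \<Sum>i<n. indicator (A i) t *\<^sub>R c) \<longlonglongrightarrow> indicator (\<Union>i. A i) t *\<^sub>R c"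
              unfolding eq by (intro tendsto_scaleR tendsto_const LIMSEQ_indicator_UN)
          qed
          show "AE t in L01. norm (\<Sum>i<n. indicator (A i) t *\<^sub>R c) \<le> norm c" for n
            unfolding eq by (auto simp: indicator_def)
          show "(\<lambda>t. indicator (\<Union>i. A i) t *\<^sub>R c) \<in> borel_measurable L01"
            using union by (intro borel_measurable_integrable integrable_L01_indicator) auto
          show "(\<lambda>t. \<Sum>i<n. indicator (A i) t *\<^sub>R c) \<in> borel_measurable L01" for n
            by (rule borel_measurable_integrable[OF fin[THEN conjunct2]])
        qed auto
        show "integrable L01 (\<lambda>t. indicator (\<Union>i. A i) t *\<^sub>R c)"
          using union by (intro integrable_L01_indicator) auto
      qed (use fin in auto)
    qed
  qed
  show ?thesis using f
  proof (induction rule: integrable_induct)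
    case (base A c)
    obtain S where S: "S \<in> sets borel" "AE t in L01. indicator S t = (indicator A t :: real)"
      using L01_set_AE_borel[OF base(1)] .
    have ae: "AE t in L01. indicator S t *\<^sub>R c = indicator A t *\<^sub>R c"
      using S(2) by eventually_elim simp
    have intA: "integrable L01 (\<lambda>t. indicator A t *\<^sub>R c)"
      using base by (intro integrable_scaleR_left integrable_real_indicator) auto
    have "P (\<lambda>t. indicator S t *\<^sub>R c)" using borel[OF S(1)] by blast
    moreover have "integrable L01 (\<lambda>t. indicator S t *\<^sub>R c)"
      using S(1) by (rule integrable_L01_indicator)
    ultimately show ?case using intA ae by (rule cong)
  next
    case (add f g) then show ?case by (intro assms(3))
  next
    case (lim f s)
    show ?case
    proof (rule assms(4)[of f s])
      \<comment> \<open>The factor 2 in the majorant is the bound on the approximating simple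
        functions that \<open>integrable_induct\<close> provides.\<close>
      show "L1_tendsto s f"
        using lim by (intro L1norm_dominated_convergence[where w="\<lambda>t. 2 * norm (f t)"]) auto
    qed (use lim in auto)
  qed
qed

lemma L1_separable:
  obtains \<psi> :: "nat \<Rightarrow> real \<Rightarrow> 'a::{banach,second_countable_topology}"
  where "\<And>k. integrable L01 (\<psi> k)"
    and "\<And>f e. integrable L01 f \<Longrightarrow> e > 0 \<Longrightarrow> \<exists>k. L1norm (\<lambda>t. f t - \<psi> k t) < e"
proof -
  obtain D :: "'a set" where D: "countable D" "\<And>X. open X \<Longrightarrow> X \<noteq> {} \<Longrightarrow> \<exists>d\<in>D. d \<in> X"
    by (erule countable_dense_setE)
  \<comment> \<open>Lists of weighted intervals make the family closed under addition by
    concatenation, which is what the \<open>add\<close> case below uses.\<close>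
  define st :: "(real \<times> real \<times> 'a) list \<Rightarrow> real \<Rightarrow> 'a"
    where "st xs t = (\<Sum>(a,b,d)\<leftarrow>xs. indicator {a..b} t *\<^sub>R d)" for xs t
  define S where "S = st ` lists (\<rat> \<times> \<rat> \<times> D)"
  have int_st: "integrable L01 (st xs)" for xs
  proof (induction xs)
    case Nil then show ?case by (simp add: st_def[abs_def])
  next
    case (Cons x xs)
    obtain a b d where x: "x = (a,b,d)" by (cases x)
    have "st (x # xs) = (\<lambda>t. indicator {a..b} t *\<^sub>R d + st xs t)"
      by (simp add: st_def[abs_def] x)
    moreover have "integrable L01 (\<lambda>t. indicator {a..b} t *\<^sub>R d + st xs t)"
      by (intro Bochner_Integration.integrable_add integrable_L01_indicator Cons) auto
    ultimately show ?case by simp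
  qed
  have "countable (\<rat> \<times> \<rat> \<times> D)" by (intro countable_SIGMA countable_rat D(1))
  then have S_countable: "countable S" unfolding S_def by (intro countable_image countable_lists)
  have S_ne: "S \<noteq> {}" unfolding S_def by auto
  have dense: "\<forall>e>0. \<exists>g\<in>S. L1norm (\<lambda>t. f t - g t) < e" if "integrable L01 f" for f
    using that
  proof (induct rule: L1_interval_induct)
    case (interval a b c)
    show ?case
    proof (intro allI impI)
      fix e :: real assume e: "e > 0"
      \<comment> \<open>The rational end points lie strictly outside the interval: the indicators
        are then 1 on all of it for every \<open>n\<close> and eventually 0 at each outer point, so
        they converge at every \<open>t\<close>, the end points included.\<close>
      have "\<exists>p\<in>\<rat>. a - 1 / Suc n < p \<and> p < a" for n by (rule Rats_dense_in_real) auto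
      then obtain p where p: "\<And>n. p n \<in> \<rat>" "\<And>n. a - 1 / Suc n < p n" "\<And>n. p n < a" by metis
      have "\<exists>r\<in>\<rat>. b < r \<and> r < b + 1 / Suc n" for n by (rule Rats_dense_in_real) auto
      then obtain r where r: "\<And>n. r n \<in> \<rat>" "\<And>n. r n < b + 1 / Suc n" "\<And>n. b < r n" by metis
      have "\<exists>d\<in>D. d \<in> ball c (1 / Suc n)" for n by (rule D(2)) auto
      then obtain d where d: "\<And>n. d n \<in> D" "\<And>n. dist c (d n) < 1 / Suc n"
        unfolding mem_ball by metis
      have lim0: "(\<lambda>n. 1 / real (Suc n)) \<longlonglongrightarrow> 0" by (rule LIMSEQ_Suc[OF lim_1_over_n])
      have p_lim: "p \<longlonglongrightarrow> a"
      proof (rule tendsto_sandwich[OF _ _ _ tendsto_const])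
        show "(\<lambda>n. a - 1 / Suc n) \<longlonglongrightarrow> a" using tendsto_diff[OF tendsto_const lim0] by simp
      qed (use p in \<open>auto intro!: always_eventually less_imp_le\<close>)
      have r_lim: "r \<longlonglongrightarrow> b"
      proof (rule tendsto_sandwich[OF _ _ tendsto_const])
        show "(\<lambda>n. b + 1 / Suc n) \<longlonglongrightarrow> b" using tendsto_add[OF tendsto_const lim0] by simp
      qed (use r in \<open>auto intro!: always_eventually less_imp_le\<close>)
      have d_lim: "d \<longlonglongrightarrow> c"
      proof (rule Lim_transform_bound[OF _ lim0, THEN LIM_zero_cancel])
        show "\<forall>\<^sub>F n in sequentially. norm (d n - c) \<le> norm (1 / real (Suc n))"
          using d(2) by (intro always_eventually) (auto simp: dist_norm norm_minus_commute less_imp_le)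
      qed
      have "(\<lambda>n. L1norm (\<lambda>t. indicator {p n..r n} t *\<^sub>R d n - indicator {a..b} t *\<^sub>R c)) \<longlonglongrightarrow> 0"
      proof (rule L1norm_dominated_convergence[where w="\<lambda>t. norm c + 1"])
        show "AE t in L01. (\<lambda>n. indicator {p n..r n} t *\<^sub>R d n) \<longlonglongrightarrow> indicator {a..b} t *\<^sub>R c"
        proof (rule AE_I2)
          fix t
          have "\<forall>\<^sub>F n in sequentially. indicator {p n..r n} t = (indicator {a..b} t :: real)"
          proof -
            consider "t < a" | "b < t" | "a \<le> t" "t \<le> b" by linarith
            then show ?thesis
            proof cases
              case 1
              show ?thesis using order_tendstoD(1)[OF p_lim 1]
                by eventually_elim (use 1 in \<open>auto simp: indicator_def\<close>)
            next
              case 2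
              show ?thesis using order_tendstoD(2)[OF r_lim 2]
                by eventually_elim (use 2 in \<open>auto simp: indicator_def\<close>)
            next
              case 3
              have "p n \<le> t \<and> t \<le> r n" for n using 3 p(3)[of n] r(3)[of n] by auto
              then show ?thesis using 3 by (intro always_eventually) (auto simp: indicator_def)
            qed
          qed
          then have "\<forall>\<^sub>F n in sequentially. indicator {a..b} t *\<^sub>R d n = indicator {p n..r n} t *\<^sub>R d n"
            by eventually_elim simp
          moreover have "(\<lambda>n. indicator {a..b} t *\<^sub>R d n) \<longlonglongrightarrow> indicator {a..b} t *\<^sub>R c"
            by (intro tendsto_scaleR tendsto_const d_lim)
          ultimately show "(\<lambda>n. indicator {p n..r n} t *\<^sub>R d n) \<longlonglongrightarrow> indicator {a..b} t *\<^sub>R c"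
            by (rule Lim_transform_eventually[rotated])
        qed
        show "AE t in L01. norm (indicator {p n..r n} t *\<^sub>R d n) \<le> norm c + 1" for n
        proof (rule AE_I2)
          fix t
          have "norm (d n) \<le> norm c + dist c (d n)" by (metis dist_norm norm_minus_commute norm_triangle_sub)
          also have "dist c (d n) \<le> 1" using d(2)[of n] by (rule order_trans[OF less_imp_le]) simp
          finally show "norm (indicator {p n..r n} t *\<^sub>R d n) \<le> norm c + 1" by (auto simp: indicator_def)
        qed
      qed (auto intro!: borel_measurable_integrable[OF integrable_L01_indicator] simp del: indicator_scaleR_eq_if)
      from order_tendstoD(2)[OF this e] obtain n
        where n: "L1norm (\<lambda>t. indicator {p n..r n} t *\<^sub>R d n - indicator {a..b} t *\<^sub>R c) < e"
        by (auto simp: eventually_sequentially)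
      have "st [(p n, r n, d n)] \<in> S" unfolding S_def using p r d by (intro imageI) auto
      moreover have "st [(p n, r n, d n)] = (\<lambda>t. indicator {p n..r n} t *\<^sub>R d n)" by (simp add: st_def[abs_def])
      ultimately show "\<exists>g\<in>S. L1norm (\<lambda>t. indicator {a..b} t *\<^sub>R c - g t) < e"
        using n L1norm_commute[of "\<lambda>t. indicator {a..b} t *\<^sub>R c" "\<lambda>t. indicator {p n..r n} t *\<^sub>R d n"]
        by (intro bexI[of _ "st [(p n, r n, d n)]"]) auto
    qed
  next
    case (add f g)
    show ?case
    proof (intro allI impI)
      fix e :: real assume e: "e > 0"
      obtain xs where xs: "xs \<in> lists (\<rat> \<times> \<rat> \<times> D)" "L1norm (\<lambda>t. f t - st xs t) < e/2"
        using add(3)[rule_format, of "e/2"] e unfolding S_def by auto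
      obtain ys where ys: "ys \<in> lists (\<rat> \<times> \<rat> \<times> D)" "L1norm (\<lambda>t. g t - st ys t) < e/2"
        using add(4)[rule_format, of "e/2"] e unfolding S_def by auto
      have eq: "(\<lambda>t. f t + g t - st (xs @ ys) t) = (\<lambda>t. (f t - st xs t) + (g t - st ys t))"
        by (simp add: st_def algebra_simps)
      have "L1norm (\<lambda>t. f t + g t - st (xs @ ys) t) < e"
        unfolding eq using L1norm_add_le[of "\<lambda>t. f t - st xs t" "\<lambda>t. g t - st ys t"] xs ys add int_st by auto
      moreover have "st (xs @ ys) \<in> S" unfolding S_def using xs ys by (intro imageI) auto
      ultimately show "\<exists>h\<in>S. L1norm (\<lambda>t. f t + g t - h t) < e" by (intro bexI[of _ "st (xs @ ys)"])
    qed
  next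
    case (lim f s)
    show ?case
    proof (intro allI impI)
      fix e :: real assume e: "e > 0"
      from order_tendstoD(2)[OF lim(4), of "e/2"] e obtain i where i: "L1norm (\<lambda>t. s i t - f t) < e/2"
        by (auto simp: eventually_sequentially)
      obtain g where g: "g \<in> S" "L1norm (\<lambda>t. s i t - g t) < e/2" using lim(3)[rule_format, of "e/2" i] e by auto
      have "L1norm (\<lambda>t. f t - g t) \<le> L1norm (\<lambda>t. f t - s i t) + L1norm (\<lambda>t. s i t - g t)"
        using lim g int_st unfolding S_def by (intro L1norm_triangle) auto
      then show "\<exists>g\<in>S. L1norm (\<lambda>t. f t - g t) < e"
        using i g L1norm_commute[of f "s i"] by (intro bexI[of _ g]) auto
    qed
  qed
  show ?thesis
  proof (rule that[of "from_nat_into S"])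
    show "integrable L01 (from_nat_into S k)" for k
      using from_nat_into[OF S_ne, of k] int_st unfolding S_def by auto
    show "\<exists>k. L1norm (\<lambda>t. f t - from_nat_into S k t) < e" if fe: "integrable L01 f" "e > 0" for f e
    proof -
      obtain g where g: "g \<in> S" "L1norm (\<lambda>t. f t - g t) < e" using dense[OF fe(1)] fe(2) by auto
      obtain k where "from_nat_into S k = g" using from_nat_into_surj[OF S_countable g(1)] by blast
      then show ?thesis using g(2) by auto
    qed
  qed
qed

text \<open>Completeness of L1 with an explicit rate. The norms of the increments have summable
  integrals, so the telescoping series converges absolutely almost everywhere, and its tail gives
  the bound. The rate is what later makes the limit of the iterates continuous.\<close>

lemma L1_geometric_limit:
  assumes int: "\<And>n. integrable L01 (s n)"
    and q: "0 \<le> q" "q < 1"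
    and step: "\<And>n. L1norm (\<lambda>t. s (Suc n) t - s n t) \<le> C * q ^ n"
  obtains f where "integrable L01 f" "\<And>n. L1norm (\<lambda>t. s n t - f t) \<le> C * q ^ n / (1 - q)"
proof -
  define d where "d n t = s (Suc n) t - s n t" for n t
  have d_int: "integrable L01 (d n)" for n unfolding d_def[abs_def] using int by auto
  have geo: "summable (\<lambda>n. C * q ^ n)" using q by (intro summable_mult summable_geometric) auto
  have sums: "summable (\<lambda>n. integral01 (\<lambda>t. norm (d n t)))"
    by (rule summable_comparison_test'[OF geo]) (use step in \<open>auto simp: L1norm_def d_def\<close>)
  have "(\<integral>\<^sup>+t. (\<Sum>n. ennreal (norm (d n t))) \<partial>L01) = (\<Sum>n. \<integral>\<^sup>+t. ennreal (norm (d n t)) \<partial>L01)"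
    using d_int by (intro nn_integral_suminf) auto
  also have "\<dots> = (\<Sum>n. ennreal (integral01 (\<lambda>t. norm (d n t))))"
    using d_int by (intro arg_cong[where f=suminf] ext nn_integral_eq_integral) auto
  also have "\<dots> \<noteq> \<infinity>" using sums by (simp add: ennreal_suminf_neq_top)
  finally have "AE t in L01. (\<Sum>n. ennreal (norm (d n t))) \<noteq> \<infinity>"
    using d_int by (intro nn_integral_noteq_infinite) auto
  then have ae: "AE t in L01. summable (\<lambda>n. norm (d n t))"
    by eventually_elim (auto intro!: summable_suminf_not_top)
  define f where "f t = s 0 t + (\<Sum>n. d n t)" for t
  have f_int: "integrable L01 f" unfolding f_def[abs_def]
    using int integrable_suminf[OF d_int ae sums] by auto
  show ?thesis
  proof (rule that[OF f_int])
    fix n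
    have ae': "AE t in L01. summable (\<lambda>k. norm (d (k + n) t))"
      using ae by eventually_elim (rule summable_ignore_initial_segment)
    have sums': "summable (\<lambda>k. integral01 (\<lambda>t. norm (d (k + n) t)))"
      using summable_ignore_initial_segment[OF sums, of n] .
    have intN: "integrable L01 (\<lambda>t. norm (d (k + n) t))" for k using d_int by auto
    have geo': "(\<lambda>k. C * q ^ (k + n)) sums (C * q ^ n / (1 - q))"
      using sums_mult[OF geometric_sums[of q], of "C * q ^ n"] q by (simp add: power_add mult_ac)
    have "L1norm (\<lambda>t. s n t - f t) \<le> integral01 (\<lambda>t. \<Sum>k. norm (d (k + n) t))"
      unfolding L1norm_def
    proof (rule integral_mono_AE)
      show "integrable L01 (\<lambda>t. norm (s n t - f t))" using int f_int by auto
      show "integrable L01 (\<lambda>t. \<Sum>k. norm (d (k + n) t))"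
        by (rule integrable_suminf[OF intN]) (use ae' sums' in auto)
      show "AE t in L01. norm (s n t - f t) \<le> (\<Sum>k. norm (d (k + n) t))"
        using ae
      proof eventually_elim
        case (elim t)
        have sm: "summable (\<lambda>k. d k t)" using elim by (rule summable_norm_cancel)
        have "(\<Sum>k<n. d k t) = s n t - s 0 t" unfolding d_def by (rule sum_lessThan_telescope)
        then have "f t - s n t = (\<Sum>k. d (k + n) t)"
          using suminf_split_initial_segment[OF sm, of n] by (simp add: f_def)
        moreover have "norm (\<Sum>k. d (k + n) t) \<le> (\<Sum>k. norm (d (k + n) t))"
          by (rule summable_norm) (rule summable_ignore_initial_segment[OF elim])
        ultimately show ?case by (metis norm_minus_commute)
      qed
    qed
    also have "\<dots> = (\<Sum>k. integral01 (\<lambda>t. norm (d (k + n) t)))"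
      by (rule integral_suminf[OF intN]) (use ae' sums' in auto)
    also have "\<dots> \<le> (\<Sum>k. C * q ^ (k + n))"
      by (rule suminf_le) (use step sums' geo' in \<open>auto simp: sums_iff L1norm_def d_def\<close>)
    also have "\<dots> = C * q ^ n / (1 - q)" using geo' by (simp add: sums_iff)
    finally show "L1norm (\<lambda>t. s n t - f t) \<le> C * q ^ n / (1 - q)" .
  qed
qed

section \<open>Equidistribution\<close>

text \<open>For \<open>0 \<le> b \<le> 1\<close> this is the antiderivative of the indicator of \<open>{x. frac x < b}\<close>.\<close>

definition sawtooth :: "real \<Rightarrow> real \<Rightarrow> real" where
  "sawtooth b x = real_of_int \<lfloor>x\<rfloor> * b + min (frac x) b"

text \<open>At the break points there is no derivative to argue with, so the continuity that the
  fundamental theorem of calculus asks for is obtained by comparing whole periods and remainders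
  directly.\<close>

lemma sawtooth_lipschitz:
  assumes b: "0 \<le> b" "b \<le> 1" and xy: "x \<le> y"
  shows "\<bar>sawtooth b y - sawtooth b x\<bar> \<le> y - x"
proof -
  have fx: "x = real_of_int \<lfloor>x\<rfloor> + frac x" "0 \<le> frac x" "frac x < 1" by (auto simp: frac_def, linarith)
  have fy: "y = real_of_int \<lfloor>y\<rfloor> + frac y" "0 \<le> frac y" "frac y < 1" by (auto simp: frac_def, linarith)
  show ?thesis
  proof (cases "\<lfloor>x\<rfloor> = \<lfloor>y\<rfloor>")
    case True
    then have "frac x \<le> frac y" "y - x = frac y - frac x" using fx fy xy by linarith+
    then show ?thesis using True b by (auto simp: sawtooth_def min_def)
  next
    case False
    define k where "k = real_of_int \<lfloor>y\<rfloor> - real_of_int \<lfloor>x\<rfloor>"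
    have "\<lfloor>x\<rfloor> < \<lfloor>y\<rfloor>" using False floor_mono[OF xy] by linarith
    then have k: "k \<ge> 1" unfolding k_def by linarith
    have "(k - 1) * (1 - b) \<ge> 0" "(k - 1) * b \<ge> 0" using k b by auto
    then have kb: "k - k * b \<ge> 1 - b" "k * b \<ge> b" by (auto simp: algebra_simps)
    have "sawtooth b y - sawtooth b x = k * b + min (frac y) b - min (frac x) b"
      by (simp add: sawtooth_def k_def algebra_simps)
    moreover have "y - x = k + frac y - frac x" using fx fy by (simp add: k_def)
    moreover have "0 \<le> min (frac y) b" "min (frac y) b \<le> frac y" "min (frac x) b \<le> b"
      "frac x - min (frac x) b \<le> 1 - b"
      using fx fy b by (auto simp: min_def)
    ultimately show ?thesis using kb by linarith
  qed
qed

lemma continuous_sawtooth: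
  assumes "0 \<le> b" "b \<le> 1"
  shows "continuous_on A (sawtooth b)"
proof -
  have "1-lipschitz_on A (sawtooth b)"
  proof (rule lipschitz_onI)
    fix x y
    show "dist (sawtooth b x) (sawtooth b y) \<le> 1 * dist x y"
      using sawtooth_lipschitz[OF assms, of x y] sawtooth_lipschitz[OF assms, of y x]
      by (cases "x \<le> y") (auto simp: dist_real_def)
  qed simp
  then show ?thesis by (rule lipschitz_on_continuous_on)
qed

lemma sawtooth_has_derivative:
  assumes b: "0 \<le> b" "b \<le> 1" and x: "frac x \<noteq> 0" "frac x \<noteq> b"
  shows "(sawtooth b has_real_derivative (if frac x < b then 1 else 0)) (at x)"
proof -
  define n where "n = \<lfloor>x\<rfloor>"
  have xn: "x = real_of_int n + frac x" by (simp add: n_def frac_def)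
  have f01: "0 < frac x" "frac x < 1" using x(1) frac_ge_0[of x] frac_lt_1[of x] by linarith+
  have fl: "\<lfloor>y\<rfloor> = n" "frac y = y - n" if "real_of_int n < y" "y < real_of_int n + 1" for y
    using that by (auto simp: frac_def intro!: floor_unique)
  show ?thesis
  proof (cases "frac x < b")
    case True
    have "((\<lambda>y. real_of_int n * b + (y - n)) has_real_derivative 1) (at x)"
      by (auto intro!: derivative_eq_intros)
    then have "(sawtooth b has_real_derivative 1) (at x)"
    proof (rule has_field_derivative_transform_within_open[where S="{real_of_int n <..< real_of_int n + b}"])
      show "real_of_int n * b + (y - real_of_int n) = sawtooth b y"
        if "y \<in> {real_of_int n<..<real_of_int n + b}" for y
        using that b fl[of y] by (auto simp: sawtooth_def)
      show "x \<in> {real_of_int n<..<real_of_int n + b}"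
        unfolding greaterThanLessThan_iff using xn f01 True by linarith
    qed auto
    with True show ?thesis by simp
  next
    case False
    have "((\<lambda>y. real_of_int n * b + b) has_real_derivative 0) (at x)"
      by (auto intro!: derivative_eq_intros)
    then have "(sawtooth b has_real_derivative 0) (at x)"
    proof (rule has_field_derivative_transform_within_open[where S="{real_of_int n + b <..< real_of_int n + 1}"])
      show "real_of_int n * b + b = sawtooth b y"
        if "y \<in> {real_of_int n + b<..<real_of_int n + 1}" for y
        using that b fl[of y] by (auto simp: sawtooth_def)
      show "x \<in> {real_of_int n + b<..<real_of_int n + 1}"
        unfolding greaterThanLessThan_iff using xn f01 False x by linarith
    qed auto
    with False show ?thesis by simp
  qed
qed

text \<open>The source of equidistribution: the deviation from the line of slope \<open>b\<close>
  stays bounded, so after division by the frequency it tends to 0, uniformly in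
  \<open>b\<close>.\<close>

lemma sawtooth_near_linear:
  assumes "0 \<le> b" "b \<le> 1"
  shows "\<bar>sawtooth b x - b * x\<bar> \<le> 1"
proof -
  have f: "0 \<le> frac x" "frac x < 1" by (auto intro: frac_lt_1)
  have "sawtooth b x - b * x = min (frac x) b - b * frac x"
    by (simp add: sawtooth_def frac_def algebra_simps)
  moreover have "0 \<le> b * frac x" "b * frac x \<le> 1" using f assms by (auto intro: mult_le_one)
  moreover have "0 \<le> min (frac x) b" "min (frac x) b \<le> 1" using f assms by (auto simp: min_def)
  ultimately show ?thesis by linarith
qed

lemma has_integral_frac_less:
  assumes b: "0 \<le> b" "b \<le> 1" and T: "0 < T" and cd: "c \<le> d"
  shows "((\<lambda>t. indicator {t. frac (T * t) < b} t :: real) has_integral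
           (sawtooth b (T * d) - sawtooth b (T * c)) / T) {c..d}"
proof -
  \<comment> \<open>The break points of the integrand. They are finite in number because
    \<open>\<lfloor>T * t\<rfloor>\<close> takes finitely many values on a bounded interval.\<close>
  define S where "S = {t \<in> {c..d}. frac (T * t) \<in> {0, b}}"
  have "S \<subseteq> (\<lambda>(n, e). (real_of_int n + e) / T) ` ({\<lfloor>T * c\<rfloor>..\<lfloor>T * d\<rfloor>} \<times> {0, b})"
  proof
    fix t assume t: "t \<in> S"
    have "t = (real_of_int \<lfloor>T * t\<rfloor> + frac (T * t)) / T" using T by (simp add: frac_def)
    moreover have "\<lfloor>T * t\<rfloor> \<in> {\<lfloor>T * c\<rfloor>..\<lfloor>T * d\<rfloor>}" using t T unfolding S_def by (auto intro!: floor_mono)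
    ultimately show "t \<in> (\<lambda>(n, e). (real_of_int n + e) / T) ` ({\<lfloor>T * c\<rfloor>..\<lfloor>T * d\<rfloor>} \<times> {0, b})"
      using t unfolding S_def by (intro image_eqI[of _ _ "(\<lfloor>T * t\<rfloor>, frac (T * t))"]) auto
  qed
  then have fin: "finite S" by (rule finite_subset) auto
  have "((\<lambda>t. indicator {t. frac (T * t) < b} t :: real) has_integral
           (sawtooth b (T * d) / T - sawtooth b (T * c) / T)) {c..d}"
  proof (rule fundamental_theorem_of_calculus_strong[OF fin cd])
    show "continuous_on {c..d} (\<lambda>t. sawtooth b (T * t) / T)"
      using T by (intro continuous_intros continuous_on_compose2[OF continuous_sawtooth[OF b, of UNIV]]) auto
    fix t assume t: "t \<in> {c..d} - S"
    have "((\<lambda>t. sawtooth b (T * t)) has_real_derivative (if frac (T * t) < b then 1 else 0) * T) (at t)"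
      by (rule DERIV_chain2[OF sawtooth_has_derivative[OF b]])
        (use t in \<open>auto simp: S_def intro!: derivative_eq_intros\<close>)
    from DERIV_cdivide[OF this, of T]
    show "((\<lambda>t. sawtooth b (T * t) / T) has_vector_derivative indicator {t. frac (T * t) < b} t) (at t)"
      using T by (auto simp: has_real_derivative_iff_has_vector_derivative[symmetric] indicator_def split: if_splits)
  qed
  then show ?thesis by (simp add: diff_divide_distrib)
qed

lemma frac_less_sets: "{t :: real. frac (T * t) < b} \<in> sets borel"
proof -
  have "(\<lambda>t::real. T * t - real_of_int \<lfloor>T * t\<rfloor>) \<in> borel_measurable borel" by measurable
  then have "Measurable.pred borel (\<lambda>t::real. T * t - real_of_int \<lfloor>T * t\<rfloor> < b)" by measurable
  then show ?thesis by (simp add: frac_def)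
qed

lemma integrable_L01_mult_indicator:
  fixes f :: "real \<Rightarrow> 'a::{banach,second_countable_topology}"
  assumes "integrable L01 f" "A \<in> sets borel"
  shows "integrable L01 (\<lambda>t. indicator A t *\<^sub>R f t)"
proof (rule Bochner_Integration.integrable_bound[OF assms(1)])
  have "indicator A \<in> borel_measurable L01"
    using assms(2) by (intro borel_measurable_L01 borel_measurable_indicator) auto
  then show "(\<lambda>t. indicator A t *\<^sub>R f t) \<in> borel_measurable L01"
    using assms(1) by (intro borel_measurable_scaleR) auto
qed (auto simp: indicator_def)

lemma norm_integral_indicator_le:
  assumes "integrable L01 f" "A \<in> sets borel"
  shows "norm (integral01 (\<lambda>t. indicator A t *\<^sub>R f t)) \<le> L1norm f"
proof -
  have "L1norm (\<lambda>t. indicator A t *\<^sub>R f t) \<le> L1norm f"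
    unfolding L1norm_def
    by (intro integral_mono integrable_norm integrable_L01_mult_indicator assms) (auto simp: indicator_def)
  then show ?thesis using norm_integral_le_L1norm order_trans by blast
qed

text \<open>On a step function the error is explicit by \<open>sawtooth_near_linear\<close>; sums
  and L1 limits preserve the estimate. The threshold must not depend on \<open>b\<close>, since the
  lengths of the pieces will vary with the function being patched.\<close>

lemma equidistribution_frac_less:
  fixes f :: "real \<Rightarrow> real"
  assumes "integrable L01 f"
  shows "\<forall>e>0. \<exists>T0>0. \<forall>T\<ge>T0. \<forall>b. 0 \<le> b \<longrightarrow> b \<le> 1 \<longrightarrow>
    \<bar>integral01 (\<lambda>t. indicator {t. frac (T * t) < b} t *\<^sub>R f t) - b * integral01 f\<bar> \<le> e"
    (is "?P f")
  using assms
proof (induct rule: L1_interval_induct)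
  case (interval c d k)
  show ?case
  proof (intro allI impI)
    fix e :: real assume e: "e > 0"
    \<comment> \<open>Each end of the interval contributes an error of at most
      \<open>\<bar>k\<bar> / T\<close>; the summand 1 keeps the threshold positive when
      \<open>k = 0\<close>.\<close>
    define T0 where "T0 = (2 * \<bar>k\<bar> + 1) / e"
    show "\<exists>T0>0. \<forall>T\<ge>T0. \<forall>b. 0 \<le> b \<longrightarrow> b \<le> 1 \<longrightarrow>
      \<bar>integral01 (\<lambda>t. indicator {t. frac (T * t) < b} t *\<^sub>R (indicator {c..d} t *\<^sub>R k))
        - b * integral01 (\<lambda>t. indicator {c..d} t *\<^sub>R k)\<bar> \<le> e"
    proof (intro exI[of _ T0] conjI allI impI)
      show "T0 > 0" unfolding T0_def using e by auto
      fix T b :: real assume T: "T0 \<le> T" and b: "0 \<le> b" "b \<le> 1"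
      then have Tpos: "T > 0" using \<open>T0 > 0\<close> by simp
      have int1: "integrable L01 (\<lambda>t. indicator {t. frac (T * t) < b} t *\<^sub>R (indicator {c..d} t *\<^sub>R k))"
        by (rule integrable_L01_mult_indicator[OF integrable_L01_indicator frac_less_sets]) auto
      have int2: "integrable L01 (\<lambda>t. indicator {c..d} t *\<^sub>R k)" by (rule integrable_L01_indicator) auto
      have sub: "{c..d} \<subseteq> I01" using interval by auto
      have fn_eq: "(\<lambda>t. indicator {t. frac (T * t) < b} t *\<^sub>R (indicator {c..d} t *\<^sub>R k))
          = (\<lambda>t. if t \<in> {c..d} then indicator {t. frac (T * t) < b} t * k else 0)"
        by (auto simp: fun_eq_iff indicator_def)
      have "((\<lambda>t. if t \<in> {c..d} then indicator {t. frac (T * t) < b} t * k else 0) has_integral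
               (sawtooth b (T * d) - sawtooth b (T * c)) / T * k) I01"
        unfolding has_integral_restrict[OF sub]
        by (rule has_integral_mult_left[OF has_integral_frac_less[OF b Tpos interval(2)]])
      then have "integral I01 (\<lambda>t. indicator {t. frac (T * t) < b} t *\<^sub>R (indicator {c..d} t *\<^sub>R k))
                   = (sawtooth b (T * d) - sawtooth b (T * c)) / T * k"
        unfolding fn_eq by (rule integral_unique)
      then have 1: "integral01 (\<lambda>t. indicator {t. frac (T * t) < b} t *\<^sub>R (indicator {c..d} t *\<^sub>R k))
                   = (sawtooth b (T * d) - sawtooth b (T * c)) / T * k"
        using lebesgue_integral_eq_integral[OF int1] by simp
      have 2: "integral01 (\<lambda>t. indicator {c..d} t *\<^sub>R k) = (d - c) * k"
      proof -
        have "((\<lambda>t. if t \<in> {c..d} then k else 0) has_integral (d - c) *\<^sub>R k) I01"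
          unfolding has_integral_restrict[OF sub] using has_integral_const_real[of k c d] interval(2) by simp
        moreover have "(\<lambda>t. indicator {c..d} t *\<^sub>R k) = (\<lambda>t. if t \<in> {c..d} then k else 0)"
          by (auto simp: fun_eq_iff indicator_def)
        ultimately have "integral I01 (\<lambda>t. indicator {c..d} t *\<^sub>R k) = (d - c) *\<^sub>R k"
          by (simp only: integral_unique)
        then show ?thesis using lebesgue_integral_eq_integral[OF int2] by auto
      qed
      have "\<bar>sawtooth b (T * d) - b * (T * d)\<bar> \<le> 1" "\<bar>sawtooth b (T * c) - b * (T * c)\<bar> \<le> 1"
        by (rule sawtooth_near_linear[OF b])+
      then have "\<bar>(sawtooth b (T * d) - sawtooth b (T * c)) - b * (T * (d - c))\<bar> \<le> 2"
        by (simp add: algebra_simps)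
      then have "\<bar>(sawtooth b (T * d) - sawtooth b (T * c)) - b * (T * (d - c))\<bar> / T \<le> 2 / T"
        using Tpos by (intro divide_right_mono) auto
      moreover have "\<bar>(sawtooth b (T * d) - sawtooth b (T * c)) - b * (T * (d - c))\<bar> / T
          = \<bar>((sawtooth b (T * d) - sawtooth b (T * c)) - b * (T * (d - c))) / T\<bar>"
        using Tpos by (simp only: abs_divide abs_of_pos)
      moreover have "((sawtooth b (T * d) - sawtooth b (T * c)) - b * (T * (d - c))) / T
          = (sawtooth b (T * d) - sawtooth b (T * c)) / T - b * (d - c)"
        using Tpos by (simp add: diff_divide_distrib)
      ultimately have "\<bar>(sawtooth b (T * d) - sawtooth b (T * c)) / T - b * (d - c)\<bar> * \<bar>k\<bar> \<le> 2 / T * \<bar>k\<bar>"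
        by (intro mult_right_mono) auto
      also have "2 / T * \<bar>k\<bar> \<le> e"
      proof -
        have "2 * \<bar>k\<bar> \<le> T0 * e" unfolding T0_def using e by simp
        also have "\<dots> \<le> T * e" using T e by simp
        finally show ?thesis using Tpos by (simp add: field_simps)
      qed
      finally have "\<bar>((sawtooth b (T * d) - sawtooth b (T * c)) / T - b * (d - c)) * k\<bar> \<le> e"
        by (simp add: abs_mult)
      then show "\<bar>integral01 (\<lambda>t. indicator {t. frac (T * t) < b} t *\<^sub>R (indicator {c..d} t *\<^sub>R k))
        - b * integral01 (\<lambda>t. indicator {c..d} t *\<^sub>R k)\<bar> \<le> e"
        unfolding 1 2 by (simp add: algebra_simps)
    qed
  qed
next
  case (add f g)
  show ?case
  proof (intro allI impI)
    fix e :: real assume e: "e > 0"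
    obtain T1 where T1: "T1 > 0" "\<And>T b. T1 \<le> T \<Longrightarrow> 0 \<le> b \<Longrightarrow> b \<le> 1 \<Longrightarrow>
      \<bar>integral01 (\<lambda>t. indicator {t. frac (T * t) < b} t *\<^sub>R f t) - b * integral01 f\<bar> \<le> e/2"
      using add(3)[rule_format, of "e/2"] e by auto
    obtain T2 where T2: "T2 > 0" "\<And>T b. T2 \<le> T \<Longrightarrow> 0 \<le> b \<Longrightarrow> b \<le> 1 \<Longrightarrow>
      \<bar>integral01 (\<lambda>t. indicator {t. frac (T * t) < b} t *\<^sub>R g t) - b * integral01 g\<bar> \<le> e/2"
      using add(4)[rule_format, of "e/2"] e by auto
    show "\<exists>T0>0. \<forall>T\<ge>T0. \<forall>b. 0 \<le> b \<longrightarrow> b \<le> 1 \<longrightarrow>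
      \<bar>integral01 (\<lambda>t. indicator {t. frac (T * t) < b} t *\<^sub>R (f t + g t))
        - b * integral01 (\<lambda>t. f t + g t)\<bar> \<le> e"
    proof (intro exI[of _ "max T1 T2"] conjI allI impI)
      show "max T1 T2 > 0" using T1 by auto
      fix T b :: real assume T: "max T1 T2 \<le> T" and b: "0 \<le> b" "b \<le> 1"
      have "integral01 (\<lambda>t. indicator {t. frac (T * t) < b} t *\<^sub>R (f t + g t)) =
            integral01 (\<lambda>t. indicator {t. frac (T * t) < b} t *\<^sub>R f t) +
            integral01 (\<lambda>t. indicator {t. frac (T * t) < b} t *\<^sub>R g t)"
        unfolding scaleR_add_right
        by (intro Bochner_Integration.integral_add integrable_L01_mult_indicator add frac_less_sets)
      moreover have "integral01 (\<lambda>t. f t + g t) = integral01 f + integral01 g"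
        using add by (intro Bochner_Integration.integral_add)
      ultimately show "\<bar>integral01 (\<lambda>t. indicator {t. frac (T * t) < b} t *\<^sub>R (f t + g t))
        - b * integral01 (\<lambda>t. f t + g t)\<bar> \<le> e"
        using T1(2)[OF _ b, of T] T2(2)[OF _ b, of T] T by (simp only: distrib_left) linarith
    qed
  qed
next
  case (lim f s)
  show ?case
  proof (intro allI impI)
    fix e :: real assume e: "e > 0"
    from order_tendstoD(2)[OF lim(4), of "e/3"] e obtain i where i: "L1norm (\<lambda>t. s i t - f t) < e/3"
      by (auto simp: eventually_sequentially)
    obtain T1 where T1: "T1 > 0" "\<And>T b. T1 \<le> T \<Longrightarrow> 0 \<le> b \<Longrightarrow> b \<le> 1 \<Longrightarrow>
      \<bar>integral01 (\<lambda>t. indicator {t. frac (T * t) < b} t *\<^sub>R s i t) - b * integral01 (s i)\<bar> \<le> e/3"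
      using lim(3)[rule_format, of "e/3" i] e by auto
    show "\<exists>T0>0. \<forall>T\<ge>T0. \<forall>b. 0 \<le> b \<longrightarrow> b \<le> 1 \<longrightarrow>
      \<bar>integral01 (\<lambda>t. indicator {t. frac (T * t) < b} t *\<^sub>R f t) - b * integral01 f\<bar> \<le> e"
    proof (intro exI[of _ T1] conjI allI impI)
      fix T b :: real assume T: "T1 \<le> T" and b: "0 \<le> b" "b \<le> 1"
      let ?A = "{t. frac (T * t) < b}"
      have sf: "integrable L01 (\<lambda>t. s i t - f t)" using lim by auto
      have "integral01 (\<lambda>t. indicator ?A t *\<^sub>R s i t) - integral01 (\<lambda>t. indicator ?A t *\<^sub>R f t)
            = integral01 (\<lambda>t. indicator ?A t *\<^sub>R (s i t - f t))"
        unfolding scaleR_diff_right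
        by (intro Bochner_Integration.integral_diff[symmetric] integrable_L01_mult_indicator lim frac_less_sets)
      then have 1: "\<bar>integral01 (\<lambda>t. indicator ?A t *\<^sub>R s i t) - integral01 (\<lambda>t. indicator ?A t *\<^sub>R f t)\<bar> < e/3"
        using norm_integral_indicator_le[OF sf frac_less_sets[of T b]] i by simp
      have "\<bar>integral01 (s i) - integral01 f\<bar> \<le> L1norm (\<lambda>t. s i t - f t)"
        using norm_integral_le_L1norm[of "\<lambda>t. s i t - f t"] lim by simp
      then have "b * \<bar>integral01 (s i) - integral01 f\<bar> \<le> 1 * (e/3)"
        using b i e by (intro mult_mono) auto
      then have 2: "\<bar>b * integral01 (s i) - b * integral01 f\<bar> \<le> e/3"
        using b by (simp add: abs_mult flip: right_diff_distrib)
      show "\<bar>integral01 (\<lambda>t. indicator ?A t *\<^sub>R f t) - b * integral01 f\<bar> \<le> e"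
        using 1 2 T1(2)[OF T b] by linarith
    qed (use T1 in auto)
  qed
qed

text \<open>Differences of two initial sets give all subintervals of the period. An upper bound
  suffices, as it is applied to norms whose mean over a piece is to be kept small.\<close>

lemma equidistribution_frac:
  fixes f :: "real \<Rightarrow> real"
  assumes f: "integrable L01 f" and e: "e > 0"
  obtains T0 where "\<And>T a b. T0 \<le> T \<Longrightarrow> 0 \<le> a \<Longrightarrow> a \<le> b \<Longrightarrow> b \<le> 1 \<Longrightarrow>
    integral01 (\<lambda>t. indicator {t. a \<le> frac (T * t) \<and> frac (T * t) < b} t *\<^sub>R f t)
      \<le> (b - a) * integral01 f + e"
proof -
  obtain T0 where T0: "\<And>T b. T0 \<le> T \<Longrightarrow> 0 \<le> b \<Longrightarrow> b \<le> 1 \<Longrightarrow>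
      \<bar>integral01 (\<lambda>t. indicator {t. frac (T * t) < b} t *\<^sub>R f t) - b * integral01 f\<bar> \<le> e/2"
    using equidistribution_frac_less[OF f, rule_format, of "e/2"] e by auto
  show ?thesis
  proof (rule that)
    fix T a b :: real assume T: "T0 \<le> T" and ab: "0 \<le> a" "a \<le> b" "b \<le> 1"
    let ?A = "\<lambda>b. {t. frac (T * t) < b}"
    have "integral01 (\<lambda>t. indicator {t. a \<le> frac (T * t) \<and> frac (T * t) < b} t *\<^sub>R f t)
       = integral01 (\<lambda>t. indicator (?A b) t *\<^sub>R f t - indicator (?A a) t *\<^sub>R f t)"
      using ab by (intro Bochner_Integration.integral_cong) (auto simp: indicator_def)
    also have "\<dots> = integral01 (\<lambda>t. indicator (?A b) t *\<^sub>R f t) - integral01 (\<lambda>t. indicator (?A a) t *\<^sub>R f t)"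
      by (intro Bochner_Integration.integral_diff integrable_L01_mult_indicator f frac_less_sets)
    also have "\<dots> \<le> (b - a) * integral01 f + e"
      using T0[OF T, of a] T0[OF T, of b] ab unfolding left_diff_distrib by linarith
    finally show "integral01 (\<lambda>t. indicator {t. a \<le> frac (T * t) \<and> frac (T * t) < b} t *\<^sub>R f t)
      \<le> (b - a) * integral01 f + e" .
  qed
qed

section \<open>Functions determined almost everywhere by their initial integrals\<close>

lemma integral_lebesgue_on_initial:
  fixes u :: "real \<Rightarrow> 'a::{banach,second_countable_topology}"
  assumes "t \<in> I01"
  shows "integral\<^sup>L (lebesgue_on {0..t}) u = integral01 (\<lambda>s. indicator {0..t} s *\<^sub>R u s)"
proof -
  have "indicator {0..t} s *\<^sub>R u s = indicator I01 s *\<^sub>R (indicator {0..t} s *\<^sub>R u s)" for s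
    using assms by (auto simp: indicator_def)
  then have "integral\<^sup>L lebesgue (\<lambda>s. indicator {0..t} s *\<^sub>R u s)
     = integral\<^sup>L lebesgue (\<lambda>s. indicator I01 s *\<^sub>R (indicator {0..t} s *\<^sub>R u s))"
    by (rule Bochner_Integration.integral_cong[OF refl])
  then show ?thesis
    by (subst (1 2) integral_restrict_space) auto
qed

lemma AE_L01_countable: "countable S \<Longrightarrow> AE t in L01. t \<notin> S"
  by (intro AE_L01_null_set countable_imp_null_set_lborel)

text \<open>Behind the almost everywhere uniqueness of second derivatives. Vanishing of the integral
  passes from initial segments to intervals, then to Borel sets and, up to null sets, to Lebesgue
  sets, where \<open>density_zero\<close> applies.\<close>

lemma AE_zero_if_initial_integrals_zero:
  fixes u :: "real \<Rightarrow> 'a::{banach,second_countable_topology}"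
  assumes u: "integrable L01 u"
    and zero: "\<And>t. t \<in> I01 \<Longrightarrow> integral\<^sup>L (lebesgue_on {0..t}) u = 0"
  shows "AE t in L01. u t = 0"
proof (rule sigma_finite_measure.density_zero[OF _ u])
  show "sigma_finite_measure L01"
    using finite_measure_L01 by (simp add: finite_measure_def)
  have zero': "integral01 (\<lambda>s. indicator {0..t} s *\<^sub>R u s) = 0" if "t \<in> I01" for t
    using zero[OF that] unfolding integral_lebesgue_on_initial[OF that] .
  have borel: "integral01 (\<lambda>s. indicator A s *\<^sub>R u s) = 0" if "A \<in> sets borel" for A
    using that
  proof (induction rule: borel_set_induct)
    case empty then show ?case by simp
  next
    case (interval a b)
    define c d where "c = max a 0" and "d = min b 1"
    show ?case
    proof (cases "c \<le> d")
      case False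
      then have "integral01 (\<lambda>s. indicator {a..b} s *\<^sub>R u s) = integral01 (\<lambda>s. 0)"
        by (intro Bochner_Integration.integral_cong) (auto simp: c_def d_def indicator_def)
      then show ?thesis by simp
    next
      case True
      \<comment> \<open>Subtracting \<open>{0..c}\<close> from \<open>{0..d}\<close> also removes
        the point \<open>c\<close>, so the next identity holds only off that point.\<close>
      have "AE s in L01. s \<notin> {c}" by (rule AE_L01_countable) simp
      then have ae: "AE s in L01. indicator {a..b} s *\<^sub>R u s = indicator {0..d} s *\<^sub>R u s - indicator {0..c} s *\<^sub>R u s"
        using AE_space
        by eventually_elim (use True in \<open>auto simp: c_def d_def indicator_def\<close>)
      have cd: "c \<in> I01" "d \<in> I01" using True by (auto simp: c_def d_def)
      have "integral01 (\<lambda>s. indicator {a..b} s *\<^sub>R u s)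
          = integral01 (\<lambda>s. indicator {0..d} s *\<^sub>R u s - indicator {0..c} s *\<^sub>R u s)"
        using ae
        by (rule integral_cong_AE[rotated 2])
          (auto intro!: borel_measurable_integrable Bochner_Integration.integrable_diff
             integrable_L01_mult_indicator u simp del: indicator_scaleR_eq_if)
      also have "\<dots> = 0"
        using zero'[OF cd(1)] zero'[OF cd(2)]
        by (subst Bochner_Integration.integral_diff) (auto intro!: integrable_L01_mult_indicator u simp del: indicator_scaleR_eq_if)
      finally show ?thesis .
    qed
  next
    case (compl A)
    have "integral01 (\<lambda>s. indicator (- A) s *\<^sub>R u s)
        = integral01 (\<lambda>s. indicator {0..1} s *\<^sub>R u s - indicator A s *\<^sub>R u s)"
      by (intro Bochner_Integration.integral_cong) (auto simp: indicator_def)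
    also have "\<dots> = integral01 (\<lambda>s. indicator {0..1} s *\<^sub>R u s) - integral01 (\<lambda>s. indicator A s *\<^sub>R u s)"
      using compl(1) by (intro Bochner_Integration.integral_diff integrable_L01_mult_indicator u) auto
    finally show ?case using zero'[of 1] compl by simp
  next
    case (union A)
    have "(\<lambda>n. integral01 (\<lambda>s. indicator (\<Union>i<n. A i) s *\<^sub>R u s)) \<longlonglongrightarrow>
            integral01 (\<lambda>s. indicator (\<Union>i. A i) s *\<^sub>R u s)"
    proof (rule integral_dominated_convergence[where w="\<lambda>s. norm (u s)"])
      show "AE s in L01. (\<lambda>n. indicator (\<Union>i<n. A i) s *\<^sub>R u s) \<longlonglongrightarrow> indicator (\<Union>i. A i) s *\<^sub>R u s"
        by (intro AE_I2 tendsto_scaleR tendsto_const LIMSEQ_indicator_UN)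
      show "AE s in L01. norm (indicator (\<Union>i<n. A i) s *\<^sub>R u s) \<le> norm (u s)" for n
        by (auto simp: indicator_def)
      show "(\<lambda>s. indicator (\<Union>i. A i) s *\<^sub>R u s) \<in> borel_measurable L01"
        using union by (intro borel_measurable_integrable[OF integrable_L01_mult_indicator[OF u]]) auto
      show "(\<lambda>s. indicator (\<Union>i<n. A i) s *\<^sub>R u s) \<in> borel_measurable L01" for n
        using union by (intro borel_measurable_integrable[OF integrable_L01_mult_indicator[OF u]]) auto
    qed (use u in auto)
    moreover have "integral01 (\<lambda>s. indicator (\<Union>i<n. A i) s *\<^sub>R u s) = 0" for n
    proof -
      have "indicator (\<Union>i<n. A i) s *\<^sub>R u s = (\<Sum>i<n. indicator (A i) s *\<^sub>R u s)" for s
      proof -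
        have "indicator (\<Union>i<n. A i) s = (\<Sum>i<n. indicator (A i) s :: real)"
          using union(1) by (intro indicator_UN_disjoint) (auto simp: disjoint_family_on_def)
        then show ?thesis by (simp add: scaleR_sum_left)
      qed
      then have "integral01 (\<lambda>s. indicator (\<Union>i<n. A i) s *\<^sub>R u s)
         = (\<Sum>i<n. integral01 (\<lambda>s. indicator (A i) s *\<^sub>R u s))"
        by (simp only:) (intro Bochner_Integration.integral_sum integrable_L01_mult_indicator u union(2))
      then show ?thesis using union(3) by simp
    qed
    ultimately show ?case by (simp only: LIMSEQ_const_iff)
  qed
  fix A assume "A \<in> sets L01"
  then obtain S where S: "S \<in> sets borel" "AE t in L01. indicator S t = (indicator A t :: real)"
    by (rule L01_set_AE_borel)
  have "AE t in L01. indicator A t *\<^sub>R u t = indicator S t *\<^sub>R u t"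
    using S(2) by eventually_elim simp
  moreover have "(\<lambda>t. indicator A t *\<^sub>R u t) \<in> borel_measurable L01"
    using \<open>A \<in> sets L01\<close> u by (intro borel_measurable_scaleR borel_measurable_indicator) auto
  moreover have "(\<lambda>t. indicator S t *\<^sub>R u t) \<in> borel_measurable L01"
    by (rule borel_measurable_integrable[OF integrable_L01_mult_indicator[OF u S(1)]])
  ultimately have "integral01 (\<lambda>t. indicator A t *\<^sub>R u t) = integral01 (\<lambda>t. indicator S t *\<^sub>R u t)"
    by (intro integral_cong_AE)
  then show "set_lebesgue_integral L01 A u = 0"
    using borel[OF S(1)] by (simp add: set_lebesgue_integral_def)
qed

section \<open>Approximate selections\<close>

text \<open>\<open>D t x y\<close> abstracts the distance of \<open>y\<close> to \<open>F t x\<close>, and \<open>T h\<close> the solution of the linear problem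
  with right-hand side \<open>h\<close>.\<close>

locale L1_inclusion =
  fixes D :: "real \<Rightarrow> 'a::{banach,second_countable_topology} \<Rightarrow> 'a \<Rightarrow> real"
    and T :: "(real \<Rightarrow> 'a) \<Rightarrow> real \<Rightarrow> 'a"
    and \<mu> \<alpha> :: "real \<Rightarrow> real" and g C0 :: real
  assumes D_nonneg: "0 \<le> D t x y"
    and D_measurable: "(\<lambda>t. D t x y) \<in> borel_measurable L01"
    and D_lipschitz: "t \<in> I01 \<Longrightarrow> D t x y \<le> D t x' y' + norm (y - y') + \<mu> t * norm (x - x')"
    and D_approx: "t \<in> I01 \<Longrightarrow> 0 < e \<Longrightarrow> \<exists>y'. norm (y' - y) < D t x y + e \<and> D t x y' < e"
    and \<mu>_nonneg: "0 \<le> \<mu> t" and \<mu>_int: "integrable L01 \<mu>"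
    and \<alpha>_int: "integrable L01 \<alpha>" and D_0: "AE t in L01. D t 0 0 \<le> \<alpha> t"
    and T_measurable: "integrable L01 h \<Longrightarrow> T h \<in> borel_measurable L01"
    and T_lipschitz: "integrable L01 h \<Longrightarrow> integrable L01 h' \<Longrightarrow> t \<in> I01 \<Longrightarrow>
          norm (T h t - T h' t) \<le> g * L1norm (\<lambda>t. h t - h' t)"
    and T_0: "t \<in> I01 \<Longrightarrow> norm (T (\<lambda>t. 0) t) \<le> C0"
    and g_nonneg: "0 \<le> g"
    and contraction: "integral01 \<mu> * g < 1"
begin

definition residual :: "(real \<Rightarrow> 'a) \<Rightarrow> real" where
  "residual h = integral01 (\<lambda>t. D t (T h t) (h t))"

text \<open>\<open>D\<close> is a Caratheodory function: measurable in \<open>t\<close> for fixed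
  arguments, continuous in the arguments. Along simple functions measurability is a countable case
  distinction, and the Lipschitz bound carries it over to pointwise limits.\<close>

lemma D_superposition_measurable:
  assumes "x \<in> borel_measurable L01" "y \<in> borel_measurable L01"
  shows "(\<lambda>t. D t (x t) (y t)) \<in> borel_measurable L01"
proof -
  obtain r where r: "\<And>i. simple_function L01 (r i)" "\<And>t. t \<in> I01 \<Longrightarrow> (\<lambda>i. r i t) \<longlonglongrightarrow> x t"
    using borel_measurable_implies_sequence_metric[OF assms(1), of 0] by (auto simp del: atLeastAtMost_iff)
  obtain s where s: "\<And>i. simple_function L01 (s i)" "\<And>t. t \<in> I01 \<Longrightarrow> (\<lambda>i. s i t) \<longlonglongrightarrow> y t"
    using borel_measurable_implies_sequence_metric[OF assms(2), of 0] by (auto simp del: atLeastAtMost_iff)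
  show ?thesis
  proof (rule borel_measurable_LIMSEQ_real)
    fix i
    have p: "simple_function L01 (\<lambda>t. (r i t, s i t))" using r s by (intro simple_function_Pair) auto
    let ?I = "(\<lambda>t. (r i t, s i t)) ` space L01"
    have fin: "finite ?I" using p by (rule simple_functionD)
    have "(\<lambda>t. (r i t, s i t)) \<in> measurable L01 (count_space ?I)"
      using p unfolding measurable_count_space_eq2[OF fin] simple_function_def by auto
    then have "(\<lambda>t. (\<lambda>p t. D t (fst p) (snd p)) (r i t, s i t) t) \<in> borel_measurable L01"
      by (rule measurable_compose_countable'[rotated])
        (use D_measurable fin in \<open>auto intro: countable_finite\<close>)
    then show "(\<lambda>t. D t (r i t) (s i t)) \<in> borel_measurable L01" by simp
  next
    fix t assume "t \<in> space L01"
    then have t: "t \<in> I01" by simp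
    have lim: "(\<lambda>i. norm (s i t - y t) + \<mu> t * norm (r i t - x t)) \<longlonglongrightarrow> 0 + \<mu> t * 0"
      using r(2)[OF t] s(2)[OF t] by (intro tendsto_intros tendsto_norm_zero LIM_zero)
    have bd: "norm (D t (r i t) (s i t) - D t (x t) (y t))
         \<le> norm (norm (s i t - y t) + \<mu> t * norm (r i t - x t))" for i
      using D_lipschitz[OF t, of "r i t" "s i t" "x t" "y t"]
        D_lipschitz[OF t, of "x t" "y t" "r i t" "s i t"] \<mu>_nonneg[of t]
      by (simp add: norm_minus_commute)
    have "(\<lambda>i. D t (r i t) (s i t) - D t (x t) (y t)) \<longlonglongrightarrow> 0"
    proof (rule Lim_transform_bound)
      show "(\<lambda>i. norm (s i t - y t) + \<mu> t * norm (r i t - x t)) \<longlonglongrightarrow> 0" using lim by simp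
    qed (intro always_eventually allI bd)
    then show "(\<lambda>i. D t (r i t) (s i t)) \<longlonglongrightarrow> D t (x t) (y t)" by (rule LIM_zero_cancel)
  qed
qed

lemma T_bounded:
  assumes "integrable L01 h" "t \<in> I01"
  shows "norm (T h t) \<le> C0 + g * L1norm h"
proof -
  have "norm (T h t) \<le> norm (T (\<lambda>t. 0) t) + norm (T h t - T (\<lambda>t. 0) t)"
    using norm_triangle_sub by blast
  then show ?thesis using T_lipschitz[OF assms(1) _ assms(2), of "\<lambda>t. 0"] T_0[OF assms(2)] by simp
qed

lemma D_integrable:
  assumes x: "x \<in> borel_measurable L01" "\<And>t. t \<in> I01 \<Longrightarrow> norm (x t) \<le> K" and y: "integrable L01 y"
  shows "integrable L01 (\<lambda>t. D t (x t) (y t))"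
proof (rule Bochner_Integration.integrable_bound)
  show "integrable L01 (\<lambda>t. \<alpha> t + norm (y t) + \<mu> t * K)"
    using \<alpha>_int \<mu>_int y by auto
  show "(\<lambda>t. D t (x t) (y t)) \<in> borel_measurable L01"
    using D_superposition_measurable x y by auto
  show "AE t in L01. norm (D t (x t) (y t)) \<le> norm (\<alpha> t + norm (y t) + \<mu> t * K)"
    using D_0 AE_space
  proof eventually_elim
    case (elim t)
    then have t: "t \<in> I01" by simp
    have "D t (x t) (y t) \<le> D t 0 0 + norm (y t) + \<mu> t * norm (x t)"
      using D_lipschitz[OF t, of "x t" "y t" 0 0] by simp
    moreover have "\<mu> t * norm (x t) \<le> \<mu> t * K" using x(2)[OF t] \<mu>_nonneg by (intro mult_left_mono)
    ultimately have "D t (x t) (y t) \<le> \<alpha> t + norm (y t) + \<mu> t * K" using elim by linarith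
    then show ?case using D_nonneg[of t "x t" "y t"] by simp
  qed
qed

lemma D_T_integrable:
  assumes "integrable L01 h" "integrable L01 y"
  shows "integrable L01 (\<lambda>t. D t (T h t) (y t))"
  by (rule D_integrable[OF T_measurable[OF assms(1)] T_bounded[OF assms(1)] assms(2)])

lemma residual_nonneg: "0 \<le> residual h"
  unfolding residual_def by (intro integral_nonneg_AE) (auto simp: D_nonneg)

lemma residual_eq_0_iff:
  assumes "integrable L01 h"
  shows "residual h = 0 \<longleftrightarrow> (AE t in L01. D t (T h t) (h t) = 0)"
  unfolding residual_def
  using D_T_integrable[OF assms assms] by (intro integral_nonneg_eq_0_iff_AE) (auto simp: D_nonneg)

text \<open>The constant is \<open>1 + integral01 \<mu> * g\<close>, rounded up to 2: the first part
  comes from moving the point \<open>h t\<close>, the second from moving the set through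
  \<open>T h t\<close>.\<close>

lemma residual_lipschitz:
  assumes h: "integrable L01 h" "integrable L01 h'"
  shows "residual h \<le> residual h' + 2 * L1norm (\<lambda>t. h t - h' t)"
proof -
  define n where "n = L1norm (\<lambda>t. h t - h' t)"
  have "residual h \<le> integral01 (\<lambda>t. D t (T h' t) (h' t) + norm (h t - h' t) + \<mu> t * (g * n))"
    unfolding residual_def
  proof (rule integral_mono)
    show "integrable L01 (\<lambda>t. D t (T h' t) (h' t) + norm (h t - h' t) + \<mu> t * (g * n))"
      using D_T_integrable[OF h(2) h(2)] h \<mu>_int by auto
    fix t assume "t \<in> space L01"
    then have t: "t \<in> I01" by simp
    have "\<mu> t * norm (T h t - T h' t) \<le> \<mu> t * (g * n)"
      using T_lipschitz[OF h t] \<mu>_nonneg by (intro mult_left_mono) (auto simp: n_def)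
    then show "D t (T h t) (h t) \<le> D t (T h' t) (h' t) + norm (h t - h' t) + \<mu> t * (g * n)"
      using D_lipschitz[OF t, of "T h t" "h t" "T h' t" "h' t"] by linarith
  qed (rule D_T_integrable[OF h(1) h(1)])
  also have "\<dots> = residual h' + n + integral01 \<mu> * g * n"
    using D_T_integrable[OF h(2) h(2)] h \<mu>_int by (simp add: residual_def n_def L1norm_def)
  also have "\<dots> \<le> residual h' + n + 1 * n"
    using contraction by (intro add_left_mono mult_right_mono) (auto simp: n_def)
  finally show ?thesis by (simp add: n_def)
qed

text \<open>A dense sequence does the work of a selection theorem. As \<open>v t\<close> only has to
  come close to the set, it can be the first member of the sequence that satisfies two measurable
  conditions.\<close>

lemma approximate_selection:
  assumes h: "integrable L01 h" and e: "0 < e"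
  shows "\<exists>v. integrable L01 v \<and>
    (\<forall>t\<in>I01. norm (v t - h t) \<le> D t (T h t) (h t) + e \<and> D t (T h t) (v t) \<le> e)"
proof -
  obtain A :: "'a set" where A: "countable A" "\<And>X. open X \<Longrightarrow> X \<noteq> {} \<Longrightarrow> \<exists>d\<in>A. d \<in> X"
    by (erule countable_dense_setE)
  have "A \<noteq> {}" using A(2)[of UNIV] by auto
  define d where "d = from_nat_into A"
  have d: "\<exists>k. norm (d k - y) < r" if r: "0 < r" for y r
  proof -
    obtain a where a: "a \<in> A" "a \<in> ball y r" using A(2)[of "ball y r"] r by auto
    obtain k where "d k = a" using from_nat_into_surj[OF A(1) a(1)] by (auto simp: d_def)
    then show ?thesis using a(2) by (auto simp: dist_norm norm_minus_commute)
  qed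
  define Q where "Q t k \<longleftrightarrow> norm (d k - h t) \<le> D t (T h t) (h t) + e \<and> D t (T h t) (d k) \<le> e" for t k
  define v where "v t = d (LEAST k. Q t k)" for t
  have Q: "Q t (LEAST k. Q t k)" if t: "t \<in> I01" for t
  proof (rule LeastI_ex)
    \<comment> \<open>Half of the tolerance is kept for replacing \<open>y\<close> by a member of
      the dense sequence.\<close>
    obtain y where y: "norm (y - h t) < D t (T h t) (h t) + e/2" "D t (T h t) y < e/2"
      using D_approx[OF t, of "e/2"] e by auto
    obtain k where k: "norm (d k - y) < e/2" using d[of "e/2" y] e by auto
    have "norm (d k - h t) \<le> norm (d k - y) + norm (y - h t)" by (metis norm_triangle_ineq diff_add_cancel add_diff_eq)
    moreover have "D t (T h t) (d k) \<le> D t (T h t) y + norm (d k - y)"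
      using D_lipschitz[OF t, of "T h t" "d k" "T h t" y] by simp
    ultimately have "Q t k" unfolding Q_def using y k by linarith
    then show "\<exists>k. Q t k" ..
  qed
  have hm: "h \<in> borel_measurable L01" using h by auto
  have [measurable]: "(\<lambda>t. D t (T h t) (d k)) \<in> borel_measurable L01" for k
    using h by (intro D_superposition_measurable T_measurable) auto
  have [measurable]: "(\<lambda>t. D t (T h t) (h t)) \<in> borel_measurable L01"
    using h by (intro D_superposition_measurable T_measurable) auto
  have [measurable]: "(\<lambda>t. norm (d k - h t)) \<in> borel_measurable L01" for k
    using hm by measurable
  have "Measurable.pred L01 (\<lambda>t. Q t k)" for k unfolding Q_def by measurable
  then have "(\<lambda>t. LEAST k. Q t k) \<in> measurable L01 (count_space UNIV)" by measurable
  then have v_meas: "v \<in> borel_measurable L01"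
    unfolding v_def[abs_def] by (rule measurable_compose_countable[rotated]) auto
  have v: "norm (v t - h t) \<le> D t (T h t) (h t) + e \<and> D t (T h t) (v t) \<le> e" if "t \<in> I01" for t
    using Q[OF that] unfolding Q_def v_def by auto
  have "integrable L01 v"
  proof (rule Bochner_Integration.integrable_bound)
    show "integrable L01 (\<lambda>t. norm (h t) + D t (T h t) (h t) + e)"
      using h D_T_integrable[OF h h] by auto
    show "AE t in L01. norm (v t) \<le> norm (norm (h t) + D t (T h t) (h t) + e)"
    proof (rule AE_I2)
      fix t assume "t \<in> space L01"
      then have "norm (v t - h t) \<le> D t (T h t) (h t) + e" using v by auto
      moreover have "norm (v t) \<le> norm (h t) + norm (v t - h t)" by (rule norm_triangle_sub)
      ultimately show "norm (v t) \<le> norm (norm (h t) + D t (T h t) (h t) + e)" by simp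
    qed
  qed (rule v_meas)
  then show ?thesis using v by blast
qed

end

section \<open>The patching map\<close>

text \<open>The radius \<open>\<delta> k\<close> is proportional to the residual at the centre, so
  that all errors become multiples of \<open>\<eta>\<close> times the residual; the cap 1 makes the
  series \<open>\<sigma>\<close> converge. The error allowed in \<open>B_equi\<close> is summable
  over \<open>k\<close>, so its total does not grow with the number of active pieces.\<close>

locale L1_step = L1_inclusion D T \<mu> \<alpha> g C0
  for D :: "real \<Rightarrow> 'a::{banach,second_countable_topology} \<Rightarrow> 'a \<Rightarrow> real"
    and T :: "(real \<Rightarrow> 'a) \<Rightarrow> real \<Rightarrow> 'a"
    and \<mu> \<alpha> :: "real \<Rightarrow> real" and g C0 :: real +
  fixes \<eta> :: real and \<psi> v :: "nat \<Rightarrow> real \<Rightarrow> 'a" and \<delta> B :: "nat \<Rightarrow> real"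
  assumes eta: "0 < \<eta>" "\<eta> \<le> 1/48"
    and \<psi>_int: "integrable L01 (\<psi> k)"
    and \<psi>_dense: "integrable L01 f \<Longrightarrow> 0 < e \<Longrightarrow> \<exists>k. L1norm (\<lambda>t. f t - \<psi> k t) < e"
    and \<delta>: "\<delta> k = min 1 (\<eta> * residual (\<psi> k))"
    and v_int: "integrable L01 (v k)"
    and v_near: "0 < \<delta> k \<Longrightarrow> t \<in> I01 \<Longrightarrow> norm (v k t - \<psi> k t) \<le> D t (T (\<psi> k) t) (\<psi> k t) + \<delta> k"
    and v_D: "0 < \<delta> k \<Longrightarrow> t \<in> I01 \<Longrightarrow> D t (T (\<psi> k) t) (v k t) \<le> \<delta> k"
    and B_ge: "1 \<le> B k" "real k \<le> B k" and B_mono: "i \<le> j \<Longrightarrow> B i \<le> B j"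
    and B_equi: "0 < \<delta> k \<Longrightarrow> B k \<le> \<tau>' \<Longrightarrow> B j \<le> \<tau>' \<Longrightarrow> 0 \<le> a \<Longrightarrow> a \<le> b \<Longrightarrow> b \<le> 1 \<Longrightarrow>
      integral01 (\<lambda>t. indicator {t. a \<le> frac (\<tau>' * t) \<and> frac (\<tau>' * t) < b} t *\<^sub>R norm (\<psi> k t - \<psi> j t))
        \<le> (b - a) * L1norm (\<lambda>t. \<psi> k t - \<psi> j t) + \<delta> k * (1/2) ^ Suc k"
begin

text \<open>The functions \<open>weight k\<close> form an unnormalised locally finite partition of unity on the set
  \<open>residual h > 0\<close>. The threshold \<open>B k\<close> is a frequency from which on the oscillating sets are well
  distributed with respect to the first \<open>k\<close> functions \<open>\<psi>\<close>; since \<open>weight k h > 0\<close> forces \<open>B k < \<tau> h\<close>,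
  the frequency \<open>\<tau> h\<close> is high enough for all active indices, and there are finitely many of them
  because \<open>B k \<ge> k\<close>. Conversely, for the least \<open>k\<close> with \<open>bump k h > 0\<close> the definition of \<open>\<sigma>\<close> gives
  \<open>\<sigma> h \<le> 2 / B k\<close>, hence \<open>B k < \<tau> h\<close>, so some weight is positive.\<close>

definition bump :: "nat \<Rightarrow> (real \<Rightarrow> 'a) \<Rightarrow> real" where
  "bump k h = max 0 (\<delta> k - L1norm (\<lambda>t. h t - \<psi> k t))"

definition \<sigma> :: "(real \<Rightarrow> 'a) \<Rightarrow> real" where
  "\<sigma> h = (\<Sum>k. (1/2) ^ k / B k * bump k h)"

definition \<tau> :: "(real \<Rightarrow> 'a) \<Rightarrow> real" where
  "\<tau> h = 3 / \<sigma> h"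

definition weight :: "nat \<Rightarrow> (real \<Rightarrow> 'a) \<Rightarrow> real" where
  "weight k h = bump k h * max 0 (\<tau> h - B k)"

definition psum :: "nat \<Rightarrow> (real \<Rightarrow> 'a) \<Rightarrow> real" where
  "psum n h = (\<Sum>j<n. weight j h)"

text \<open>By \<open>B_ge\<close> the weights from index \<open>\<tau> h\<close> on are 0, so this
  is the sum of all weights. The cut-off jumps with \<open>h\<close>, the value of the sum does
  not.\<close>

definition total :: "(real \<Rightarrow> 'a) \<Rightarrow> real" where
  "total h = psum (nat \<lceil>\<tau> h\<rceil>) h"

text \<open>Scaling the position within the period by \<open>total h\<close> takes the place of
  normalising the weights.\<close>

definition piece :: "(real \<Rightarrow> 'a) \<Rightarrow> real \<Rightarrow> nat" where
  "piece h t = (LEAST k. frac (\<tau> h * t) * total h < psum (Suc k) h)"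

text \<open>Where the residual of an integrable \<open>h\<close> vanishes, all bumps vanish too and
  there is nothing to patch with. Continuity at such points comes from the distance estimate for the
  step, not from the partition.\<close>

definition step :: "(real \<Rightarrow> 'a) \<Rightarrow> real \<Rightarrow> 'a" where
  "step h = (if residual h = 0 then h else (\<lambda>t. v (piece h t) t))"

lemma B_pos: "0 < B k" using B_ge(1)[of k] by linarith

lemma \<delta>_bounds: "0 \<le> \<delta> k" "\<delta> k \<le> 1" "\<delta> k \<le> \<eta> * residual (\<psi> k)"
  using eta residual_nonneg[of "\<psi> k"] by (auto simp: \<delta>)

lemma bump_bounds: "0 \<le> bump k h" "bump k h \<le> 1"
  using \<delta>_bounds[of k] L1norm_nonneg[of "\<lambda>t. h t - \<psi> k t"] unfolding bump_def by linarith+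

lemma bump_posD:
  assumes "0 < bump k h"
  shows "0 < \<delta> k" "L1norm (\<lambda>t. h t - \<psi> k t) < \<delta> k"
  using assms L1norm_nonneg[of "\<lambda>t. h t - \<psi> k t"] unfolding bump_def by linarith+

lemma bump_lipschitz:
  assumes "integrable L01 h" "integrable L01 h'"
  shows "\<bar>bump k h - bump k h'\<bar> \<le> L1norm (\<lambda>t. h t - h' t)"
  using L1norm_triangle[OF assms \<psi>_int[of k]] L1norm_triangle[OF assms(2,1) \<psi>_int[of k]]
    L1norm_commute[of h h'] unfolding bump_def by linarith

lemma coeff_bounds: "0 \<le> (1/2) ^ k / B k" "(1/2) ^ k / B k \<le> (1/2) ^ k"
  using B_ge(1)[of k] B_pos[of k] by (auto simp: field_simps)

lemma half_sums: "(\<lambda>k. (1/2 :: real) ^ k) sums 2"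
  using geometric_sums[of "1/2 :: real"] by simp

lemma \<sigma>_summable: "summable (\<lambda>k. (1/2) ^ k / B k * bump k h)"
proof (rule summable_comparison_test'[where g="\<lambda>k. (1/2) ^ k" and N=0])
  show "summable (\<lambda>k. (1/2 :: real) ^ k)" using half_sums by (simp add: sums_iff)
  fix k
  have "(1/2) ^ k / B k * bump k h \<le> (1/2) ^ k * 1"
    using coeff_bounds[of k] bump_bounds[of k h] by (intro mult_mono) auto
  moreover have "0 \<le> (1/2) ^ k / B k * bump k h"
    using coeff_bounds[of k] bump_bounds[of k h] by (intro mult_nonneg_nonneg)
  ultimately show "norm ((1/2) ^ k / B k * bump k h) \<le> (1/2) ^ k"
    by (simp only: real_norm_def abs_of_nonneg mult_1_right)
qed

lemma \<sigma>_lipschitz: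
  assumes h: "integrable L01 h" "integrable L01 h'"
  shows "\<bar>\<sigma> h - \<sigma> h'\<bar> \<le> 2 * L1norm (\<lambda>t. h t - h' t)"
proof -
  define n where "n = L1norm (\<lambda>t. h t - h' t)"
  have sm: "(\<lambda>k. (1/2) ^ k * n) sums (2 * n)" by (rule sums_mult2[OF half_sums])
  have "\<sigma> h - \<sigma> h' = (\<Sum>k. (1/2) ^ k / B k * bump k h - (1/2) ^ k / B k * bump k h')"
    unfolding \<sigma>_def by (rule suminf_diff[OF \<sigma>_summable \<sigma>_summable])
  moreover have "norm (\<Sum>k. (1/2) ^ k / B k * bump k h - (1/2) ^ k / B k * bump k h') \<le> (\<Sum>k. (1/2) ^ k * n)"
  proof (rule norm_suminf_le)
    show "summable (\<lambda>k. (1/2) ^ k * n)" using sm by (simp add: sums_iff)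
    fix k
    have "norm ((1/2) ^ k / B k * bump k h - (1/2) ^ k / B k * bump k h')
       = (1/2) ^ k / B k * \<bar>bump k h - bump k h'\<bar>"
      using coeff_bounds(1)[of k] by (simp only: right_diff_distrib[symmetric] real_norm_def abs_mult abs_of_nonneg)
    also have "\<dots> \<le> (1/2) ^ k * n"
      using coeff_bounds[of k] bump_lipschitz[OF h, of k] by (intro mult_mono) (auto simp: n_def)
    finally show "norm ((1/2) ^ k / B k * bump k h - (1/2) ^ k / B k * bump k h') \<le> (1/2) ^ k * n" .
  qed
  ultimately show ?thesis using sm by (simp add: sums_iff n_def)
qed

lemma \<sigma>_le:
  assumes "\<And>j. j < k \<Longrightarrow> bump j h = 0"
  shows "\<sigma> h \<le> 2 / B k"
proof -
  have sm: "(\<lambda>j. (1/2) ^ j * (1 / B k)) sums (2 * (1 / B k))" by (rule sums_mult2[OF half_sums])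
  have "\<sigma> h \<le> (\<Sum>j. (1/2) ^ j * (1 / B k))"
    unfolding \<sigma>_def
  proof (rule suminf_le[OF _ \<sigma>_summable])
    show "summable (\<lambda>j. (1/2) ^ j * (1 / B k))" using sm by (simp add: sums_iff)
    fix j
    show "(1/2) ^ j / B j * bump j h \<le> (1/2) ^ j * (1 / B k)"
    proof (cases "j < k")
      case True
      then show ?thesis using assms B_pos[of k] by simp
    next
      case False
      then have "1 / B j \<le> 1 / B k" using B_mono[of k j] B_pos[of k] by (intro divide_left_mono) auto
      then have "(1/2) ^ j * (1 / B j) * bump j h \<le> (1/2) ^ j * (1 / B k) * 1"
        using bump_bounds[of j h] B_pos[of j] B_pos[of k] by (intro mult_mono mult_left_mono) auto
      then show ?thesis by simp
    qed
  qed
  then show ?thesis using sm by (simp add: sums_iff)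
qed

section \<open>One step at a function of positive residual\<close>

context
  fixes h :: "real \<Rightarrow> 'a"
  assumes h_int: "integrable L01 h" and h_pos: "0 < residual h"
begin

lemma ex_bump_pos: "\<exists>k. 0 < bump k h"
proof -
  \<comment> \<open>Small enough for every \<open>\<psi> k\<close> within \<open>c\<close> of
    \<open>h\<close> to keep more than half of the residual of \<open>h\<close>; then its radius
    exceeds \<open>c\<close>.\<close>
  define c where "c = min (1/2) (\<eta> / 2 * residual h)"
  have c: "0 < c" using eta h_pos by (simp add: c_def)
  obtain k where k: "L1norm (\<lambda>t. h t - \<psi> k t) < c" using \<psi>_dense[OF h_int c] by blast
  have "residual h \<le> residual (\<psi> k) + 2 * c"
    using residual_lipschitz[OF h_int \<psi>_int[of k]] k by linarith
  moreover have "2 * c \<le> \<eta> * residual h" by (simp add: c_def)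
  moreover have "\<eta> * residual h \<le> 1/48 * residual h" using eta h_pos by (intro mult_right_mono) auto
  ultimately have "residual h / 2 < residual (\<psi> k)" using h_pos by linarith
  then have "\<eta> * (residual h / 2) < \<eta> * residual (\<psi> k)" using eta by (intro mult_strict_left_mono) auto
  then have "c < \<delta> k" unfolding \<delta> c_def by (auto simp: min_less_iff_disj)
  then have "0 < bump k h" unfolding bump_def using k by linarith
  then show ?thesis ..
qed

lemma \<sigma>_pos: "0 < \<sigma> h"
proof -
  obtain k where k: "0 < bump k h" using ex_bump_pos by blast
  show ?thesis unfolding \<sigma>_def
  proof (rule suminf_pos2[OF \<sigma>_summable, of _ k])
    show "0 \<le> (1/2) ^ n / B n * bump n h" for n
      using coeff_bounds bump_bounds by (intro mult_nonneg_nonneg)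
    show "0 < (1/2) ^ k / B k * bump k h"
      using k B_pos by (intro mult_pos_pos divide_pos_pos) auto
  qed
qed

lemma weight_nonneg: "0 \<le> weight k h"
  unfolding weight_def using bump_bounds[of k h] by (intro mult_nonneg_nonneg) auto

lemma weight_posD:
  assumes "0 < weight k h"
  shows "0 < bump k h" "B k < \<tau> h"
  using assms bump_bounds[of k h] unfolding weight_def by (auto simp: zero_less_mult_iff)

lemma ex_weight_pos: "\<exists>k. 0 < weight k h"
proof -
  define k where "k = (LEAST k. 0 < bump k h)"
  have k: "0 < bump k h" unfolding k_def using ex_bump_pos by (rule LeastI_ex)
  have "bump j h = 0" if "j < k" for j
    using not_less_Least[OF that[unfolded k_def]] bump_bounds[of j h] by linarith
  then have "\<sigma> h \<le> 2 / B k" by (rule \<sigma>_le)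
  then have "\<sigma> h * B k \<le> 2" using B_pos[of k] by (simp add: field_simps)
  \<comment> \<open>The 3 in the definition of \<open>\<tau>\<close>, against the 2 in
    \<open>\<sigma>_le\<close>, makes this inequality strict.\<close>
  then have "B k < \<tau> h" unfolding \<tau>_def using \<sigma>_pos by (simp add: field_simps)
  then have "0 < weight k h" unfolding weight_def using k by simp
  then show ?thesis ..
qed

lemma psum_eq_total:
  assumes "\<tau> h \<le> real n"
  shows "psum n h = total h"
proof -
  have le: "nat \<lceil>\<tau> h\<rceil> \<le> n" using assms by linarith
  have z: "weight j h = 0" if "nat \<lceil>\<tau> h\<rceil> \<le> j" for j
  proof -
    have "\<tau> h \<le> real j" using that by linarith
    then have "\<tau> h \<le> B j" using B_ge(2)[of j] by linarith
    then show ?thesis unfolding weight_def by simp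
  qed
  have "psum n h = (\<Sum>j\<in>{..<nat \<lceil>\<tau> h\<rceil>}. weight j h)"
    unfolding psum_def using le z by (intro sum.mono_neutral_right) auto
  then show ?thesis by (simp add: total_def psum_def)
qed

lemma psum_mono: "m \<le> n \<Longrightarrow> psum m h \<le> psum n h"
  unfolding psum_def by (intro sum_mono2) (auto simp: weight_nonneg)

lemma psum_nonneg: "0 \<le> psum n h"
  unfolding psum_def by (intro sum_nonneg weight_nonneg)

lemma psum_le_total: "psum n h \<le> total h"
proof -
  define m where "m = max n (nat \<lceil>\<tau> h\<rceil>)"
  have "\<tau> h \<le> real m" unfolding m_def by linarith
  then show ?thesis using psum_mono[of n m] psum_eq_total by (simp add: m_def)
qed

lemma total_pos: "0 < total h"
proof -
  obtain k where k: "0 < weight k h" using ex_weight_pos by blast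
  have "weight k h \<le> psum (Suc k) h"
    using psum_nonneg[of k] by (simp add: psum_def)
  then show ?thesis using k psum_le_total[of "Suc k"] by linarith
qed

lemma piece_bounds:
  "psum (piece h t) h \<le> frac (\<tau> h * t) * total h"
  "frac (\<tau> h * t) * total h < psum (Suc (piece h t)) h"
proof -
  define n where "n = nat \<lceil>\<tau> h\<rceil>"
  have "\<tau> h \<le> real (Suc n)" unfolding n_def by linarith
  then have n: "psum (Suc n) h = total h" by (rule psum_eq_total)
  have "frac (\<tau> h * t) * total h < 1 * total h"
    using total_pos frac_lt_1 by (intro mult_strict_right_mono)
  then have ex: "\<exists>k. frac (\<tau> h * t) * total h < psum (Suc k) h" using n by (intro exI[of _ n]) simp
  show "frac (\<tau> h * t) * total h < psum (Suc (piece h t)) h"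
    unfolding piece_def using ex by (rule LeastI_ex)
  show "psum (piece h t) h \<le> frac (\<tau> h * t) * total h"
  proof (cases "piece h t")
    case 0
    have "0 \<le> frac (\<tau> h * t) * total h" using total_pos by (intro mult_nonneg_nonneg) auto
    then show ?thesis using 0 by (simp add: psum_def)
  next
    case (Suc k)
    then have "k < piece h t" by simp
    from not_less_Least[OF this[unfolded piece_def]] show ?thesis using Suc by simp
  qed
qed

lemma piece_eqI:
  assumes "psum k h \<le> frac (\<tau> h * t) * total h" "frac (\<tau> h * t) * total h < psum (Suc k) h"
  shows "piece h t = k"
proof (rule antisym)
  show "piece h t \<le> k" unfolding piece_def using assms(2) by (rule Least_le)
  show "k \<le> piece h t"
  proof (rule ccontr)
    assume "\<not> k \<le> piece h t"
    then have "psum (Suc (piece h t)) h \<le> psum k h" by (intro psum_mono) auto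
    then show False using piece_bounds(2)[of t] assms(1) by linarith
  qed
qed

lemma weight_piece_pos: "0 < weight (piece h t) h"
  using piece_bounds[of t] by (simp add: psum_def)

lemma piece_measurable: "piece h \<in> measurable L01 (count_space UNIV)"
proof -
  have "(\<lambda>t. \<tau> h * t - real_of_int \<lfloor>\<tau> h * t\<rfloor>) \<in> borel_measurable borel" by measurable
  then have [measurable]: "(\<lambda>t. frac (\<tau> h * t)) \<in> borel_measurable L01"
    unfolding frac_def by (rule borel_measurable_L01)
  have "Measurable.pred L01 (\<lambda>t. frac (\<tau> h * t) * total h < psum (Suc k) h)" for k by measurable
  then show ?thesis unfolding piece_def[abs_def] by measurable
qed

text \<open>An active centre has a residual comparable to that of \<open>h\<close>: they are closer
  than \<open>\<delta> k\<close>, which is at most 1/48 of the residual at the centre, so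
  \<open>residual_lipschitz\<close> can be solved for that residual. This lets
  \<open>\<eta> * residual h\<close> measure every later error.\<close>

lemma active_bounds:
  assumes "0 < weight k h"
  shows "0 < \<delta> k" "L1norm (\<lambda>t. h t - \<psi> k t) < \<delta> k" "\<delta> k \<le> 2 * \<eta> * residual h" "B k < \<tau> h"
proof -
  note b = bump_posD[OF weight_posD(1)[OF assms]]
  show "0 < \<delta> k" "L1norm (\<lambda>t. h t - \<psi> k t) < \<delta> k" "B k < \<tau> h" using b weight_posD(2)[OF assms] by auto
  have "residual (\<psi> k) \<le> residual h + 2 * \<delta> k"
    using residual_lipschitz[OF \<psi>_int[of k] h_int] b L1norm_commute[of h "\<psi> k"] by linarith
  moreover have "\<delta> k \<le> 1/48 * residual (\<psi> k)"
    using \<delta>_bounds(3)[of k] mult_right_mono[OF eta(2) residual_nonneg[of "\<psi> k"]] by linarith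
  ultimately have "residual (\<psi> k) \<le> 2 * residual h" using h_pos by linarith
  then have "\<eta> * residual (\<psi> k) \<le> \<eta> * (2 * residual h)" using eta by (intro mult_left_mono) auto
  then show "\<delta> k \<le> 2 * \<eta> * residual h" using \<delta>_bounds(3)[of k] by simp
qed

lemma finite_active: "finite {k. 0 < weight k h}"
proof (rule finite_subset)
  show "{k. 0 < weight k h} \<subseteq> {..<nat \<lceil>\<tau> h\<rceil>}"
  proof
    fix k assume "k \<in> {k. 0 < weight k h}"
    then have "real k < \<tau> h" using active_bounds(4)[of k] B_ge(2)[of k] by auto
    then show "k \<in> {..<nat \<lceil>\<tau> h\<rceil>}" by (auto, linarith)
  qed
qed simp

lemma sum_active_weight: "(\<Sum>k | 0 < weight k h. weight k h) = total h"
proof -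
  define m where "m = Suc (Max (insert (nat \<lceil>\<tau> h\<rceil>) {k. 0 < weight k h}))"
  have fin: "finite (insert (nat \<lceil>\<tau> h\<rceil>) {k. 0 < weight k h})" using finite_active by simp
  have "\<tau> h \<le> real m" using Max_ge[OF fin, of "nat \<lceil>\<tau> h\<rceil>"] unfolding m_def by simp
  moreover have "(\<Sum>k | 0 < weight k h. weight k h) = (\<Sum>k<m. weight k h)"
  proof (rule sum.mono_neutral_left)
    show "{k. 0 < weight k h} \<subseteq> {..<m}" using Max_ge[OF fin] unfolding m_def by (auto simp: less_Suc_eq_le)
    show "\<forall>i\<in>{..<m} - {k. 0 < weight k h}. weight i h = 0"
    proof
      fix i assume "i \<in> {..<m} - {k. 0 < weight k h}"
      then show "weight i h = 0" using weight_nonneg[of i] by auto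
    qed
  qed simp
  ultimately show ?thesis using psum_eq_total by (simp add: psum_def)
qed

lemma frac_sets: "{t. a \<le> frac (c * t) \<and> frac (c * t) < b} \<in> sets (borel :: real measure)"
proof -
  have "{t. a \<le> frac (c * t) \<and> frac (c * t) < b} = {t. frac (c * t) < b} - {t. frac (c * t) < a}" by auto
  then show ?thesis using sets.Diff[OF frac_less_sets frac_less_sets] by simp
qed

lemma compose_piece_integrable:
  fixes f :: "nat \<Rightarrow> real \<Rightarrow> 'a"
  assumes "\<And>k. integrable L01 (f k)"
  shows "integrable L01 (\<lambda>t. f (piece h t) t)"
proof (rule Bochner_Integration.integrable_bound)
  show "integrable L01 (\<lambda>t. \<Sum>k | 0 < weight k h. norm (f k t))" using assms by auto
  show "(\<lambda>t. f (piece h t) t) \<in> borel_measurable L01"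
    using piece_measurable by (rule measurable_compose_countable[rotated]) (use assms in auto)
  show "AE t in L01. norm (f (piece h t) t) \<le> norm (\<Sum>k | 0 < weight k h. norm (f k t))"
  proof (rule AE_I2)
    fix t
    have "norm (f (piece h t) t) \<le> (\<Sum>k | 0 < weight k h. norm (f k t))"
      using weight_piece_pos finite_active by (intro member_le_sum) auto
    then show "norm (f (piece h t) t) \<le> norm (\<Sum>k | 0 < weight k h. norm (f k t))" by simp
  qed
qed

text \<open>The oscillation of the pieces at frequency \<open>\<tau> h\<close> spreads the error evenly: the piece of index
  \<open>k\<close> contributes about its weight times the \<open>L1\<close> error, instead of the full \<open>L1\<close> error.\<close>

lemma piece_error:
  "L1norm (\<lambda>t. \<psi> (piece h t) t - h t) \<le> 8 * \<eta> * residual h"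
proof -
  define E where "E = \<eta> * residual h"
  have E: "0 < E" using eta h_pos by (simp add: E_def)
  \<comment> \<open>\<open>B_equi\<close> speaks only about pairs from the countable family, so one
    active \<open>\<psi> j\<close> stands in for \<open>h\<close>; the exchange is paid for at the
    end by another \<open>2 * E\<close>.\<close>
  obtain j where j: "0 < weight j h" using ex_weight_pos by blast
  let ?K = "{k. 0 < weight k h}"
  define A where "A k = {t. psum k h / total h \<le> frac (\<tau> h * t) \<and> frac (\<tau> h * t) < psum (Suc k) h / total h}" for k
  have pw: "norm (\<psi> (piece h t) t - \<psi> j t) \<le> (\<Sum>k\<in>?K. indicator (A k) t *\<^sub>R norm (\<psi> k t - \<psi> j t))" for t
  proof -
    have "t \<in> A (piece h t)" unfolding A_def using piece_bounds[of t] total_pos by (auto simp: field_simps)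
    then have "norm (\<psi> (piece h t) t - \<psi> j t)
        = indicator (A (piece h t)) t *\<^sub>R norm (\<psi> (piece h t) t - \<psi> j t)" by simp
    also have "\<dots> \<le> (\<Sum>k\<in>?K. indicator (A k) t *\<^sub>R norm (\<psi> k t - \<psi> j t))"
      using weight_piece_pos finite_active
      by (intro member_le_sum[where f="\<lambda>k. indicator (A k) t *\<^sub>R norm (\<psi> k t - \<psi> j t)"]) auto
    finally show ?thesis .
  qed
  have int_k: "integrable L01 (\<lambda>t. indicator (A k) t *\<^sub>R norm (\<psi> k t - \<psi> j t))" for k
    using \<psi>_int unfolding A_def by (intro integrable_L01_mult_indicator frac_sets) auto
  \<comment> \<open>Two active centres are each within \<open>2 * E\<close> of \<open>h\<close>,
    hence \<open>4 * E\<close> apart. The second terms add up to at most \<open>2 * E\<close> over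
    any set of indices.\<close>
  have contrib: "integral01 (\<lambda>t. indicator (A k) t *\<^sub>R norm (\<psi> k t - \<psi> j t))
      \<le> weight k h / total h * (4 * E) + 2 * E * (1/2) ^ Suc k" if k: "0 < weight k h" for k
  proof -
    note ak = active_bounds[OF k] and aj = active_bounds[OF j]
    have "L1norm (\<lambda>t. \<psi> k t - \<psi> j t) \<le> L1norm (\<lambda>t. \<psi> k t - h t) + L1norm (\<lambda>t. h t - \<psi> j t)"
      using \<psi>_int h_int by (intro L1norm_triangle)
    then have 1: "L1norm (\<lambda>t. \<psi> k t - \<psi> j t) \<le> 4 * E"
      using ak aj L1norm_commute[of h "\<psi> k"] unfolding E_def by linarith
    have "integral01 (\<lambda>t. indicator (A k) t *\<^sub>R norm (\<psi> k t - \<psi> j t))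
      \<le> (psum (Suc k) h / total h - psum k h / total h) * L1norm (\<lambda>t. \<psi> k t - \<psi> j t) + \<delta> k * (1/2) ^ Suc k"
      unfolding A_def
    proof (rule B_equi)
      show "0 \<le> psum k h / total h" using psum_nonneg[of k] total_pos by auto
      show "psum k h / total h \<le> psum (Suc k) h / total h"
        using psum_mono[of k "Suc k"] total_pos by (intro divide_right_mono) auto
      show "psum (Suc k) h / total h \<le> 1" using psum_le_total total_pos by auto
    qed (use ak aj in auto)
    also have "psum (Suc k) h / total h - psum k h / total h = weight k h / total h"
      by (simp add: psum_def add_divide_distrib)
    also have "weight k h / total h * L1norm (\<lambda>t. \<psi> k t - \<psi> j t) + \<delta> k * (1/2) ^ Suc k
        \<le> weight k h / total h * (4 * E) + 2 * E * (1/2) ^ Suc k"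
      using 1 ak k total_pos by (intro add_mono mult_left_mono mult_right_mono) (auto simp: E_def)
    finally show ?thesis .
  qed
  have halves: "(\<Sum>k\<in>?K. (1/2 :: real) ^ Suc k) \<le> 1"
  proof -
    have "(\<Sum>k\<in>?K. (1/2 :: real) ^ Suc k) \<le> (\<Sum>k. (1/2) ^ Suc k)"
      using power_half_series finite_active by (intro sum_le_suminf) (auto simp: sums_iff)
    then show ?thesis using power_half_series by (simp add: sums_iff)
  qed
  have int_pj: "integrable L01 (\<lambda>t. \<psi> (piece h t) t)" using \<psi>_int by (rule compose_piece_integrable)
  have "L1norm (\<lambda>t. \<psi> (piece h t) t - \<psi> j t) \<le>
      integral01 (\<lambda>t. \<Sum>k\<in>?K. indicator (A k) t *\<^sub>R norm (\<psi> k t - \<psi> j t))"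
    unfolding L1norm_def
  proof (rule integral_mono)
    show "integrable L01 (\<lambda>t. norm (\<psi> (piece h t) t - \<psi> j t))"
      using int_pj \<psi>_int by (intro integrable_norm Bochner_Integration.integrable_diff)
    show "integrable L01 (\<lambda>t. \<Sum>k\<in>?K. indicator (A k) t *\<^sub>R norm (\<psi> k t - \<psi> j t))"
      by (intro Bochner_Integration.integrable_sum int_k)
  qed (rule pw)
  also have "\<dots> = (\<Sum>k\<in>?K. integral01 (\<lambda>t. indicator (A k) t *\<^sub>R norm (\<psi> k t - \<psi> j t)))"
    by (intro Bochner_Integration.integral_sum int_k)
  also have "\<dots> \<le> (\<Sum>k\<in>?K. weight k h / total h * (4 * E) + 2 * E * (1/2) ^ Suc k)"
    by (intro sum_mono contrib) auto
  also have "\<dots> = (\<Sum>k\<in>?K. weight k h) / total h * (4 * E) + 2 * E * (\<Sum>k\<in>?K. (1/2) ^ Suc k)"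
    by (simp only: sum.distrib sum_distrib_left sum_distrib_right sum_divide_distrib)
  also have "\<dots> \<le> 4 * E + 2 * E * 1"
    using sum_active_weight total_pos halves E by (intro add_mono mult_left_mono) auto
  finally have 1: "L1norm (\<lambda>t. \<psi> (piece h t) t - \<psi> j t) \<le> 6 * E" by simp
  have 2: "L1norm (\<lambda>t. \<psi> j t - h t) \<le> 2 * E"
    using active_bounds[OF j] L1norm_commute[of h "\<psi> j"] unfolding E_def by linarith
  show ?thesis
    using L1norm_triangle[OF int_pj \<psi>_int[of j] h_int] 1 2 unfolding E_def by linarith
qed

lemma step_eq: "step h t = v (piece h t) t"
  using h_pos by (simp add: step_def)

lemma step_integrable_pos: "integrable L01 (step h)"
proof -
  have "step h = (\<lambda>t. v (piece h t) t)" by (rule ext) (rule step_eq)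
  then show ?thesis using compose_piece_integrable[OF v_int] by (simp only:)
qed

lemma T_active_bound:
  assumes "0 < weight k h" "t \<in> I01"
  shows "\<mu> t * norm (T h t - T (\<psi> k) t) \<le> \<mu> t * (g * (2 * \<eta> * residual h))"
proof -
  have "norm (T h t - T (\<psi> k) t) \<le> g * L1norm (\<lambda>t. h t - \<psi> k t)"
    using T_lipschitz[OF h_int \<psi>_int assms(2)] .
  also have "\<dots> \<le> g * (2 * \<eta> * residual h)"
    using active_bounds[OF assms(1)] g_nonneg by (intro mult_left_mono) auto
  finally show ?thesis using \<mu>_nonneg by (intro mult_left_mono)
qed

lemma \<mu>_g_le: "0 \<le> x \<Longrightarrow> integral01 \<mu> * (g * x) \<le> x"
  using mult_right_mono[of "integral01 \<mu> * g" 1 x] contraction by (simp add: mult.assoc)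

text \<open>\<open>v k\<close> is off \<open>\<psi> k\<close> by little more than the distance to
  the set, and passing from \<open>\<psi> k\<close> to \<open>h\<close> costs
  \<open>norm (\<psi> k t - h t)\<close> twice, once for the point and once for its distance. This
  cost is controlled only in the mean, by \<open>piece_error\<close>. Hence 20 = 2 * 8 + 2 + 2, the
  last two from the set moving and from \<open>\<delta> k\<close>.\<close>

lemma step_distance_pos:
  "L1norm (\<lambda>t. step h t - h t) \<le> (1 + 20 * \<eta>) * residual h"
proof -
  define E where "E = \<eta> * residual h"
  have E: "0 < E" using eta h_pos by (simp add: E_def)
  have int_p: "integrable L01 (\<lambda>t. \<psi> (piece h t) t)" using \<psi>_int by (rule compose_piece_integrable)
  note ints = D_T_integrable[OF h_int h_int] \<mu>_int int_p h_int
  have "L1norm (\<lambda>t. step h t - h t) \<le> integral01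
      (\<lambda>t. D t (T h t) (h t) + 2 * norm (\<psi> (piece h t) t - h t) + \<mu> t * (g * (2 * E)) + 2 * E)"
    unfolding L1norm_def
  proof (rule integral_mono)
    show "integrable L01 (\<lambda>t. norm (step h t - h t))" using step_integrable_pos h_int by auto
    show "integrable L01 (\<lambda>t. D t (T h t) (h t) + 2 * norm (\<psi> (piece h t) t - h t) + \<mu> t * (g * (2 * E)) + 2 * E)"
      using ints by auto
    fix t assume "t \<in> space L01"
    then have t: "t \<in> I01" by simp
    define k where "k = piece h t"
    have k: "0 < weight k h" unfolding k_def by (rule weight_piece_pos)
    note ak = active_bounds[OF k]
    have "norm (v k t - h t) \<le> norm (v k t - \<psi> k t) + norm (\<psi> k t - h t)"
      by (metis norm_triangle_ineq diff_add_cancel add_diff_eq)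
    moreover have "norm (v k t - \<psi> k t) \<le> D t (T (\<psi> k) t) (\<psi> k t) + \<delta> k" by (rule v_near[OF ak(1) t])
    moreover have "D t (T (\<psi> k) t) (\<psi> k t) \<le> D t (T h t) (h t) + norm (\<psi> k t - h t) + \<mu> t * norm (T h t - T (\<psi> k) t)"
      using D_lipschitz[OF t, of "T (\<psi> k) t" "\<psi> k t" "T h t" "h t"] by (simp add: norm_minus_commute)
    moreover have "\<mu> t * norm (T h t - T (\<psi> k) t) \<le> \<mu> t * (g * (2 * E))"
      using T_active_bound[OF k t] by (simp add: E_def mult.assoc)
    ultimately show "norm (step h t - h t) \<le>
        D t (T h t) (h t) + 2 * norm (\<psi> (piece h t) t - h t) + \<mu> t * (g * (2 * E)) + 2 * E"
      using ak(3) unfolding step_eq k_def[symmetric] E_def by linarith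
  qed
  also have "\<dots> = residual h + 2 * L1norm (\<lambda>t. \<psi> (piece h t) t - h t) + integral01 \<mu> * (g * (2 * E)) + 2 * E"
    using ints by (simp add: residual_def L1norm_def)
  also have "\<dots> \<le> residual h + 2 * (8 * E) + 2 * E + 2 * E"
    using piece_error \<mu>_g_le[of "2 * E"] E by (simp add: E_def)
  finally show ?thesis by (simp add: E_def algebra_simps)
qed

text \<open>The contraction. The new value is near the set belonging to
  \<open>T (\<psi> k) t\<close> and is compared with the one belonging to
  \<open>T (step h) t\<close>. The sets depend on the functions only through \<open>T\<close>, which
  is controlled uniformly by L1 distances, so no pointwise closeness of \<open>\<psi> k\<close> and
  \<open>h\<close> enters. The surplus is 24 = 2 + 20 + 2.\<close>

lemma step_residual_pos:
  "residual (step h) \<le> (integral01 \<mu> * g + 24 * \<eta>) * residual h"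
proof -
  define E where "E = \<eta> * residual h"
  define n where "n = L1norm (\<lambda>t. step h t - h t)"
  have E: "0 < E" using eta h_pos by (simp add: E_def)
  have "residual (step h) \<le> integral01 (\<lambda>t. 2 * E + \<mu> t * (g * n) + \<mu> t * (g * (2 * E)))"
    unfolding residual_def
  proof (rule integral_mono)
    show "integrable L01 (\<lambda>t. D t (T (step h) t) (step h t))"
      by (rule D_T_integrable[OF step_integrable_pos step_integrable_pos])
    show "integrable L01 (\<lambda>t. 2 * E + \<mu> t * (g * n) + \<mu> t * (g * (2 * E)))" using \<mu>_int by auto
    fix t assume "t \<in> space L01"
    then have t: "t \<in> I01" by simp
    define k where "k = piece h t"
    have k: "0 < weight k h" unfolding k_def by (rule weight_piece_pos)
    note ak = active_bounds[OF k]
    have "D t (T (step h) t) (v k t) \<le> D t (T (\<psi> k) t) (v k t) + \<mu> t * norm (T (step h) t - T (\<psi> k) t)"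
      using D_lipschitz[OF t, of "T (step h) t" "v k t" "T (\<psi> k) t" "v k t"] by simp
    moreover have "D t (T (\<psi> k) t) (v k t) \<le> \<delta> k" by (rule v_D[OF ak(1) t])
    moreover have "norm (T (step h) t - T (\<psi> k) t) \<le> norm (T (step h) t - T h t) + norm (T h t - T (\<psi> k) t)"
      by (metis norm_triangle_ineq diff_add_cancel add_diff_eq)
    then have "\<mu> t * norm (T (step h) t - T (\<psi> k) t)
        \<le> \<mu> t * norm (T (step h) t - T h t) + \<mu> t * norm (T h t - T (\<psi> k) t)"
      using \<mu>_nonneg[of t] by (simp add: mult_left_mono flip: distrib_left)
    moreover have "\<mu> t * norm (T (step h) t - T h t) \<le> \<mu> t * (g * n)"
      using T_lipschitz[OF step_integrable_pos h_int t] \<mu>_nonneg by (intro mult_left_mono) (auto simp: n_def)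
    moreover have "\<mu> t * norm (T h t - T (\<psi> k) t) \<le> \<mu> t * (g * (2 * E))"
      using T_active_bound[OF k t] by (simp add: E_def mult.assoc)
    ultimately show "D t (T (step h) t) (step h t) \<le> 2 * E + \<mu> t * (g * n) + \<mu> t * (g * (2 * E))"
      using ak(3) unfolding step_eq[of t] k_def[symmetric] E_def by linarith
  qed
  also have "\<dots> = 2 * E + integral01 \<mu> * g * n + integral01 \<mu> * (g * (2 * E))"
    using \<mu>_int by simp
  also have "\<dots> \<le> 2 * E + (integral01 \<mu> * g * residual h + 20 * E) + 2 * E"
  proof -
    have m: "0 \<le> integral01 \<mu> * g" using g_nonneg \<mu>_nonneg by (auto intro!: mult_nonneg_nonneg)
    have "integral01 \<mu> * g * n \<le> integral01 \<mu> * g * (residual h + 20 * E)"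
      using step_distance_pos m by (intro mult_left_mono) (auto simp: n_def E_def algebra_simps)
    moreover have "integral01 \<mu> * g * (20 * E) \<le> 20 * E"
      using \<mu>_g_le[of "20 * E"] E by (simp add: mult.assoc)
    moreover have "integral01 \<mu> * (g * (2 * E)) \<le> 2 * E"
      using \<mu>_g_le[of "2 * E"] E by simp
    ultimately show ?thesis unfolding distrib_left by linarith
  qed
  finally show ?thesis by (simp add: E_def algebra_simps)
qed

end

end

section \<open>Iteration of the patching map\<close>

context L1_step
begin

lemma step_integrable:
  assumes "integrable L01 h"
  shows "integrable L01 (step h)"
proof (cases "residual h = 0")
  case False
  then have "0 < residual h" using residual_nonneg[of h] by linarith
  then show ?thesis by (rule step_integrable_pos[OF assms])
qed (use assms in \<open>simp add: step_def\<close>)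

lemma step_distance:
  assumes "integrable L01 h"
  shows "L1norm (\<lambda>t. step h t - h t) \<le> 2 * residual h"
proof (cases "residual h = 0")
  case True
  then show ?thesis by (simp add: step_def L1norm_def)
next
  case False
  then have pos: "0 < residual h" using residual_nonneg[of h] by linarith
  have "(1 + 20 * \<eta>) * residual h \<le> 2 * residual h" using pos eta by (intro mult_right_mono) auto
  then show ?thesis using step_distance_pos[OF assms pos] by linarith
qed

lemma step_residual:
  assumes "integrable L01 h"
  shows "residual (step h) \<le> (integral01 \<mu> * g + 24 * \<eta>) * residual h"
proof (cases "residual h = 0")
  case True
  then show ?thesis by (simp add: step_def)
next
  case False
  then have pos: "0 < residual h" using residual_nonneg[of h] by linarith
  then show ?thesis by (rule step_residual_pos[OF assms])
qed

text \<open>Away from these times the strict inequalities that fix the piece survive small changes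
  of \<open>h\<close>; the instance \<open>k = 0\<close> removes the jumps of
  \<open>frac\<close>.\<close>

lemma exceptional_countable:
  assumes "\<tau> h \<noteq> 0" "total h \<noteq> 0"
  shows "countable {t. \<exists>k. frac (\<tau> h * t) * total h = psum k h}"
proof (rule countable_subset)
  show "{t. \<exists>k. frac (\<tau> h * t) * total h = psum k h}
      \<subseteq> range (\<lambda>(n::int, k::nat). (real_of_int n + psum k h / total h) / \<tau> h)"
  proof
    fix t assume "t \<in> {t. \<exists>k. frac (\<tau> h * t) * total h = psum k h}"
    then obtain k where k: "frac (\<tau> h * t) * total h = psum k h" by blast
    have "\<tau> h * t = real_of_int \<lfloor>\<tau> h * t\<rfloor> + psum k h / total h"
      using k[symmetric] assms by (simp add: frac_def)
    then have "t = (real_of_int \<lfloor>\<tau> h * t\<rfloor> + psum k h / total h) / \<tau> h" using assms by (simp add: field_simps)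
    then show "t \<in> range (\<lambda>(n::int, k::nat). (real_of_int n + psum k h / total h) / \<tau> h)"
      by (intro image_eqI[of _ _ "(\<lfloor>\<tau> h * t\<rfloor>, k)"]) auto
  qed
qed (rule countable_image, simp)

text \<open>At residual 0 the bound on the step distance suffices. Elsewhere the frequency and the
  cut points vary continuously, so at almost every \<open>t\<close> the piece is eventually constant
  along the sequence; only finitely many \<open>v k\<close> occur near \<open>h\<close>, and their
  norms add up to a majorant.\<close>

lemma step_continuous:
  assumes hs: "\<And>n. integrable L01 (hs n)" and h: "integrable L01 h"
    and lim: "L1_tendsto hs h"
  shows "L1_tendsto (\<lambda>n. step (hs n)) (step h)"
proof (cases "residual h = 0")
  case True
  \<comment> \<open>The 5 is 2 * 2 + 1: the step moves \<open>hs n\<close> by at most twice its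
    residual, which is at most twice its distance to the zero \<open>h\<close>.\<close>
  have bd: "L1norm (\<lambda>t. step (hs n) t - step h t) \<le> 5 * L1norm (\<lambda>t. hs n t - h t)" for n
  proof -
    have "L1norm (\<lambda>t. step (hs n) t - h t) \<le> L1norm (\<lambda>t. step (hs n) t - hs n t) + L1norm (\<lambda>t. hs n t - h t)"
      by (rule L1norm_triangle[OF step_integrable[OF hs] hs h])
    moreover have "residual (hs n) \<le> 2 * L1norm (\<lambda>t. hs n t - h t)"
      using residual_lipschitz[OF hs[of n] h] True by simp
    ultimately have "L1norm (\<lambda>t. step (hs n) t - h t) \<le> 5 * L1norm (\<lambda>t. hs n t - h t)"
      using step_distance[OF hs[of n]] by linarith
    then show ?thesis using True by (simp add: step_def[of h])
  qed
  have "(\<lambda>n. 5 * L1norm (\<lambda>t. hs n t - h t)) \<longlonglongrightarrow> 0" using tendsto_mult[OF tendsto_const lim, of 5] by simp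
  then show ?thesis
  proof (rule Lim_null_comparison[rotated])
    show "\<forall>\<^sub>F n in sequentially. norm (L1norm (\<lambda>t. step (hs n) t - step h t)) \<le> 5 * L1norm (\<lambda>t. hs n t - h t)"
      using bd by (intro always_eventually) simp
  qed
next
  case False
  then have pos: "0 < residual h" using residual_nonneg[of h] by linarith
  note \<sigma>p = \<sigma>_pos[OF h pos] and totp = total_pos[OF h pos]
  have \<tau>p: "0 < \<tau> h" using \<sigma>p by (simp add: \<tau>_def)
  have pos_ev: "\<forall>\<^sub>F n in sequentially. 0 < residual (hs n)"
  proof -
    have "\<forall>\<^sub>F n in sequentially. L1norm (\<lambda>t. hs n t - h t) < residual h / 2"
      using pos by (intro order_tendstoD(2)[OF lim]) auto
    then show ?thesis
    proof eventually_elim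
      case (elim n)
      then show ?case using residual_lipschitz[OF h hs[of n]] L1norm_commute[of h "hs n"] by linarith
    qed
  qed
  have bump_lim: "(\<lambda>n. bump k (hs n)) \<longlonglongrightarrow> bump k h" for k
  proof -
    have "(\<lambda>n. bump k (hs n) - bump k h) \<longlonglongrightarrow> 0"
    proof (rule Lim_null_comparison[OF _ lim])
      show "\<forall>\<^sub>F n in sequentially. norm (bump k (hs n) - bump k h) \<le> L1norm (\<lambda>t. hs n t - h t)"
        using bump_lipschitz[OF hs h] by (intro always_eventually) simp
    qed
    then show ?thesis by (rule LIM_zero_cancel)
  qed
  have lim2: "(\<lambda>n. 2 * L1norm (\<lambda>t. hs n t - h t)) \<longlonglongrightarrow> 0" using tendsto_mult[OF tendsto_const lim, of 2] by simp
  have "(\<lambda>n. \<sigma> (hs n) - \<sigma> h) \<longlonglongrightarrow> 0"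
  proof (rule Lim_null_comparison[OF _ lim2])
    show "\<forall>\<^sub>F n in sequentially. norm (\<sigma> (hs n) - \<sigma> h) \<le> 2 * L1norm (\<lambda>t. hs n t - h t)"
      using \<sigma>_lipschitz[OF hs h] by (intro always_eventually) simp
  qed
  then have \<sigma>_lim: "(\<lambda>n. \<sigma> (hs n)) \<longlonglongrightarrow> \<sigma> h" by (rule LIM_zero_cancel)
  then have \<tau>_lim: "(\<lambda>n. \<tau> (hs n)) \<longlonglongrightarrow> \<tau> h"
    unfolding \<tau>_def using \<sigma>p by (intro tendsto_intros) auto
  have weight_lim: "(\<lambda>n. weight k (hs n)) \<longlonglongrightarrow> weight k h" for k
    unfolding weight_def by (intro tendsto_intros bump_lim \<tau>_lim)
  have psum_lim: "(\<lambda>n. psum k (hs n)) \<longlonglongrightarrow> psum k h" for k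
    unfolding psum_def by (intro tendsto_intros weight_lim)
  \<comment> \<open>Strictly above \<open>\<tau> h\<close>, so that eventually
    \<open>\<tau> (hs n) < K\<close> as well and all pieces in use have index below
    \<open>K\<close>.\<close>
  define K where "K = Suc (nat \<lceil>\<tau> h\<rceil>)"
  have K: "\<tau> h < real K" unfolding K_def by linarith
  have good_ev: "\<forall>\<^sub>F n in sequentially. 0 < residual (hs n) \<and> \<tau> (hs n) < real K"
    using pos_ev order_tendstoD(2)[OF \<tau>_lim K] by (rule eventually_conj)
  have total_lim: "(\<lambda>n. total (hs n)) \<longlonglongrightarrow> total h"
  proof -
    have "\<forall>\<^sub>F n in sequentially. psum K (hs n) = total (hs n)"
      using good_ev by eventually_elim (rule psum_eq_total[OF hs], auto)
    moreover have "(\<lambda>n. psum K (hs n)) \<longlonglongrightarrow> total h"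
      using psum_lim[of K] psum_eq_total[OF h pos, of K] K by simp
    ultimately show ?thesis by (rule Lim_transform_eventually[rotated])
  qed
  \<comment> \<open>The members of the sequence that are not yet good are replaced by
    \<open>step h\<close>, so that the majorant is valid for every \<open>n\<close>.\<close>
  define s where "s n = (if 0 < residual (hs n) \<and> \<tau> (hs n) < real K then step (hs n) else step h)" for n
  have piece_lt: "piece f t < K" if "integrable L01 f" "0 < residual f" "\<tau> f < real K" for f t
    using active_bounds(4)[OF that(1,2) weight_piece_pos[OF that(1,2)], of t] B_ge(2)[of "piece f t"] that(3)
    by linarith
  have step_bd: "norm (step f t) \<le> (\<Sum>k<K. norm (v k t))" if "integrable L01 f" "0 < residual f" "\<tau> f < real K" for f t
    unfolding step_eq[OF that(1,2)] using piece_lt[OF that]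
    by (intro member_le_sum[where f="\<lambda>k. norm (v k t)"]) auto
  have "L1_tendsto s (step h)"
  proof (rule L1norm_dominated_convergence[where w="\<lambda>t. \<Sum>k<K. norm (v k t)"])
    show "integrable L01 (\<lambda>t. \<Sum>k<K. norm (v k t))" using v_int by auto
    show "step h \<in> borel_measurable L01" using step_integrable[OF h] by auto
    show "s n \<in> borel_measurable L01" for n using step_integrable[OF h] step_integrable[OF hs[of n]] by (auto simp: s_def)
    show "AE t in L01. norm (s n t) \<le> (\<Sum>k<K. norm (v k t))" for n
      using step_bd[OF h pos K] step_bd[OF hs[of n]] by (intro AE_I2) (auto simp: s_def)
    have "AE t in L01. t \<notin> {t. \<exists>k. frac (\<tau> h * t) * total h = psum k h}"
      using \<tau>p totp by (intro AE_L01_countable exceptional_countable) auto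
    then show "AE t in L01. (\<lambda>n. s n t) \<longlonglongrightarrow> step h t"
    proof eventually_elim
      case (elim t)
      define k where "k = piece h t"
      have ne: "frac (\<tau> h * t) * total h \<noteq> psum j h" for j using elim by auto
      have "frac (\<tau> h * t) \<noteq> 0" using ne[of 0] by (auto simp: psum_def)
      then have cont: "isCont frac (\<tau> h * t)" by (intro continuous_frac) auto
      have lim1: "(\<lambda>n. frac (\<tau> (hs n) * t) * total (hs n)) \<longlonglongrightarrow> frac (\<tau> h * t) * total h"
        by (intro tendsto_mult total_lim isCont_tendsto_compose[OF cont] \<tau>_lim tendsto_const)
      have b1: "psum k h < frac (\<tau> h * t) * total h"
        using piece_bounds(1)[OF h pos, of t] ne[of k] unfolding k_def by linarith
      have b2: "frac (\<tau> h * t) * total h < psum (Suc k) h"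
        using piece_bounds(2)[OF h pos, of t] unfolding k_def .
      have e1: "\<forall>\<^sub>F n in sequentially. 0 < frac (\<tau> (hs n) * t) * total (hs n) - psum k (hs n)"
        using b1 by (intro order_tendstoD(1)[OF tendsto_diff[OF lim1 psum_lim]]) auto
      have e2: "\<forall>\<^sub>F n in sequentially. 0 < psum (Suc k) (hs n) - frac (\<tau> (hs n) * t) * total (hs n)"
        using b2 by (intro order_tendstoD(1)[OF tendsto_diff[OF psum_lim lim1]]) auto
      have "\<forall>\<^sub>F n in sequentially. step h t = s n t"
        using e1 e2 good_ev
      proof eventually_elim
        case (elim n)
        then have "piece (hs n) t = k" by (intro piece_eqI[OF hs]) auto
        then show ?case using elim step_eq[OF h pos, of t] step_eq[OF hs, of n t] by (simp add: s_def k_def)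
      qed
      then show ?case by (rule Lim_transform_eventually[OF tendsto_const])
    qed
  qed
  moreover have "\<forall>\<^sub>F n in sequentially. L1norm (\<lambda>t. s n t - step h t) = L1norm (\<lambda>t. step (hs n) t - step h t)"
    using good_ev by eventually_elim (simp add: s_def)
  ultimately show ?thesis by (rule Lim_transform_eventually)
qed

end

section \<open>From the contracting step to the retraction in L1\<close>

context L1_inclusion
begin

text \<open>Centres, approximate selections and frequency thresholds are chosen here, in this order,
  since each depends on the previous ones; the conclusion no longer mentions them.\<close>

lemma contraction_step:
  "\<exists>R q. 0 \<le> q \<and> q < 1 \<and>
    (\<forall>h. integrable L01 h \<longrightarrow> integrable L01 (R h)) \<and>
    (\<forall>h. integrable L01 h \<longrightarrow> L1norm (\<lambda>t. R h t - h t) \<le> 2 * residual h) \<and>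
    (\<forall>h. integrable L01 h \<longrightarrow> residual (R h) \<le> q * residual h) \<and>
    (\<forall>h. residual h = 0 \<longrightarrow> R h = h) \<and>
    (\<forall>hs h. (\<forall>n. integrable L01 (hs n)) \<longrightarrow> integrable L01 h \<longrightarrow>
       L1_tendsto hs h \<longrightarrow> L1_tendsto (\<lambda>n. R (hs n)) (R h))"
proof -
  define \<rho> where "\<rho> = integral01 \<mu> * g"
  have \<rho>: "0 \<le> \<rho>" "\<rho> < 1" using contraction g_nonneg \<mu>_nonneg by (auto simp: \<rho>_def intro!: mult_nonneg_nonneg)
  \<comment> \<open>With this value the surplus \<open>24 * \<eta>\<close> of
    \<open>step_residual\<close> is half of the gap \<open>1 - \<rho>\<close>, which leaves the
    factor \<open>(1 + \<rho>) / 2\<close>.\<close>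
  define \<eta> where "\<eta> = (1 - \<rho>) / 48"
  have eta: "0 < \<eta>" "\<eta> \<le> 1/48" using \<rho> by (auto simp: \<eta>_def)
  obtain \<psi> :: "nat \<Rightarrow> real \<Rightarrow> 'a" where \<psi>: "\<And>k. integrable L01 (\<psi> k)"
    "\<And>f e. integrable L01 f \<Longrightarrow> e > 0 \<Longrightarrow> \<exists>k. L1norm (\<lambda>t. f t - \<psi> k t) < e"
    using L1_separable by blast
  define \<delta> where "\<delta> k = min 1 (\<eta> * residual (\<psi> k))" for k
  have "\<exists>v. integrable L01 v \<and> (0 < \<delta> k \<longrightarrow> (\<forall>t\<in>I01. norm (v t - \<psi> k t) \<le> D t (T (\<psi> k) t) (\<psi> k t) + \<delta> k
        \<and> D t (T (\<psi> k) t) (v t) \<le> \<delta> k))" for k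
  proof (cases "0 < \<delta> k")
    case True
    then show ?thesis using approximate_selection[OF \<psi>(1), of "\<delta> k" k] by blast
  next
    case False
    then show ?thesis using \<psi>(1) by blast
  qed
  then obtain v where v: "\<And>k. integrable L01 (v k)"
    "\<And>k t. 0 < \<delta> k \<Longrightarrow> t \<in> I01 \<Longrightarrow> norm (v k t - \<psi> k t) \<le> D t (T (\<psi> k) t) (\<psi> k t) + \<delta> k"
    "\<And>k t. 0 < \<delta> k \<Longrightarrow> t \<in> I01 \<Longrightarrow> D t (T (\<psi> k) t) (v k t) \<le> \<delta> k"
    by metis
  define Q where "Q k j T0 \<longleftrightarrow> (\<forall>\<tau> a b. T0 \<le> \<tau> \<longrightarrow> 0 \<le> a \<longrightarrow> a \<le> b \<longrightarrow> b \<le> 1 \<longrightarrow>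
      integral01 (\<lambda>t. indicator {t. a \<le> frac (\<tau> * t) \<and> frac (\<tau> * t) < b} t *\<^sub>R norm (\<psi> k t - \<psi> j t))
        \<le> (b - a) * L1norm (\<lambda>t. \<psi> k t - \<psi> j t) + \<delta> k * (1/2) ^ Suc k)" for k j T0
  have "\<exists>T0. 0 < \<delta> k \<longrightarrow> Q k j T0" for k j
  proof (cases "0 < \<delta> k")
    case True
    have int: "integrable L01 (\<lambda>t. norm (\<psi> k t - \<psi> j t))" using \<psi>(1) by auto
    have e: "0 < \<delta> k * (1/2) ^ Suc k" using True by simp
    obtain T0 where "\<And>\<tau> a b. T0 \<le> \<tau> \<Longrightarrow> 0 \<le> a \<Longrightarrow> a \<le> b \<Longrightarrow> b \<le> 1 \<Longrightarrow>
      integral01 (\<lambda>t. indicator {t. a \<le> frac (\<tau> * t) \<and> frac (\<tau> * t) < b} t *\<^sub>R norm (\<psi> k t - \<psi> j t))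
        \<le> (b - a) * integral01 (\<lambda>t. norm (\<psi> k t - \<psi> j t)) + \<delta> k * (1/2) ^ Suc k"
      using equidistribution_frac[OF int e] by blast
    then show ?thesis unfolding Q_def L1norm_def by (intro exI[of _ T0]) simp
  qed simp
  then obtain T0 where "\<And>k j. 0 < \<delta> k \<Longrightarrow> Q k j (T0 k j)" by metis
  then have T0: "\<And>k j \<tau> a b. 0 < \<delta> k \<Longrightarrow> T0 k j \<le> \<tau> \<Longrightarrow> 0 \<le> a \<Longrightarrow> a \<le> b \<Longrightarrow> b \<le> 1 \<Longrightarrow>
      integral01 (\<lambda>t. indicator {t. a \<le> frac (\<tau> * t) \<and> frac (\<tau> * t) < b} t *\<^sub>R norm (\<psi> k t - \<psi> j t))
        \<le> (b - a) * L1norm (\<lambda>t. \<psi> k t - \<psi> j t) + \<delta> k * (1/2) ^ Suc k"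
    unfolding Q_def by simp
  \<comment> \<open>The double sum dominates every \<open>T0 i j\<close> with indices up to
    \<open>n\<close> and is monotone in \<open>n\<close>; the remaining summands give
    \<open>B_ge\<close>.\<close>
  define B where "B n = 1 + real n + (\<Sum>i\<le>n. \<Sum>j\<le>n. \<bar>T0 i j\<bar>)" for n
  have B_T0: "T0 k j \<le> B (max k j)" for k j
  proof -
    let ?m = "max k j"
    have "\<bar>T0 k j\<bar> \<le> (\<Sum>j\<le>?m. \<bar>T0 k j\<bar>)" by (rule member_le_sum) auto
    also have "\<dots> \<le> (\<Sum>i\<le>?m. \<Sum>j\<le>?m. \<bar>T0 i j\<bar>)"
      by (rule member_le_sum[where f="\<lambda>i. \<Sum>j\<le>?m. \<bar>T0 i j\<bar>"]) (auto intro: sum_nonneg)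
    finally show ?thesis unfolding B_def by linarith
  qed
  interpret L1_step D T \<mu> \<alpha> g C0 \<eta> \<psi> v \<delta> B
  proof unfold_locales
    show "1 \<le> B k" "real k \<le> B k" for k
      unfolding B_def using sum_nonneg[of "{..k}" "\<lambda>i. \<Sum>j\<le>k. \<bar>T0 i j\<bar>"] by (auto intro: sum_nonneg)
    show "B i \<le> B j" if "i \<le> j" for i j
    proof -
      have "(\<Sum>k\<le>i. \<Sum>l\<le>i. \<bar>T0 k l\<bar>) \<le> (\<Sum>k\<le>i. \<Sum>l\<le>j. \<bar>T0 k l\<bar>)"
        using that by (intro sum_mono sum_mono2) auto
      also have "\<dots> \<le> (\<Sum>k\<le>j. \<Sum>l\<le>j. \<bar>T0 k l\<bar>)"
        using that by (intro sum_mono2) (auto intro: sum_nonneg)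
      finally show ?thesis unfolding B_def using that by linarith
    qed
    fix k j :: nat and \<tau>' a b :: real
    assume k: "0 < \<delta> k" and B: "B k \<le> \<tau>'" "B j \<le> \<tau>'" and ab: "0 \<le> a" "a \<le> b" "b \<le> 1"
    have "T0 k j \<le> \<tau>'" using B_T0[of k j] B by (auto simp: max_def split: if_splits)
    then show "integral01 (\<lambda>t. indicator {t. a \<le> frac (\<tau>' * t) \<and> frac (\<tau>' * t) < b} t *\<^sub>R norm (\<psi> k t - \<psi> j t))
        \<le> (b - a) * L1norm (\<lambda>t. \<psi> k t - \<psi> j t) + \<delta> k * (1/2) ^ Suc k"
      by (rule T0[OF k _ ab])
  qed (use eta \<psi> v in \<open>simp_all add: \<delta>_def\<close>)
  have "\<rho> + 24 * \<eta> < 1" "0 \<le> \<rho> + 24 * \<eta>" 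
  proof -
    have "24 * \<eta> = (1 - \<rho>) / 2" by (simp add: \<eta>_def)
    then show "\<rho> + 24 * \<eta> < 1" "0 \<le> \<rho> + 24 * \<eta>" using \<rho> by (simp_all add: field_simps)
  qed
  moreover have "step h = h" if "residual h = 0" for h using that by (simp add: step_def)
  ultimately show ?thesis
    using step_residual
    by (intro exI[of _ step] exI[of _ "\<rho> + 24 * \<eta>"])
       (simp add: step_integrable step_distance step_continuous \<rho>_def)
qed

text \<open>Residuals decay geometrically and each step moves by at most twice the residual, so the
  iterates converge at a rate that depends on \<open>h\<close> only through
  \<open>residual h\<close>. That quantity is locally bounded, so convergence is locally uniform and
  the continuity of the iterates passes to the limit.\<close>

theorem solution_retraction:
  obtains r where
    "\<And>h. integrable L01 h \<Longrightarrow> integrable L01 (r h)"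
    "\<And>h. integrable L01 h \<Longrightarrow> AE t in L01. D t (T (r h) t) (r h t) = 0"
    "\<And>h. integrable L01 h \<Longrightarrow> AE t in L01. D t (T h t) (h t) = 0 \<Longrightarrow> r h = h"
    "\<And>hs h. (\<And>n. integrable L01 (hs n)) \<Longrightarrow> integrable L01 h \<Longrightarrow>
      L1_tendsto hs h \<Longrightarrow> L1_tendsto (\<lambda>n. r (hs n)) (r h)"
proof -
  obtain R q where q: "0 \<le> q" "q < 1"
    and R_int': "\<forall>h. integrable L01 h \<longrightarrow> integrable L01 (R h)"
    and R_dist': "\<forall>h. integrable L01 h \<longrightarrow> L1norm (\<lambda>t. R h t - h t) \<le> 2 * residual h"
    and R_res': "\<forall>h. integrable L01 h \<longrightarrow> residual (R h) \<le> q * residual h"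
    and R_fix': "\<forall>h. residual h = 0 \<longrightarrow> R h = h"
    and R_cont': "\<forall>hs h. (\<forall>n. integrable L01 (hs n)) \<longrightarrow> integrable L01 h \<longrightarrow>
       L1_tendsto hs h \<longrightarrow> L1_tendsto (\<lambda>n. R (hs n)) (R h)"
    using contraction_step by (elim exE conjE) (rule that)
  note R_int = R_int'[rule_format] and R_dist = R_dist'[rule_format] and R_res = R_res'[rule_format]
    and R_fix = R_fix'[rule_format] and R_cont = R_cont'[rule_format]
  have It_int: "integrable L01 ((R ^^ n) h)" if "integrable L01 h" for n h
    using that by (induction n) (auto intro: R_int)
  have It_res: "residual ((R ^^ n) h) \<le> q ^ n * residual h" if h: "integrable L01 h" for n h
  proof (induction n)
    case (Suc n)
    have "residual ((R ^^ Suc n) h) \<le> q * residual ((R ^^ n) h)" using R_res[OF It_int[OF h]] by simp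
    also have "\<dots> \<le> q * (q ^ n * residual h)" using Suc q by (intro mult_left_mono)
    finally show ?case by (simp add: mult.assoc)
  qed simp
  have It_step: "L1norm (\<lambda>t. (R ^^ Suc n) h t - (R ^^ n) h t) \<le> 2 * residual h * q ^ n"
    if h: "integrable L01 h" for n h
    using R_dist[OF It_int[OF h, of n]] It_res[OF h, of n] by (simp add: mult_ac)
  have ex: "\<exists>f. integrable L01 f \<and> (\<forall>n. L1norm (\<lambda>t. (R ^^ n) h t - f t) \<le> 2 * residual h * q ^ n / (1 - q))"
    if h: "integrable L01 h" for h
  proof -
    obtain f where "integrable L01 f" "\<And>n. L1norm (\<lambda>t. (R ^^ n) h t - f t) \<le> 2 * residual h * q ^ n / (1 - q)"
      using L1_geometric_limit[of "\<lambda>n. (R ^^ n) h", OF It_int[OF h] q It_step[OF h]] by blast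
    then show ?thesis by blast
  qed
  define lim_of where "lim_of h = (SOME f. integrable L01 f \<and>
      (\<forall>n. L1norm (\<lambda>t. (R ^^ n) h t - f t) \<le> 2 * residual h * q ^ n / (1 - q)))" for h
  \<comment> \<open>An L1 limit is determined only up to null sets, whereas a retraction has to fix
    solutions as functions; on the zero set the value is therefore prescribed.\<close>
  define r where "r h = (if residual h = 0 then h else lim_of h)" for h
  have lim_of: "integrable L01 (lim_of h) \<and>
      (\<forall>n. L1norm (\<lambda>t. (R ^^ n) h t - lim_of h t) \<le> 2 * residual h * q ^ n / (1 - q))"
    if "integrable L01 h" for h
    unfolding lim_of_def by (rule someI_ex[OF ex[OF that]])
  have It_fix: "(R ^^ n) h = h" if "residual h = 0" for n h
    using R_fix[OF that] by (induction n) auto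
  have r_int: "integrable L01 (r h)" if "integrable L01 h" for h
    using lim_of[OF that] that by (simp add: r_def)
  have r_lim: "L1norm (\<lambda>t. (R ^^ n) h t - r h t) \<le> 2 * residual h * q ^ n / (1 - q)" if "integrable L01 h" for h n
    using lim_of[OF that] by (cases "residual h = 0") (auto simp: r_def It_fix L1norm_def)
  have pow0: "(\<lambda>n. c * q ^ n / (1 - q)) \<longlonglongrightarrow> 0" for c
    using tendsto_divide[OF tendsto_mult[OF tendsto_const[of c] LIMSEQ_realpow_zero[OF q]] tendsto_const[of "1 - q"]] q
    by simp
  have r_res: "residual (r h) = 0" if h: "integrable L01 h" for h
  proof -
    have "residual (r h) \<le> residual h * q ^ n + 2 * (2 * residual h * q ^ n / (1 - q))" for n
      using residual_lipschitz[OF r_int[OF h] It_int[OF h, of n]] It_res[OF h, of n] r_lim[OF h, of n]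
        L1norm_commute[of "r h" "(R ^^ n) h"] by (simp add: mult.commute)
    moreover have "(\<lambda>n. residual h * q ^ n + 2 * (2 * residual h * q ^ n / (1 - q))) \<longlonglongrightarrow> residual h * 0 + 2 * 0"
      by (intro tendsto_add tendsto_mult tendsto_const LIMSEQ_realpow_zero[OF q] pow0)
    ultimately have "residual (r h) \<le> 0"
      by (intro LIMSEQ_le_const[where X="\<lambda>n. residual h * q ^ n + 2 * (2 * residual h * q ^ n / (1 - q))"]) auto
    then show ?thesis using residual_nonneg[of "r h"] by linarith
  qed
  show ?thesis
  proof (rule that[of r])
    show "integrable L01 (r h)" if "integrable L01 h" for h using r_int[OF that] .
    show "AE t in L01. D t (T (r h) t) (r h t) = 0" if "integrable L01 h" for h
      using r_res[OF that] residual_eq_0_iff[OF r_int[OF that]] by simp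
    show "r h = h" if "integrable L01 h" "AE t in L01. D t (T h t) (h t) = 0" for h
      using that residual_eq_0_iff[OF that(1)] by (simp add: r_def)
    fix hs :: "nat \<Rightarrow> real \<Rightarrow> 'a" and h :: "real \<Rightarrow> 'a"
    assume hs: "\<And>n. integrable L01 (hs n)" and h: "integrable L01 h"
      and lim: "L1_tendsto hs h"
    have It_cont: "L1_tendsto (\<lambda>n. (R ^^ k) (hs n)) ((R ^^ k) h)" for k
    proof (induction k)
      case 0 then show ?case using lim by simp
    next
      case (Suc k)
      then show ?case using R_cont[OF It_int[OF hs] It_int[OF h] Suc] by simp
    qed
    show "L1_tendsto (\<lambda>n. r (hs n)) (r h)"
    proof (rule LIMSEQ_I)
      fix e :: real assume e: "0 < e"
      \<comment> \<open>Within L1 distance 1 of \<open>h\<close> residuals are at most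
        \<open>residual h + 2\<close>, so \<open>c\<close> serves as the rate constant for all these
        functions at once.\<close>
      define c where "c = 2 * (residual h + 2)"
      obtain k where k: "c * q ^ k / (1 - q) < e / 3"
        using order_tendstoD(2)[OF pow0[of c], of "e/3"] e by (auto simp: eventually_sequentially)
      have "\<forall>\<^sub>F n in sequentially. L1norm (\<lambda>t. hs n t - h t) < 1 \<and>
          L1norm (\<lambda>t. (R ^^ k) (hs n) t - (R ^^ k) h t) < e / 3"
        using e by (intro eventually_conj order_tendstoD(2)[OF lim] order_tendstoD(2)[OF It_cont[of k]]) auto
      then obtain N where N: "\<And>n. N \<le> n \<Longrightarrow> L1norm (\<lambda>t. hs n t - h t) < 1"
          "\<And>n. N \<le> n \<Longrightarrow> L1norm (\<lambda>t. (R ^^ k) (hs n) t - (R ^^ k) h t) < e / 3"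
        by (auto simp: eventually_sequentially)
      show "\<exists>N. \<forall>n\<ge>N. norm (L1norm (\<lambda>t. r (hs n) t - r h t) - 0) < e"
      proof (intro exI[of _ N] allI impI)
        fix n assume n: "N \<le> n"
        have mono: "2 * residual f * q ^ k / (1 - q) \<le> c * q ^ k / (1 - q)" if "residual f \<le> residual h + 2" for f
          using that q by (intro divide_right_mono mult_right_mono) (auto simp: c_def)
        have res_n: "residual (hs n) \<le> residual h + 2"
          using residual_lipschitz[OF hs[of n] h] N(1)[OF n] by linarith
        have "L1norm (\<lambda>t. (R ^^ k) (hs n) t - r (hs n) t) < e / 3"
          using r_lim[OF hs[of n], of k] mono[OF res_n] k by linarith
        moreover have "L1norm (\<lambda>t. (R ^^ k) h t - r h t) < e / 3"
          using r_lim[OF h, of k] mono[of h] k by linarith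
        moreover have "L1norm (\<lambda>t. r (hs n) t - r h t) \<le> L1norm (\<lambda>t. r (hs n) t - (R ^^ k) (hs n) t)
            + L1norm (\<lambda>t. (R ^^ k) (hs n) t - r h t)"
          by (intro L1norm_triangle r_int It_int hs h)
        moreover have "L1norm (\<lambda>t. (R ^^ k) (hs n) t - r h t) \<le> L1norm (\<lambda>t. (R ^^ k) (hs n) t - (R ^^ k) h t)
            + L1norm (\<lambda>t. (R ^^ k) h t - r h t)"
          by (intro L1norm_triangle r_int It_int hs h)
        ultimately have "L1norm (\<lambda>t. r (hs n) t - r h t) < e"
          using N(2)[OF n] L1norm_commute[of "r (hs n)" "(R ^^ k) (hs n)"] by linarith
        then show "norm (L1norm (\<lambda>t. r (hs n) t - r h t) - 0) < e" by simp
      qed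
    qed
  qed
qed

end

section \<open>Linear second order equations\<close>

lemma continuous_on_I01_bounded:
  fixes f :: "real \<Rightarrow> 'b::real_normed_vector"
  assumes "continuous_on I01 f"
  obtains K where "0 \<le> K" "\<And>t. t \<in> I01 \<Longrightarrow> norm (f t) \<le> K"
proof -
  obtain K where K: "\<forall>y\<in>f ` I01. norm y \<le> K"
    using compact_imp_bounded[OF compact_continuous_image[OF assms compact_Icc]] unfolding bounded_iff by blast
  then have "norm (f 0) \<le> K" by auto
  then have "0 \<le> K" by (rule order_trans[OF norm_ge_zero])
  then show ?thesis using K by (intro that[of K]) auto
qed

text \<open>Banach's fixed point theorem for the equivalent first order system, with the unknown
  \<open>w t = exp (- lam * t) *\<^sub>R y t\<close>. The exponential weight makes one contraction
  work on the whole interval, without continuation from short ones.\<close>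

lemma linear_ode_exists:
  fixes p q :: "real \<Rightarrow> real"
  assumes p: "continuous_on I01 p" and q: "continuous_on I01 q"
  obtains x x' where "x 0 = \<xi>" "x' 0 = \<xi>'"
    "\<And>t. t \<in> I01 \<Longrightarrow> (x has_vector_derivative x' t) (at t within I01)"
    "\<And>t. t \<in> I01 \<Longrightarrow> (x' has_vector_derivative p t * x' t + q t * x t) (at t within I01)"
proof -
  define A where "A t y = (snd y, p t * snd y + q t * fst y)" for t and y :: "real \<times> real"
  obtain P where P0: "0 \<le> P" and P: "\<And>t. t \<in> I01 \<Longrightarrow> \<bar>p t\<bar> \<le> P"
    using continuous_on_I01_bounded[OF p] by (metis real_norm_def)
  obtain Q where Q0: "0 \<le> Q" and Q: "\<And>t. t \<in> I01 \<Longrightarrow> \<bar>q t\<bar> \<le> Q"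
    using continuous_on_I01_bounded[OF q] by (metis real_norm_def)
  define M where "M = 1 + P + Q"
  note PQ = P0 Q0
  then have M: "0 < M" by (simp add: M_def)
  have A_bound: "norm (A t y) \<le> M * norm y" if "t \<in> I01" for t y
  proof -
    have "norm (A t y) \<le> \<bar>snd y\<bar> + \<bar>p t * snd y + q t * fst y\<bar>"
      unfolding A_def using norm_Pair_le[of "snd y" "p t * snd y + q t * fst y"] by simp
    also have "\<dots> \<le> \<bar>snd y\<bar> + (\<bar>p t\<bar> * \<bar>snd y\<bar> + \<bar>q t\<bar> * \<bar>fst y\<bar>)"
      by (metis abs_mult abs_triangle_ineq add_left_mono)
    also have "\<dots> \<le> norm y + (P * norm y + Q * norm y)"
      using P[OF that] Q[OF that] PQ norm_fst_le[of "fst y" "snd y"] norm_snd_le[of "snd y" "fst y"]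
      by (intro add_mono mult_mono) auto
    finally show ?thesis by (simp add: M_def algebra_simps)
  qed
  have A_diff: "A t y - A t z = A t (y - z)" for t y z by (simp add: A_def algebra_simps)
  have A_scale: "A t (k *\<^sub>R y) = k *\<^sub>R A t y" for t k y by (simp add: A_def algebra_simps)
  \<comment> \<open>The weight turns the bound \<open>M\<close> on the system into the Lipschitz
    constant \<open>M / lam\<close>, here 1/2.\<close>
  define lam where "lam = 2 * M"
  have lam: "0 < lam" using M by (simp add: lam_def)
  \<comment> \<open>Members of the \<open>bcontfun\<close> space live on the whole line; clamping
    the time to the interval extends functions by their end values.\<close>
  define cl where "cl t = max 0 (min t (1::real))" for t
  have cl: "cl t \<in> I01" "t \<in> I01 \<Longrightarrow> cl t = t" for t by (auto simp: cl_def)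
  define f where "f w s = exp (lam * s) *\<^sub>R A s (apply_bcontfun w s)" for w s
  have f_cont: "continuous_on I01 (f w)" for w
    unfolding f_def A_def
    by (intro continuous_intros p q continuous_on_subset[OF continuous_on_apply_bcontfun]) auto
  have f_int: "f w integrable_on {0..cl t}" for w t
    using cl[of t] by (intro integrable_continuous_interval continuous_on_subset[OF f_cont]) auto
  define \<Phi> where "\<Phi> w t = exp (- lam * t) *\<^sub>R ((\<xi>, \<xi>') + integral {0..t} (f w))" for w t
  have \<Phi>_cont: "continuous_on I01 (\<Phi> w)" for w
    unfolding \<Phi>_def
    by (intro continuous_intros indefinite_integral_continuous_1 integrable_continuous_interval f_cont)
  have \<Phi>_bc: "(\<lambda>t. \<Phi> w (cl t)) \<in> bcontfun" for w
  unfolding bcontfun_def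
  proof (intro CollectI conjI)
    have "continuous_on UNIV cl" unfolding cl_def by (intro continuous_intros)
    then show "continuous_on UNIV (\<lambda>t. \<Phi> w (cl t))"
      by (rule continuous_on_compose2[OF \<Phi>_cont]) (use cl in auto)
    have "bounded (\<Phi> w ` I01)" using compact_imp_bounded[OF compact_continuous_image[OF \<Phi>_cont compact_Icc]] .
    moreover have "range (\<lambda>t. \<Phi> w (cl t)) \<subseteq> \<Phi> w ` I01" using cl by blast
    ultimately show "bounded (range (\<lambda>t. \<Phi> w (cl t)))" by (rule bounded_subset)
  qed
  define \<Psi> where "\<Psi> w = Bcontfun (\<lambda>t. \<Phi> w (cl t))" for w
  have \<Psi>: "apply_bcontfun (\<Psi> w) t = \<Phi> w (cl t)" for w t
    unfolding \<Psi>_def using Bcontfun_inverse[OF \<Phi>_bc] by simp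
  have contr: "dist (\<Psi> w) (\<Psi> z) \<le> 1/2 * dist w z" for w z
  proof (rule dist_bound)
    fix t
    define s where "s = cl t"
    define d where "d = dist w z"
    have s: "0 \<le> s" "s \<le> 1" using cl(1)[of t] by (auto simp: s_def)
    have hi: "((\<lambda>u. exp (lam * u) * (M * d)) has_integral (exp (lam * s) / lam * (M * d) - exp (lam * 0) / lam * (M * d))) {0..s}"
      using s lam
      by (intro fundamental_theorem_of_calculus)
         (auto intro!: derivative_eq_intros simp: has_real_derivative_iff_has_vector_derivative[symmetric])
    have "\<Phi> w s - \<Phi> z s = exp (- lam * s) *\<^sub>R (integral {0..s} (f w) - integral {0..s} (f z))"
      unfolding \<Phi>_def by (simp add: algebra_simps)
    also have "integral {0..s} (f w) - integral {0..s} (f z) = integral {0..s} (\<lambda>u. f w u - f z u)"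
      using f_int[of w t] f_int[of z t] by (intro integral_diff[symmetric]) (auto simp: s_def)
    finally have "norm (\<Phi> w s - \<Phi> z s) = exp (- lam * s) * norm (integral {0..s} (\<lambda>u. f w u - f z u))" by simp
    also have "norm (integral {0..s} (\<lambda>u. f w u - f z u)) \<le> integral {0..s} (\<lambda>u. exp (lam * u) * (M * d))"
    proof (rule integral_norm_bound_integral)
      show "(\<lambda>u. f w u - f z u) integrable_on {0..s}"
        using f_int[of w t] f_int[of z t] by (intro integrable_diff) (auto simp: s_def)
      show "(\<lambda>u. exp (lam * u) * (M * d)) integrable_on {0..s}" using hi by blast
      fix u assume "u \<in> {0..s}"
      then have u: "u \<in> I01" using s by auto
      have "norm (f w u - f z u) = exp (lam * u) * norm (A u (apply_bcontfun w u - apply_bcontfun z u))"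
        unfolding f_def by (simp add: A_diff flip: scaleR_diff_right)
      also have "\<dots> \<le> exp (lam * u) * (M * norm (apply_bcontfun w u - apply_bcontfun z u))"
        using A_bound[OF u] by (intro mult_left_mono) auto
      also have "\<dots> \<le> exp (lam * u) * (M * d)"
        using M dist_bounded[of w u z] by (intro mult_left_mono) (auto simp: d_def dist_norm)
      finally show "norm (f w u - f z u) \<le> exp (lam * u) * (M * d)" .
    qed
    also have "integral {0..s} (\<lambda>u. exp (lam * u) * (M * d)) = (exp (lam * s) - 1) / lam * (M * d)"
      using integral_unique[OF hi] by (simp add: algebra_simps diff_divide_distrib)
    also have "\<dots> \<le> exp (lam * s) / lam * (M * d)"
      using lam M by (intro mult_right_mono divide_right_mono) (auto simp: d_def)
    also have "exp (- lam * s) * (exp (lam * s) / lam * (M * d)) = 1/2 * d"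
      using M by (simp add: lam_def exp_minus field_simps)
    finally show "dist (apply_bcontfun (\<Psi> w) t) (apply_bcontfun (\<Psi> z) t) \<le> 1/2 * dist w z"
      by (simp add: \<Psi> dist_norm s_def d_def)
  qed
  obtain w where w: "\<Psi> w = w"
    using banach_fix_type[of "1/2" \<Psi>] contr by auto
  define y where "y t = exp (lam * t) *\<^sub>R apply_bcontfun w t" for t
  have y_eq: "y t = (\<xi>, \<xi>') + integral {0..t} (\<lambda>s. A s (y s))" if t: "t \<in> I01" for t
  proof -
    have "apply_bcontfun w t = \<Phi> w t" using \<Psi>[of w t] w cl(2)[OF t] by simp
    moreover have "f w = (\<lambda>s. A s (y s))" by (simp add: f_def y_def A_scale fun_eq_iff)
    ultimately show ?thesis unfolding y_def \<Phi>_def by (simp flip: exp_add)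
  qed
  have Ay_cont: "continuous_on I01 (\<lambda>s. A s (y s))"
    using f_cont[of w] by (simp add: f_def[abs_def] y_def A_scale)
  have y_der: "(y has_vector_derivative A t (y t)) (at t within I01)" if t: "t \<in> I01" for t
  proof (rule has_vector_derivative_transform[OF t])
    show "((\<lambda>t. (\<xi>, \<xi>') + integral {0..t} (\<lambda>s. A s (y s))) has_vector_derivative A t (y t)) (at t within I01)"
      using has_vector_derivative_add[OF has_vector_derivative_const integral_has_vector_derivative[OF Ay_cont t]] by simp
  qed (use y_eq in auto)
  show ?thesis
  proof (rule that[of "\<lambda>t. fst (y t)" "\<lambda>t. snd (y t)"])
    show "fst (y 0) = \<xi>" "snd (y 0) = \<xi>'" using y_eq[of 0] by auto
    fix t :: real assume t: "t \<in> I01"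
    show "((\<lambda>t. fst (y t)) has_vector_derivative snd (y t)) (at t within I01)"
      using bounded_linear.has_vector_derivative[OF bounded_linear_fst y_der[OF t]] by (simp add: A_def)
    show "((\<lambda>t. snd (y t)) has_vector_derivative p t * snd (y t) + q t * fst (y t)) (at t within I01)"
      using bounded_linear.has_vector_derivative[OF bounded_linear_snd y_der[OF t]] by (simp add: A_def)
  qed
qed

section \<open>The space W21\<close>

lemma integrable_bounded_scaleR:
  fixes f :: "real \<Rightarrow> 'a::{banach,second_countable_topology}" and a :: "real \<Rightarrow> real"
  assumes f: "integrable L01 f" and a: "a \<in> borel_measurable L01" "\<And>t. t \<in> I01 \<Longrightarrow> \<bar>a t\<bar> \<le> K"
  shows "integrable L01 (\<lambda>t. a t *\<^sub>R f t)"
proof (rule Bochner_Integration.integrable_bound)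
  show "integrable L01 (\<lambda>t. K *\<^sub>R f t)" using f by auto
  show "(\<lambda>t. a t *\<^sub>R f t) \<in> borel_measurable L01" using f a by auto
  show "AE t in L01. norm (a t *\<^sub>R f t) \<le> norm (K *\<^sub>R f t)"
  proof (rule AE_I2)
    fix t assume "t \<in> space L01"
    then have "\<bar>a t\<bar> \<le> \<bar>K\<bar>" using a(2)[of t] by auto
    then show "norm (a t *\<^sub>R f t) \<le> norm (K *\<^sub>R f t)" by (simp add: mult_right_mono)
  qed
qed

lemma continuous_on_I01_measurable:
  fixes f :: "real \<Rightarrow> 'a::{banach,second_countable_topology}"
  assumes "continuous_on I01 f"
  shows "f \<in> borel_measurable L01"
  using assms by (intro continuous_imp_measurable_on_sets_lebesgue) auto

lemma integrable_continuous_scaleR: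
  fixes f :: "real \<Rightarrow> 'a::{banach,second_countable_topology}" and a :: "real \<Rightarrow> real"
  assumes f: "integrable L01 f" and a: "continuous_on I01 a"
  shows "integrable L01 (\<lambda>t. a t *\<^sub>R f t)"
proof -
  obtain K where "0 \<le> K" "\<And>t. t \<in> I01 \<Longrightarrow> norm (a t) \<le> K" using continuous_on_I01_bounded[OF a] by blast
  then show ?thesis by (intro integrable_bounded_scaleR[OF f continuous_on_I01_measurable[OF a], of K]) simp
qed

lemma integrable_continuous_I01:
  fixes f :: "real \<Rightarrow> 'a::{banach,second_countable_topology}"
  assumes "continuous_on I01 f"
  shows "integrable L01 f"
proof -
  obtain K where K: "0 \<le> K" "\<And>t. t \<in> I01 \<Longrightarrow> norm (f t) \<le> K" using continuous_on_I01_bounded[OF assms] by blast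
  show ?thesis
  proof (rule Bochner_Integration.integrable_bound[OF integrable_L01_const[of K] continuous_on_I01_measurable[OF assms]])
    show "AE t in L01. norm (f t) \<le> norm K" using K by (intro AE_I2) auto
  qed
qed

lemma integrable_lebesgue_on_initial:
  fixes u :: "real \<Rightarrow> 'a::{banach,second_countable_topology}"
  assumes "integrable L01 u" "t \<in> I01"
  shows "integrable (lebesgue_on {0..t}) u"
proof -
  have "integrable lebesgue (\<lambda>s. indicator I01 s *\<^sub>R (indicator {0..t} s *\<^sub>R u s))"
  proof -
    have "integrable L01 (\<lambda>s. indicator {0..t} s *\<^sub>R u s)"
      by (rule integrable_L01_mult_indicator[OF assms(1)]) simp
    then show ?thesis by (subst integrable_restrict_space[symmetric]) simp_all
  qed
  moreover have "indicator I01 s *\<^sub>R (indicator {0..t} s *\<^sub>R u s) = indicator {0..t} s *\<^sub>R u s" for s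
    using assms(2) by (auto simp: indicator_def)
  ultimately have "integrable lebesgue (\<lambda>s. indicator {0..t} s *\<^sub>R u s)" by (simp only:)
  then show ?thesis by (subst integrable_restrict_space) simp_all
qed

lemma der1_eq:
  assumes "(x has_vector_derivative d) (at t within I01)" "t \<in> I01"
  shows "der1 x t = d"
  unfolding der1_def using vector_derivative_within_cbox[of 0 1 t x d] assms by simp

text \<open>Since \<open>der2\<close> is an arbitrary choice among the admissible functions, every
  computation with it rests on this and yields an almost everywhere identity.\<close>

lemma is_der2_unique:
  assumes "is_der2 x u" "is_der2 x v"
  shows "AE t in L01. u t = v t"
proof -
  have int: "integrable L01 u" "integrable L01 v" using assms unfolding is_der2_def by blast+
  have "AE t in L01. u t - v t = 0"
  proof (rule AE_zero_if_initial_integrals_zero)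
    fix t :: real assume t: "t \<in> I01"
    have "integral\<^sup>L (lebesgue_on {0..t}) u = integral\<^sup>L (lebesgue_on {0..t}) v"
      using assms t unfolding is_der2_def by (metis add_left_cancel)
    then show "integral\<^sup>L (lebesgue_on {0..t}) (\<lambda>t. u t - v t) = 0"
      using integrable_lebesgue_on_initial[OF int(1) t] integrable_lebesgue_on_initial[OF int(2) t] by simp
  qed (use int in auto)
  then show ?thesis by simp
qed

lemma W21_D:
  assumes "x \<in> W21"
  shows "is_der2 x (der2 x)" "integrable L01 (der2 x)" "integrable L01 (der1 x)" "integrable L01 x"
    "\<And>t. t \<in> I01 \<Longrightarrow> (x has_vector_derivative der1 x t) (at t within I01)"
    "\<And>t. t \<in> I01 \<Longrightarrow> der1 x t = der1 x 0 + integral\<^sup>L (lebesgue_on {0..t}) (der2 x)"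
    "\<And>t. t \<notin> I01 \<Longrightarrow> x t = 0"
proof -
  show d: "is_der2 x (der2 x)"
    unfolding der2_def using assms by (intro someI_ex[of "is_der2 x"]) (simp add: W21_def)
  show "integrable L01 (der2 x)"
    "\<And>t. t \<in> I01 \<Longrightarrow> (x has_vector_derivative der1 x t) (at t within I01)"
    "\<And>t. t \<in> I01 \<Longrightarrow> der1 x t = der1 x 0 + integral\<^sup>L (lebesgue_on {0..t}) (der2 x)"
    using d unfolding is_der2_def by blast+
  show "integrable L01 (der1 x)" "integrable L01 x" "\<And>t. t \<notin> I01 \<Longrightarrow> x t = 0"
    using assms unfolding W21_def by blast+
qed

lemma W21_continuous_on:
  assumes "x \<in> W21"
  shows "continuous_on I01 x"
  using W21_D(5)[OF assms] by (intro continuous_on_vector_derivative)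

lemma W21_I:
  fixes x :: "real \<Rightarrow> 'a::{banach,second_countable_topology}"
  assumes out: "\<And>t. t \<notin> I01 \<Longrightarrow> x t = 0"
    and der: "\<And>t. t \<in> I01 \<Longrightarrow> (x has_vector_derivative x' t) (at t within I01)"
    and int: "integrable L01 x'" "integrable L01 u"
    and x': "\<And>t. t \<in> I01 \<Longrightarrow> x' t = x' 0 + integral\<^sup>L (lebesgue_on {0..t}) u"
  shows "x \<in> W21" "\<And>t. t \<in> I01 \<Longrightarrow> der1 x t = x' t" "AE t in L01. der2 x t = u t"
proof -
  show d1: "der1 x t = x' t" if "t \<in> I01" for t using der1_eq[OF der[OF that] that] .
  have d2: "is_der2 x u"
    unfolding is_der2_def
  proof (intro conjI ballI)
    fix t :: real assume t: "t \<in> I01"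
    show "(x has_vector_derivative der1 x t) (at t within I01)" using der[OF t] d1[OF t] by simp
    show "der1 x t = der1 x 0 + integral\<^sup>L (lebesgue_on {0..t}) u" using d1[OF t] d1[of 0] x'[OF t] by simp
  qed (rule int)
  have "integrable L01 (der1 x)"
    using int(1) d1 by (subst Bochner_Integration.integrable_cong[OF refl, of _ _ x']) auto
  moreover have "integrable L01 x"
    using der by (intro integrable_continuous_I01 continuous_on_vector_derivative)
  ultimately show W: "x \<in> W21" unfolding W21_def using out d2 by blast
  show "AE t in L01. der2 x t = u t" by (rule is_der2_unique[OF W21_D(1)[OF W] d2])
qed

text \<open>One rule for sums, with \<open>c = 1\<close>, and differences, with
  \<open>c = -1\<close>; this explains the factors \<open>1 *\<^sub>R\<close> further on.\<close>

lemma W21_add_scaled: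
  fixes x y :: "real \<Rightarrow> 'a::{banach,second_countable_topology}"
  assumes x: "x \<in> W21" and y: "y \<in> W21"
  shows "(\<lambda>t. x t + c *\<^sub>R y t) \<in> W21"
    "\<And>t. t \<in> I01 \<Longrightarrow> der1 (\<lambda>t. x t + c *\<^sub>R y t) t = der1 x t + c *\<^sub>R der1 y t"
    "AE t in L01. der2 (\<lambda>t. x t + c *\<^sub>R y t) t = der2 x t + c *\<^sub>R der2 y t"
proof -
  let ?z = "\<lambda>t. x t + c *\<^sub>R y t" and ?z' = "\<lambda>t. der1 x t + c *\<^sub>R der1 y t"
    and ?u = "\<lambda>t. der2 x t + c *\<^sub>R der2 y t"
  note X = W21_D[OF x] and Y = W21_D[OF y]
  have out: "?z t = 0" if "t \<notin> I01" for t using X(7)[OF that] Y(7)[OF that] by simp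
  have der: "(?z has_vector_derivative ?z' t) (at t within I01)" if "t \<in> I01" for t
    by (intro has_vector_derivative_add X(5)[OF that]
        bounded_linear.has_vector_derivative[OF bounded_linear_scaleR_right Y(5)[OF that]])
  have int: "integrable L01 ?z'" "integrable L01 ?u" using X(2,3) Y(2,3) by auto
  have eq: "?z' t = ?z' 0 + integral\<^sup>L (lebesgue_on {0..t}) ?u" if t: "t \<in> I01" for t
    using X(6)[OF t] Y(6)[OF t] integrable_lebesgue_on_initial[OF X(2) t] integrable_lebesgue_on_initial[OF Y(2) t]
    by (simp add: algebra_simps)
  show "?z \<in> W21" "\<And>t. t \<in> I01 \<Longrightarrow> der1 ?z t = ?z' t" "AE t in L01. der2 ?z t = ?u t"
    using W21_I[OF out der int eq] by blast+
qed

text \<open>Lifts real solutions to the Banach space: solutions of the homogeneous equation with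
  values there are built from a real fundamental system with vector coefficients.\<close>

lemma W21_scaleR_vector:
  fixes x :: "real \<Rightarrow> real" and e :: "'a::{banach,second_countable_topology}"
  assumes x: "x \<in> W21"
  shows "(\<lambda>t. x t *\<^sub>R e) \<in> W21"
    "\<And>t. t \<in> I01 \<Longrightarrow> der1 (\<lambda>t. x t *\<^sub>R e) t = der1 x t *\<^sub>R e"
    "AE t in L01. der2 (\<lambda>t. x t *\<^sub>R e) t = der2 x t *\<^sub>R e"
proof -
  let ?z = "\<lambda>t. x t *\<^sub>R e" and ?z' = "\<lambda>t. der1 x t *\<^sub>R e" and ?u = "\<lambda>t. der2 x t *\<^sub>R e"
  note X = W21_D[OF x]
  have out: "?z t = 0" if "t \<notin> I01" for t using X(7)[OF that] by simp
  have der: "(?z has_vector_derivative ?z' t) (at t within I01)" if "t \<in> I01" for t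
    using bounded_linear.has_vector_derivative[OF bounded_linear_scaleR_left X(5)[OF that]] .
  have int: "integrable L01 ?z'" "integrable L01 ?u" using X(2,3) by auto
  have eq: "?z' t = ?z' 0 + integral\<^sup>L (lebesgue_on {0..t}) ?u" if t: "t \<in> I01" for t
    using X(6)[OF t] integrable_lebesgue_on_initial[OF X(2) t] by (simp add: scaleR_add_left)
  show "?z \<in> W21" "\<And>t. t \<in> I01 \<Longrightarrow> der1 ?z t = ?z' t" "AE t in L01. der2 ?z t = ?u t"
    using W21_I[OF out der int eq] by blast+
qed

lemma Lop_add_scaled:
  assumes "x \<in> W21" "y \<in> W21"
  shows "AE t in L01. Lop a2 a1 a0 (\<lambda>t. x t + c *\<^sub>R y t) t = Lop a2 a1 a0 x t + c *\<^sub>R Lop a2 a1 a0 y t"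
  using W21_add_scaled(3)[OF assms, of c] AE_space
proof eventually_elim
  case (elim t)
  then show ?case using W21_add_scaled(2)[OF assms, of t c] by (simp add: Lop_def algebra_simps)
qed

lemma bop_add_scaled:
  assumes "x \<in> W21" "y \<in> W21"
  shows "bop b1 b2 c1 c2 (\<lambda>t. x t + c *\<^sub>R y t) = bop b1 b2 c1 c2 x + c *\<^sub>R bop b1 b2 c1 c2 y"
  using W21_add_scaled(2)[OF assms, of 0 c] W21_add_scaled(2)[OF assms, of 1 c]
  by (simp add: bop_def algebra_simps)

lemma Lop_scaleR_vector:
  fixes x :: "real \<Rightarrow> real" and e :: "'a::{banach,second_countable_topology}"
  assumes "x \<in> W21"
  shows "AE t in L01. Lop a2 a1 a0 (\<lambda>t. x t *\<^sub>R e) t = Lop a2 a1 a0 x t *\<^sub>R e"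
  using W21_scaleR_vector(3)[OF assms, of e] AE_space
proof eventually_elim
  case (elim t)
  then show ?case using W21_scaleR_vector(2)[OF assms, of t e] by (simp add: Lop_def algebra_simps)
qed

lemma bop_scaleR_vector:
  fixes x :: "real \<Rightarrow> real" and e :: "'a::{banach,second_countable_topology}"
  assumes "x \<in> W21"
  shows "bop b1 b2 c1 c2 (\<lambda>t. x t *\<^sub>R e) = bop b1 b2 c1 c2 x *\<^sub>R e"
  using W21_scaleR_vector(2)[OF assms, of 0 e] W21_scaleR_vector(2)[OF assms, of 1 e]
  by (simp add: bop_def algebra_simps)

lemma Lop_integrable:
  assumes "continuous_on I01 a2" "continuous_on I01 a1" "continuous_on I01 a0" "x \<in> W21"
  shows "integrable L01 (Lop a2 a1 a0 x)"
  unfolding Lop_def[abs_def] using W21_D(2,3,4)[OF assms(4)] assms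
  by (intro Bochner_Integration.integrable_add integrable_continuous_scaleR)

lemma L1norm_Lop_le:
  assumes a: "continuous_on I01 a2" "continuous_on I01 a1" "continuous_on I01 a0"
  obtains K where "0 \<le> K"
    "\<And>x :: real \<Rightarrow> 'a::{banach,second_countable_topology}. x \<in> W21 \<Longrightarrow> L1norm (Lop a2 a1 a0 x) \<le> K * W21_norm x"
proof -
  let ?L = "Lop a2 a1 a0"
  obtain K2 where K2: "0 \<le> K2" "\<And>t. t \<in> I01 \<Longrightarrow> norm (a2 t) \<le> K2" using continuous_on_I01_bounded[OF a(1)] by blast
  obtain K1 where K1: "0 \<le> K1" "\<And>t. t \<in> I01 \<Longrightarrow> norm (a1 t) \<le> K1" using continuous_on_I01_bounded[OF a(2)] by blast
  obtain K0 where K0: "0 \<le> K0" "\<And>t. t \<in> I01 \<Longrightarrow> norm (a0 t) \<le> K0" using continuous_on_I01_bounded[OF a(3)] by blast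
  define K where "K = K2 + K1 + K0"
  show ?thesis
  proof (rule that[of K])
    show "0 \<le> K" using K2 K1 K0 by (simp add: K_def)
    fix x :: "real \<Rightarrow> 'a" assume x: "x \<in> W21"
    note X = W21_D[OF x]
    have "L1norm (?L x) \<le> integral01 (\<lambda>t. K * norm (der2 x t) + K * norm (der1 x t) + K * norm (x t))"
      unfolding L1norm_def
    proof (rule integral_mono)
      show "integrable L01 (\<lambda>t. norm (?L x t))" using Lop_integrable[OF a x] by auto
      show "integrable L01 (\<lambda>t. K * norm (der2 x t) + K * norm (der1 x t) + K * norm (x t))" using X(2,3,4) by auto
      fix t assume "t \<in> space L01"
      then have t: "t \<in> I01" by simp
      have le: "\<bar>a2 t\<bar> \<le> K" "\<bar>a1 t\<bar> \<le> K" "\<bar>a0 t\<bar> \<le> K"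
        using K2(1) K1(1) K0(1) K2(2)[OF t] K1(2)[OF t] K0(2)[OF t] by (simp_all add: K_def)
      have "norm (?L x t) \<le> norm (a2 t *\<^sub>R der2 x t) + norm (a1 t *\<^sub>R der1 x t) + norm (a0 t *\<^sub>R x t)"
        unfolding Lop_def by (intro norm_triangle_le add_right_mono norm_triangle_ineq)
      also have "\<dots> \<le> K * norm (der2 x t) + K * norm (der1 x t) + K * norm (x t)"
        using le by (simp only: norm_scaleR) (intro add_mono mult_right_mono norm_ge_zero)
      finally show "norm (?L x t) \<le> K * norm (der2 x t) + K * norm (der1 x t) + K * norm (x t)" .
    qed
    also have "\<dots> = K * W21_norm x" using X(2,3,4) by (simp add: W21_norm_def algebra_simps)
    finally show "L1norm (?L x) \<le> K * W21_norm x" .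
  qed
qed

section \<open>An a priori estimate for the Sobolev norm\<close>

lemma integral_L01_indicator:
  assumes "0 \<le> a" "a \<le> b" "b \<le> 1"
  shows "integral01 (\<lambda>t. indicator {a..b} t) = b - a"
proof -
  have "{a..b} \<inter> I01 = {a..b}" using assms by auto
  moreover have "measure L01 {a..b} = b - a" using assms by (subst measure_restrict_space) auto
  ultimately show ?thesis using Bochner_Integration.integral_indicator[of L01 "{a..b}"] by (simp only: space_lebesgue_on)
qed

lemma der1_diff_le:
  fixes x :: "real \<Rightarrow> 'a::{banach,second_countable_topology}"
  assumes x: "x \<in> W21" and st: "s \<in> {a..b}" "t \<in> {a..b}" "0 \<le> a" "b \<le> 1"
  shows "norm (der1 x s - der1 x t) \<le> integral01 (\<lambda>r. indicator {a..b} r *\<^sub>R norm (der2 x r))"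
proof -
  have sI: "s \<in> I01" and tI: "t \<in> I01" using st by auto
  note X = W21_D[OF x]
  have int: "integrable L01 (\<lambda>r. indicator {0..c} r *\<^sub>R der2 x r)" for c
    by (rule integrable_L01_mult_indicator[OF X(2)]) simp
  have "der1 x s - der1 x t = integral01 (\<lambda>r. indicator {0..s} r *\<^sub>R der2 x r - indicator {0..t} r *\<^sub>R der2 x r)"
    using X(6)[OF sI] X(6)[OF tI] int[of s] int[of t]
    unfolding integral_lebesgue_on_initial[OF sI] integral_lebesgue_on_initial[OF tI]
    by (subst Bochner_Integration.integral_diff) auto
  also have "norm \<dots> \<le> L1norm (\<lambda>r. indicator {0..s} r *\<^sub>R der2 x r - indicator {0..t} r *\<^sub>R der2 x r)"
    by (rule norm_integral_le_L1norm)
  also have "\<dots> \<le> integral01 (\<lambda>r. indicator {a..b} r *\<^sub>R norm (der2 x r))"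
    unfolding L1norm_def
  proof (rule integral_mono)
    show "integrable L01 (\<lambda>r. norm (indicator {0..s} r *\<^sub>R der2 x r - indicator {0..t} r *\<^sub>R der2 x r))"
      by (intro integrable_norm Bochner_Integration.integrable_diff int)
    show "integrable L01 (\<lambda>r. indicator {a..b} r *\<^sub>R norm (der2 x r))"
      by (rule integrable_L01_mult_indicator[OF integrable_norm[OF X(2)]]) simp
    fix r
    show "norm (indicator {0..s} r *\<^sub>R der2 x r - indicator {0..t} r *\<^sub>R der2 x r) \<le> indicator {a..b} r *\<^sub>R norm (der2 x r)"
      using st by (auto simp: indicator_def)
  qed
  finally show ?thesis .
qed

text \<open>For solutions given by the Green's function only a bound on \<open>G\<close> itself is
  at hand, so derivatives have to be estimated from the supremum of \<open>x\<close> and from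
  \<open>L x\<close>. The equation bounds \<open>x''\<close> by \<open>L x\<close>,
  \<open>x'\<close> and \<open>x\<close>. On a window of length \<open>\<delta>\<close> the
  derivative \<open>x'\<close> differs from a difference quotient of size at most
  \<open>2 * X / \<delta>\<close> by its variation, in which the supremum \<open>m\<close> of
  \<open>x'\<close> carries the factor \<open>c * \<delta>\<close> and can be absorbed.\<close>

lemma W21_norm_estimate:
  fixes a2 a1 a0 :: "real \<Rightarrow> real"
  assumes a: "continuous_on I01 a2" "continuous_on I01 a1" "continuous_on I01 a0"
    and nz: "\<forall>t\<in>I01. a2 t \<noteq> 0"
  obtains K where "0 \<le> K"
    "\<And>(x :: real \<Rightarrow> 'a::{banach,second_countable_topology}) X. x \<in> W21 \<Longrightarrow> (\<And>t. t \<in> I01 \<Longrightarrow> norm (x t) \<le> X) \<Longrightarrow>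
       W21_norm x \<le> K * (X + L1norm (Lop a2 a1 a0 x))"
proof -
  let ?L = "Lop a2 a1 a0"
  have "continuous_on I01 (\<lambda>t. inverse (a2 t))" using a(1) nz by (intro continuous_intros) auto
  then obtain K2 where K2: "0 \<le> K2" "\<And>t. t \<in> I01 \<Longrightarrow> norm (inverse (a2 t)) \<le> K2"
    using continuous_on_I01_bounded[of "\<lambda>t. inverse (a2 t)"] by blast
  obtain K1 where K1: "0 \<le> K1" "\<And>t. t \<in> I01 \<Longrightarrow> norm (a1 t) \<le> K1" using continuous_on_I01_bounded[OF a(2)] by blast
  obtain K0 where K0: "0 \<le> K0" "\<And>t. t \<in> I01 \<Longrightarrow> norm (a0 t) \<le> K0" using continuous_on_I01_bounded[OF a(3)] by blast
  define k where "k = 1 + K1 + K0"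
  define c where "c = K2 * k"
  have k: "1 \<le> k" using K1 K0 by (simp add: k_def)
  have c: "0 \<le> c" using K2 k by (simp add: c_def)
  \<comment> \<open>\<open>c * \<delta> \<le> 1/2\<close> makes the absorption possible, and
    \<open>\<delta> \<le> 1/2\<close> lets a window of this length fit on one side of every
    \<open>t\<close>.\<close>
  define \<delta> where "\<delta> = 1 / (2 * (c + 1))"
  have \<delta>: "0 < \<delta>" "\<delta> \<le> 1/2" "c * \<delta> \<le> 1/2" using c by (auto simp: \<delta>_def field_simps)
  \<comment> \<open>Read off from \<open>m \<le> 4 * X / \<delta> + 2 * c * (L + X)\<close> and
    \<open>1 / \<delta> = 2 * (c + 1)\<close>.\<close>
  define C where "C = 8 * (c + 1) + 2 * c"
  have C: "0 \<le> C" using c by (simp add: C_def)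
  have der2_bound: "norm (der2 x t) \<le> c * (norm (?L x t) + norm (der1 x t) + norm (x t))"
    if t: "t \<in> I01" for x :: "real \<Rightarrow> 'a" and t
  proof -
    have "der2 x t = inverse (a2 t) *\<^sub>R (?L x t - a1 t *\<^sub>R der1 x t - a0 t *\<^sub>R x t)"
      using nz t by (simp add: Lop_def)
    then have "norm (der2 x t) = \<bar>inverse (a2 t)\<bar> * norm (?L x t - a1 t *\<^sub>R der1 x t - a0 t *\<^sub>R x t)"
      by (simp only: norm_scaleR)
    also have "\<dots> \<le> K2 * (k * norm (?L x t) + k * norm (der1 x t) + k * norm (x t))"
    proof (rule mult_mono)
      have "norm (?L x t - a1 t *\<^sub>R der1 x t - a0 t *\<^sub>R x t)
          \<le> norm (?L x t) + norm (a1 t *\<^sub>R der1 x t) + norm (a0 t *\<^sub>R x t)"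
        by (meson add_mono norm_triangle_ineq4 order_refl order_trans)
      also have "\<dots> \<le> k * norm (?L x t) + k * norm (der1 x t) + k * norm (x t)"
      proof -
        have "\<bar>a1 t\<bar> \<le> k" "\<bar>a0 t\<bar> \<le> k" using K1(1) K0(1) K1(2)[OF t] K0(2)[OF t] by (simp_all add: k_def)
        then show ?thesis using mult_right_mono[OF k norm_ge_zero[of "?L x t"]]
          by (simp only: norm_scaleR) (intro add_mono mult_right_mono norm_ge_zero, simp_all)
      qed
      finally show "norm (?L x t - a1 t *\<^sub>R der1 x t - a0 t *\<^sub>R x t)
        \<le> k * norm (?L x t) + k * norm (der1 x t) + k * norm (x t)" .
    qed (use K2(1) K2(2)[OF t] in auto)
    finally show ?thesis by (simp add: c_def algebra_simps)
  qed
  have der1_bound: "norm (der1 x t0) \<le> C * (X + L1norm (?L x))"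
    if x: "x \<in> W21" and X: "\<And>t. t \<in> I01 \<Longrightarrow> norm (x t) \<le> X" and t0: "t0 \<in> I01"
    for x :: "real \<Rightarrow> 'a" and X t0
  proof -
    note XD = W21_D[OF x]
    define L where "L = L1norm (?L x)"
    have L_int: "integrable L01 (?L x)" by (rule Lop_integrable[OF a x])
    define m where "m = (SUP t\<in>I01. norm (der1 x t))"
    \<comment> \<open>Absorbing \<open>m / 2\<close> at the end presupposes that this supremum is
      finite.\<close>
    have "bdd_above ((\<lambda>t. norm (der1 x t)) ` I01)"
    proof (rule bdd_aboveI2)
      fix t :: real assume t: "t \<in> I01"
      have "norm (der1 x t) \<le> norm (der1 x 0) + norm (der1 x t - der1 x 0)" by (rule norm_triangle_sub)
      then show "norm (der1 x t) \<le> norm (der1 x 0) + integral01 (\<lambda>r. indicator {0..1} r *\<^sub>R norm (der2 x r))"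
        using der1_diff_le[OF x, of t 0 1 0] t by auto
    qed
    then have m: "norm (der1 x t) \<le> m" if "t \<in> I01" for t
      unfolding m_def using that by (rule cSUP_upper[rotated])
    have X0: "0 \<le> X" using order_trans[OF norm_ge_zero X[of 0]] by simp
    have m0: "0 \<le> m" using order_trans[OF norm_ge_zero m[of 0]] by simp
    have main: "norm (der1 x t) \<le> 2 * X / \<delta> + c * (L + X) + m / 2" if t: "t \<in> I01" for t
    proof -
      obtain p where p: "p \<in> {t, t - \<delta>}" "0 \<le> p" "p + \<delta> \<le> 1"
      proof (cases "t + \<delta> \<le> 1")
        case True then show ?thesis using that[of t] t by auto
      next
        case False then show ?thesis using that[of "t - \<delta>"] t \<delta> by auto
      qed
      define J where "J = {p..p + \<delta>}"
      have tJ: "t \<in> J" using p \<delta> by (auto simp: J_def)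
      have JI: "J \<subseteq> I01" using p by (auto simp: J_def)
      have V: "norm (der1 x s - der1 x t) \<le> c * (L + m * \<delta> + X * \<delta>)" if s: "s \<in> J" for s
      proof -
        have "norm (der1 x s - der1 x t) \<le> integral01 (\<lambda>r. indicator J r *\<^sub>R norm (der2 x r))"
          unfolding J_def using s tJ p by (intro der1_diff_le[OF x]) (auto simp: J_def)
        also have "\<dots> \<le> integral01 (\<lambda>r. c * (norm (?L x r) + (m + X) * indicator J r))"
        proof (rule integral_mono)
          show "integrable L01 (\<lambda>r. indicator J r *\<^sub>R norm (der2 x r))"
            unfolding J_def by (rule integrable_L01_mult_indicator[OF integrable_norm[OF XD(2)]]) simp
          have "integrable L01 (\<lambda>r. indicator J r *\<^sub>R (1::real))"
            unfolding J_def by (rule integrable_L01_indicator) simp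
          then show "integrable L01 (\<lambda>r. c * (norm (?L x r) + (m + X) * indicator J r))"
            using L_int by (intro integrable_mult_right Bochner_Integration.integrable_add integrable_norm) auto
          fix r assume "r \<in> space L01"
          then have r: "r \<in> I01" by simp
          show "indicator J r *\<^sub>R norm (der2 x r) \<le> c * (norm (?L x r) + (m + X) * indicator J r)"
          proof (cases "r \<in> J")
            case True
            have "norm (der2 x r) \<le> c * (norm (?L x r) + norm (der1 x r) + norm (x r))"
              by (rule der2_bound[OF r])
            also have "\<dots> \<le> c * (norm (?L x r) + (m + X))"
              using m[OF r] X[OF r] c by (intro mult_left_mono) auto
            finally show ?thesis using True by simp
          next
            case False
            then show ?thesis using c by simp
          qed
        qed
        also have "\<dots> = c * (L + (m + X) * \<delta>)"
        proof -
          have i: "integrable L01 (\<lambda>r. indicator J r :: real)"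
            using integrable_L01_indicator[of J "1::real"] by (simp add: J_def)
          have e: "integral01 (\<lambda>r. indicator J r) = \<delta>"
            unfolding J_def using integral_L01_indicator[of p "p + \<delta>"] p \<delta> by simp
          have "integral01 (\<lambda>r. c * (norm (?L x r) + (m + X) * indicator J r))
              = c * (integral01 (\<lambda>r. norm (?L x r)) + (m + X) * integral01 (\<lambda>r. indicator J r))"
            by (subst integral_mult_right_zero, subst Bochner_Integration.integral_add)
              (auto intro: integrable_norm[OF L_int] integrable_mult_right[OF i] simp only: integral_mult_right_zero)
          then show ?thesis by (simp only: e L_def L1norm_def)
        qed
        finally show ?thesis by (simp add: algebra_simps)
      qed
      \<comment> \<open>The other end of the window: \<open>x\<close> changes by at most
        \<open>2 * X\<close> over the full length \<open>\<delta>\<close>.\<close>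
      define s where "s = (if p = t then t + \<delta> else t - \<delta>)"
      have s: "s \<in> J" "\<bar>s - t\<bar> = \<delta>" using p \<delta> by (auto simp: s_def J_def)
      have seg: "closed_segment t s \<subseteq> J" using tJ s by (simp add: J_def closed_segment_subset)
      have "norm (x s - x t - (s - t) *\<^sub>R der1 x t) \<le> norm (s - t) * (c * (L + m * \<delta> + X * \<delta>))"
        using V tJ JI
        by (intro vector_differentiable_bound_linearization[where S=J and f'="der1 x"] seg
              has_vector_derivative_within_subset[OF XD(5)]) auto
      moreover have "norm ((s - t) *\<^sub>R der1 x t) \<le> norm (x s - x t - (s - t) *\<^sub>R der1 x t) + norm (x s - x t)"
        by (metis norm_minus_commute norm_triangle_sub add.commute)
      moreover have "norm (x s - x t) \<le> 2 * X"
        using norm_triangle_ineq4[of "x s" "x t"] X[of s] X[OF t] s JI by auto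
      ultimately have "\<delta> * norm (der1 x t) \<le> 2 * X + \<delta> * (c * (L + m * \<delta> + X * \<delta>))"
        using s by simp
      then have "norm (der1 x t) \<le> 2 * X / \<delta> + c * (L + m * \<delta> + X * \<delta>)"
        using \<delta> by (simp add: field_simps)
      also have "\<dots> = 2 * X / \<delta> + (c * L + (c * \<delta>) * m + c * (X * \<delta>))" by (simp add: algebra_simps)
      also have "\<dots> \<le> 2 * X / \<delta> + (c * L + (1/2) * m + c * (X * 1))"
        using \<delta> c m0 X0 by (intro add_left_mono add_mono mult_right_mono mult_left_mono) auto
      finally show ?thesis by (simp add: algebra_simps)
    qed
    have "m \<le> 2 * X / \<delta> + c * (L + X) + m / 2"
      unfolding m_def[of] by (rule cSUP_least) (use main in \<open>auto simp: m_def\<close>)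
    then have "m \<le> 4 * X / \<delta> + 2 * c * (L + X)" by simp
    also have "4 * X / \<delta> = 8 * (c + 1) * X" using c by (simp add: \<delta>_def)
    also have "8 * (c + 1) * X + 2 * c * (L + X) \<le> C * (X + L)"
    proof -
      have "0 \<le> (c + 1) * L" using c by (auto simp: L_def)
      then show ?thesis by (simp add: C_def algebra_simps)
    qed
    finally show ?thesis using m[OF t0] by (simp add: L_def)
  qed
  define K where "K = 1 + C + c * (2 + C)"
  show ?thesis
  proof (rule that[of K])
    show "0 \<le> K" using C c by (simp add: K_def)
    fix x :: "real \<Rightarrow> 'a" and X
    assume x: "x \<in> W21" and X: "\<And>t. t \<in> I01 \<Longrightarrow> norm (x t) \<le> X"
    note XD = W21_D[OF x]
    define L where "L = L1norm (?L x)"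
    have L0: "0 \<le> L" by (simp add: L_def)
    have X0: "0 \<le> X" using order_trans[OF norm_ge_zero X[of 0]] by simp
    have L_int: "integrable L01 (?L x)" by (rule Lop_integrable[OF a x])
    have d1: "norm (der1 x t) \<le> C * (X + L)" if "t \<in> I01" for t
      unfolding L_def by (rule der1_bound[OF x X that])
    have 0: "integral01 (\<lambda>t. norm (x t)) \<le> integral01 (\<lambda>t. X)"
      using XD(2,3,4) X by (intro integral_mono) auto
    have 1: "integral01 (\<lambda>t. norm (der1 x t)) \<le> integral01 (\<lambda>t. C * (X + L))"
      using XD(2,3,4) d1 by (intro integral_mono) auto
    have 2: "integral01 (\<lambda>t. norm (der2 x t)) \<le> integral01 (\<lambda>t. c * (norm (?L x t) + C * (X + L) + X))"
    proof (rule integral_mono)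
      fix t assume "t \<in> space L01"
      then have t: "t \<in> I01" by simp
      have "norm (der2 x t) \<le> c * (norm (?L x t) + norm (der1 x t) + norm (x t))" by (rule der2_bound[OF t])
      also have "\<dots> \<le> c * (norm (?L x t) + C * (X + L) + X)"
        using d1[OF t] X[OF t] c by (intro mult_left_mono) auto
      finally show "norm (der2 x t) \<le> c * (norm (?L x t) + C * (X + L) + X)" .
    qed (use XD(2,3,4) L_int in auto)
    have "integral01 (\<lambda>t. c * (norm (?L x t) + C * (X + L) + X)) = c * (L + C * (X + L) + X)"
      using L_int by (simp add: L_def L1norm_def)
    then have "W21_norm x \<le> X + C * (X + L) + c * (L + C * (X + L) + X)"
      unfolding W21_norm_def using 0 1 2 unfolding integral_L01_const by linarith
    also have "\<dots> \<le> K * (X + L)"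
    proof -
      have "0 \<le> c * X" "0 \<le> c * L" using c X0 L0 by auto
      then show ?thesis using L0 X0 by (simp add: K_def algebra_simps)
    qed
    finally show "W21_norm x \<le> K * (X + L1norm (?L x))" by (simp add: L_def)
  qed
qed

lemma homogeneous_solution_exists:
  fixes a2 a1 a0 :: "real \<Rightarrow> real"
  assumes a: "continuous_on I01 a2" "continuous_on I01 a1" "continuous_on I01 a0"
    and nz: "\<forall>t\<in>I01. a2 t \<noteq> 0"
  obtains x :: "real \<Rightarrow> real" where "x \<in> W21" "AE t in L01. Lop a2 a1 a0 x t = 0" "x 0 = \<xi>" "der1 x 0 = \<xi>'"
proof -
  define p q where "p t = - a1 t / a2 t" and "q t = - a0 t / a2 t" for t
  have "continuous_on I01 p" "continuous_on I01 q"
    unfolding p_def[abs_def] q_def[abs_def] using a nz by (auto intro!: continuous_intros)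
  then obtain x x' where x: "x 0 = \<xi>" "x' 0 = \<xi>'"
    "\<And>t. t \<in> I01 \<Longrightarrow> (x has_vector_derivative x' t) (at t within I01)"
    "\<And>t. t \<in> I01 \<Longrightarrow> (x' has_vector_derivative p t * x' t + q t * x t) (at t within I01)"
    using linear_ode_exists[of p q \<xi> \<xi>'] by blast
  define y where "y t = (if t \<in> I01 then x t else 0)" for t
  define u where "u t = p t * x' t + q t * x t" for t
  have cont: "continuous_on I01 x" "continuous_on I01 x'"
    using continuous_on_vector_derivative[OF x(3)] continuous_on_vector_derivative[OF x(4)] by simp_all
  have u_cont: "continuous_on I01 u"
    unfolding u_def using cont \<open>continuous_on I01 p\<close> \<open>continuous_on I01 q\<close> by (intro continuous_intros)
  have u_int: "integrable L01 u" by (rule integrable_continuous_I01[OF u_cont])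
  have out: "y t = 0" if "t \<notin> I01" for t using that unfolding y_def by (rule if_not_P)
  have der: "(y has_vector_derivative x' t) (at t within I01)" if t: "t \<in> I01" for t
    by (rule has_vector_derivative_transform[OF t _ x(3)[OF t]]) (simp add: y_def)
  have eq: "x' t = x' 0 + integral\<^sup>L (lebesgue_on {0..t}) u" if t: "t \<in> I01" for t
  proof -
    have "(u has_integral x' t - x' 0) {0..t}"
      using t x(4) unfolding u_def
      by (intro fundamental_theorem_of_calculus has_vector_derivative_within_subset[OF x(4)]) auto
    then have "integral {0..t} u = x' t - x' 0" by (rule integral_unique)
    then show ?thesis using lebesgue_integral_eq_integral[OF integrable_lebesgue_on_initial[OF u_int t]] by simp
  qed
  have W: "y \<in> W21" "\<And>t. t \<in> I01 \<Longrightarrow> der1 y t = x' t" "AE t in L01. der2 y t = u t"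
    using W21_I[OF out der integrable_continuous_I01[OF cont(2)] u_int eq] by blast+
  have "AE t in L01. Lop a2 a1 a0 y t = 0"
    using W(3) AE_space
  proof eventually_elim
    case (elim t)
    then have t: "t \<in> I01" by simp
    then show ?case using elim W(2)[OF t] nz by (simp add: Lop_def u_def p_def q_def y_def field_simps)
  qed
  then show ?thesis using that[of y] W x(1,2) by (simp add: y_def)
qed

section \<open>The boundary value problem\<close>

lemma W21_combination:
  fixes \<phi> \<theta> :: "real \<Rightarrow> real" and e f :: "'a::{banach,second_countable_topology}"
  assumes \<phi>: "\<phi> \<in> W21" "AE t in L01. Lop a2 a1 a0 \<phi> t = 0"
    and \<theta>: "\<theta> \<in> W21" "AE t in L01. Lop a2 a1 a0 \<theta> t = 0"
  defines "z \<equiv> \<lambda>t. \<phi> t *\<^sub>R e + 1 *\<^sub>R (\<theta> t *\<^sub>R f)"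
  shows "z \<in> W21" "AE t in L01. Lop a2 a1 a0 z t = 0"
    "bop b1 b2 c1 c2 z = bop b1 b2 c1 c2 \<phi> *\<^sub>R e + bop b1 b2 c1 c2 \<theta> *\<^sub>R f"
    "der1 z 0 = der1 \<phi> 0 *\<^sub>R e + der1 \<theta> 0 *\<^sub>R f"
proof -
  have W: "(\<lambda>t. \<phi> t *\<^sub>R e) \<in> W21" "(\<lambda>t. \<theta> t *\<^sub>R f) \<in> W21" using W21_scaleR_vector(1) \<phi>(1) \<theta>(1) by blast+
  show "z \<in> W21" unfolding z_def by (rule W21_add_scaled(1)[OF W])
  show "AE t in L01. Lop a2 a1 a0 z t = 0"
    using Lop_add_scaled[OF W, of a2 a1 a0 1] Lop_scaleR_vector[OF \<phi>(1), of a2 a1 a0 e]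
      Lop_scaleR_vector[OF \<theta>(1), of a2 a1 a0 f] \<phi>(2) \<theta>(2)
    unfolding z_def by eventually_elim simp
  show "bop b1 b2 c1 c2 z = bop b1 b2 c1 c2 \<phi> *\<^sub>R e + bop b1 b2 c1 c2 \<theta> *\<^sub>R f"
    unfolding z_def bop_add_scaled[OF W] bop_scaleR_vector[OF \<phi>(1)] bop_scaleR_vector[OF \<theta>(1)] by simp
  show "der1 z 0 = der1 \<phi> 0 *\<^sub>R e + der1 \<theta> 0 *\<^sub>R f"
    using W21_add_scaled(2)[OF W, of 0 1] W21_scaleR_vector(2)[OF \<phi>(1), of 0 e] W21_scaleR_vector(2)[OF \<theta>(1), of 0 f]
    unfolding z_def by simp
qed

lemma singular_2x2_kernel:
  fixes m11 m12 m21 m22 :: real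
  assumes "m11 * m22 - m12 * m21 = 0"
  obtains c d where "c \<noteq> 0 \<or> d \<noteq> 0" "m11 * c + m12 * d = 0" "m21 * c + m22 * d = 0"
proof -
  consider "m11 \<noteq> 0 \<or> m12 \<noteq> 0" | "m21 \<noteq> 0 \<or> m22 \<noteq> 0" | "m11 = 0" "m12 = 0" "m21 = 0" "m22 = 0" by blast
  then show ?thesis
  proof cases
    case 1 then show ?thesis using that[of m12 "- m11"] assms by (auto simp: algebra_simps)
  next
    case 2 then show ?thesis using that[of m22 "- m21"] assms by (auto simp: algebra_simps)
  next
    case 3 then show ?thesis using that[of 1 0] by auto
  qed
qed

text \<open>The boundary values of a fundamental system with unit initial data form a real 2x2
  matrix. A kernel vector would be the initial data of a nontrivial solution of the scalar problem,
  so the matrix is invertible.\<close>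

lemma boundary_data_solution_exists:
  fixes a2 a1 a0 :: "real \<Rightarrow> real" and d1 d2 :: "'a::{banach,second_countable_topology}"
  assumes a: "continuous_on I01 a2" "continuous_on I01 a1" "continuous_on I01 a0"
    and nz: "\<forall>t\<in>I01. a2 t \<noteq> 0"
    and trivial: "\<forall>x::real \<Rightarrow> real. x \<in> W21 \<and> (AE t in L01. Lop a2 a1 a0 x t = 0) \<and>
        bop b11 b12 c11 c12 x = 0 \<and> bop b21 b22 c21 c22 x = 0 \<longrightarrow> x = (\<lambda>t. 0)"
  obtains z :: "real \<Rightarrow> 'a" where "z \<in> W21" "AE t in L01. Lop a2 a1 a0 z t = 0"
    "bop b11 b12 c11 c12 z = d1" "bop b21 b22 c21 c22 z = d2"
proof -
  obtain \<phi> :: "real \<Rightarrow> real" where \<phi>: "\<phi> \<in> W21" "AE t in L01. Lop a2 a1 a0 \<phi> t = 0" "\<phi> 0 = 1" "der1 \<phi> 0 = 0"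
    by (rule homogeneous_solution_exists[OF a nz])
  obtain \<theta> :: "real \<Rightarrow> real" where \<theta>: "\<theta> \<in> W21" "AE t in L01. Lop a2 a1 a0 \<theta> t = 0" "\<theta> 0 = 0" "der1 \<theta> 0 = 1"
    by (rule homogeneous_solution_exists[OF a nz])
  define m11 m12 m21 m22 where "m11 = bop b11 b12 c11 c12 \<phi>" and "m12 = bop b11 b12 c11 c12 \<theta>"
    and "m21 = bop b21 b22 c21 c22 \<phi>" and "m22 = bop b21 b22 c21 c22 \<theta>"
  define det where "det = m11 * m22 - m12 * m21"
  have det: "det \<noteq> 0"
  proof
    assume "det = 0"
    then obtain c d where cd: "c \<noteq> 0 \<or> d \<noteq> 0" "m11 * c + m12 * d = 0" "m21 * c + m22 * d = 0"
      unfolding det_def by (rule singular_2x2_kernel)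
    define y :: "real \<Rightarrow> real" where "y = (\<lambda>t. \<phi> t *\<^sub>R c + 1 *\<^sub>R (\<theta> t *\<^sub>R d))"
    note Y = W21_combination[where e=c and f=d, OF \<phi>(1,2) \<theta>(1,2), folded y_def]
    have "bop b11 b12 c11 c12 y = 0" "bop b21 b22 c21 c22 y = 0"
      using cd Y(3)[of b11 b12 c11 c12] Y(3)[of b21 b22 c21 c22] by (simp_all add: m11_def m12_def m21_def m22_def)
    then have y0: "y = (\<lambda>t. 0)" using trivial Y(1,2) by blast
    have "y 0 = c" by (simp add: y_def \<phi> \<theta>)
    then have "c = 0" using y0 by simp
    moreover have "der1 y 0 = d" using Y(4) by (simp add: \<phi> \<theta>)
    moreover have "der1 y 0 = 0" unfolding y0 by (rule der1_eq) auto
    ultimately show False using cd by simp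
  qed
  \<comment> \<open>Cramer's rule with a real matrix and vector right-hand sides.\<close>
  define e f where "e = (1 / det) *\<^sub>R (m22 *\<^sub>R d1 - m12 *\<^sub>R d2)" and "f = (1 / det) *\<^sub>R (m11 *\<^sub>R d2 - m21 *\<^sub>R d1)"
  note Z = W21_combination[where e=e and f=f, OF \<phi>(1,2) \<theta>(1,2)]
  show ?thesis
  proof (rule that[OF Z(1,2)])
    have "m11 *\<^sub>R e + m12 *\<^sub>R f = (1 / det) *\<^sub>R (det *\<^sub>R d1)"
      unfolding e_def f_def det_def by (simp add: algebra_simps)
    then show "bop b11 b12 c11 c12 (\<lambda>t. \<phi> t *\<^sub>R e + 1 *\<^sub>R (\<theta> t *\<^sub>R f)) = d1"
      using det by (simp only: Z(3) m11_def[symmetric] m12_def[symmetric]) simp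
    have "m21 *\<^sub>R e + m22 *\<^sub>R f = (1 / det) *\<^sub>R (det *\<^sub>R d2)"
      unfolding e_def f_def det_def by (simp add: algebra_simps)
    then show "bop b21 b22 c21 c22 (\<lambda>t. \<phi> t *\<^sub>R e + 1 *\<^sub>R (\<theta> t *\<^sub>R f)) = d2"
      using det by (simp only: Z(3) m21_def[symmetric] m22_def[symmetric]) simp
  qed
qed

section \<open>Distances to the values of a multifunction\<close>

lemma infdist_le_hausd:
  assumes A: "A \<noteq> {}" "bounded A" and B: "B \<noteq> {}" "bounded B"
  shows "infdist y A \<le> infdist y B + hausd A B"
proof -
  obtain a where a: "a \<in> A" using A by blast
  obtain K where K: "\<And>b. b \<in> B \<Longrightarrow> dist a b \<le> K" using B(2) unfolding bounded_any_center[where a=a] by blast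
  \<comment> \<open>The supremum in \<open>hausd\<close> dominates its terms only once the distances
    are known to be bounded; this is where boundedness of the values enters.\<close>
  have bdd: "bdd_above ((\<lambda>b. infdist b A) ` B)"
  proof (rule bdd_aboveI2)
    fix b assume "b \<in> B"
    then show "infdist b A \<le> K" using infdist_le[OF a, of b] K[of b] by (simp add: dist_commute)
  qed
  have "infdist y A - hausd A B \<le> dist y b" if b: "b \<in> B" for b
  proof -
    have "infdist b A \<le> (SUP b\<in>B. infdist b A)" by (rule cSUP_upper[OF b bdd])
    then have "infdist b A \<le> hausd A B" unfolding hausd_def by linarith
    then show ?thesis using infdist_triangle[of y A b] by linarith
  qed
  then have "infdist y A - hausd A B \<le> infdist y B"
    unfolding infdist_notempty[OF B(1)] using B(1) by (intro cINF_greatest)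
  then show ?thesis by simp
qed

lemma infdist_less_iff:
  assumes "A \<noteq> {}"
  shows "infdist y A < r \<longleftrightarrow> A \<inter> ball y r \<noteq> {}"
  unfolding infdist_notempty[OF assms] using assms by (subst cINF_less_iff) auto

text \<open>A sublevel set of the distance consists of the times at which the value meets an open
  ball, and such sets are measurable by hypothesis.\<close>

lemma infdist_multifunction_measurable:
  fixes F :: "real \<Rightarrow> 'a::metric_space set"
  assumes "\<And>t. t \<in> I01 \<Longrightarrow> F t \<noteq> {}"
    and "\<And>A. open A \<Longrightarrow> {t \<in> I01. F t \<inter> A \<noteq> {}} \<in> sets lebesgue"
  shows "(\<lambda>t. infdist y (F t)) \<in> borel_measurable L01"
proof (rule borel_measurableI_less)
  fix r :: real
  have "{t \<in> space L01. infdist y (F t) < r} = {t \<in> I01. F t \<inter> ball y r \<noteq> {}}"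
    using infdist_less_iff[OF assms(1)] by auto
  then show "{t \<in> space L01. infdist y (F t) < r} \<in> sets L01"
    using assms(2)[of "ball y r"] by (auto simp: sets_restrict_space_iff)
qed

section \<open>Transfer from right-hand sides to solutions\<close>

theorem theorem4p1:
  fixes a2 a1 a0 :: "real \<Rightarrow> real"
    and b11 b12 b21 b22 c11 c12 c21 c22 :: real
    and d1 d2 :: "'a::{banach,second_countable_topology}"
    and G :: "real \<Rightarrow> real \<Rightarrow> real"
    and F :: "real \<Rightarrow> 'a \<Rightarrow> 'a set"
    and \<mu> \<alpha> :: "real \<Rightarrow> real"
  assumes cont_a: "continuous_on I01 a2" "continuous_on I01 a1" "continuous_on I01 a0"
    and a2_nz: "\<forall>t\<in>I01. a2 t \<noteq> 0"
    and trivial: "\<forall>x::real \<Rightarrow> real. x \<in> W21 \<and>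
                     (AE t in lebesgue_on I01. Lop a2 a1 a0 x t = 0) \<and>
                     bop b11 b12 c11 c12 x = 0 \<and> bop b21 b22 c21 c22 x = 0
                     \<longrightarrow> x = (\<lambda>t. 0)"
    and G_cont: "continuous_on (I01 \<times> I01) (\<lambda>(t,s). G t s)"
    and G_green: "\<forall>u::real \<Rightarrow> 'a. integrable (lebesgue_on I01) u \<longrightarrow>
          (let x = (\<lambda>t. if t \<in> I01 then integral\<^sup>L (lebesgue_on I01) (\<lambda>s. G t s *\<^sub>R u s) else 0) in
             x \<in> W21 \<and> (AE t in lebesgue_on I01. Lop a2 a1 a0 x t = u t) \<and>
             bop b11 b12 c11 c12 x = 0 \<and> bop b21 b22 c21 c22 x = 0 \<and>
             (\<forall>y\<in>W21. (AE t in lebesgue_on I01. Lop a2 a1 a0 y t = u t) \<and>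
                 bop b11 b12 c11 c12 y = 0 \<and> bop b21 b22 c21 c22 y = 0 \<longrightarrow> y = x))"
    and h1: "\<forall>t\<in>I01. \<forall>x. F t x \<noteq> {} \<and> closed (F t x) \<and> bounded (F t x)"
    and h2: "\<forall>x. \<forall>A. open A \<longrightarrow> {t \<in> I01. F t x \<inter> A \<noteq> {}} \<in> sets lebesgue"
    and h3: "integrable (lebesgue_on I01) \<mu>"
            "AE t in lebesgue_on I01. \<forall>x y. hausd (F t x) (F t y) \<le> \<mu> t * dist x y"
    and h4: "integrable (lebesgue_on I01) \<alpha>"
            "AE t in lebesgue_on I01. infdist 0 (F t 0) \<le> \<alpha> t"
    and small: "integral\<^sup>L (lebesgue_on I01) (\<lambda>t. \<bar>\<mu> t\<bar>)
                  < inverse (SUP p\<in>I01 \<times> I01. \<bar>G (fst p) (snd p)\<bar>)"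
  shows "W21_retract {x \<in> W21. bop b11 b12 c11 c12 x = d1 \<and> bop b21 b22 c21 c22 x = d2 \<and>
            (AE t in lebesgue_on I01. Lop a2 a1 a0 x t \<in> F t (x t))}"
proof -
  let ?L = "Lop a2 a1 a0" and ?B = "bop b11 b12 c11 c12" and ?C = "bop b21 b22 c21 c22"
  define g where "g = (SUP p\<in>I01 \<times> I01. \<bar>G (fst p) (snd p)\<bar>)"
  have "continuous_on (I01 \<times> I01) (\<lambda>p. \<bar>G (fst p) (snd p)\<bar>)"
    using continuous_on_rabs[OF G_cont] by (simp add: case_prod_unfold)
  then have "bounded ((\<lambda>p. \<bar>G (fst p) (snd p)\<bar>) ` (I01 \<times> I01))"
    by (intro compact_imp_bounded compact_continuous_image compact_Times compact_Icc)
  then have "bdd_above ((\<lambda>p. \<bar>G (fst p) (snd p)\<bar>) ` (I01 \<times> I01))" by (rule bounded_imp_bdd_above)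
  then have G_le: "\<bar>G t s\<bar> \<le> g" if "t \<in> I01" "s \<in> I01" for t s
    unfolding g_def using cSUP_upper[of "(t, s)" "I01 \<times> I01" "\<lambda>p. \<bar>G (fst p) (snd p)\<bar>"] that by auto
  \<comment> \<open>Because of \<open>inverse 0 = 0\<close>, the strict inequality
    \<open>small\<close> itself excludes \<open>g = 0\<close>.\<close>
  have g: "0 < g"
  proof -
    have "0 \<le> integral01 (\<lambda>t. \<bar>\<mu> t\<bar>)" by simp
    then have "0 < inverse g" using small unfolding g_def by linarith
    then show ?thesis by simp
  qed
  have contr: "integral01 (\<lambda>t. \<bar>\<mu> t\<bar>) * g < 1"
  proof -
    have "integral01 (\<lambda>t. \<bar>\<mu> t\<bar>) * g < inverse g * g"
      using small g unfolding g_def[symmetric] by (intro mult_strict_right_mono)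
    then show ?thesis using g by simp
  qed
  have G_cont_s: "continuous_on I01 (G t)" if t: "t \<in> I01" for t
  proof -
    have "continuous_on I01 (\<lambda>s. (t, s))" by (intro continuous_intros)
    then have "continuous_on I01 (\<lambda>s. (\<lambda>(t, s). G t s) (t, s))"
      by (rule continuous_on_compose2[OF G_cont]) (use t in auto)
    then show ?thesis by simp
  qed
  obtain z :: "real \<Rightarrow> 'a" where z: "z \<in> W21" "AE t in L01. ?L z t = 0"
    "?B z = d1" "?C z = d2"
    by (rule boundary_data_solution_exists[OF cont_a a2_nz trivial])
  define Gop where "Gop u = (\<lambda>t. if t \<in> I01 then integral01 (\<lambda>s. G t s *\<^sub>R u s) else 0)" for u :: "real \<Rightarrow> 'a"
  have green: "Gop u \<in> W21 \<and> (AE t in L01. ?L (Gop u) t = u t) \<and>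
      ?B (Gop u) = 0 \<and> ?C (Gop u) = 0 \<and>
      (\<forall>y\<in>W21. (AE t in L01. ?L y t = u t) \<and>
         ?B y = 0 \<and> ?C y = 0 \<longrightarrow> y = Gop u)"
    if u: "integrable L01 u" for u
    using G_green[rule_format, OF u] unfolding Let_def Gop_def .
  note Gop = green[THEN conjunct1] green[THEN conjunct2, THEN conjunct1]
    green[THEN conjunct2, THEN conjunct2, THEN conjunct1]
    green[THEN conjunct2, THEN conjunct2, THEN conjunct2, THEN conjunct1]
  have Gop_unique: "y = Gop u" if "integrable L01 u" "y \<in> W21" "AE t in L01. ?L y t = u t"
      "?B y = 0" "?C y = 0" for u y
    using green[OF that(1), THEN conjunct2, THEN conjunct2, THEN conjunct2, THEN conjunct2,
        THEN bspec, OF that(2)] that(3-5) by simp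
  have Gop_int: "integrable L01 (\<lambda>s. G t s *\<^sub>R u s)" if "integrable L01 u" "t \<in> I01" for u :: "real \<Rightarrow> 'a" and t
    by (rule integrable_continuous_scaleR[OF that(1) G_cont_s[OF that(2)]])
  have Gop_diff: "norm (Gop u t - Gop v t) \<le> g * L1norm (\<lambda>t. u t - v t)"
    if u: "integrable L01 u" and v: "integrable L01 v" and t: "t \<in> I01" for u v t
  proof -
    have "Gop u t - Gop v t = integral01 (\<lambda>s. G t s *\<^sub>R u s - G t s *\<^sub>R v s)"
      using Gop_int[OF u t] Gop_int[OF v t] t by (simp add: Gop_def)
    also have "norm \<dots> \<le> L1norm (\<lambda>s. G t s *\<^sub>R u s - G t s *\<^sub>R v s)" by (rule norm_integral_le_L1norm)
    also have "\<dots> \<le> integral01 (\<lambda>s. g * norm (u s - v s))"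
      unfolding L1norm_def
    proof (rule integral_mono)
      show "integrable L01 (\<lambda>s. norm (G t s *\<^sub>R u s - G t s *\<^sub>R v s))"
        by (intro integrable_norm Bochner_Integration.integrable_diff Gop_int u v t)
      show "integrable L01 (\<lambda>s. g * norm (u s - v s))" using u v by auto
      fix s assume "s \<in> space L01"
      then have "\<bar>G t s\<bar> \<le> g" using G_le[OF t] by simp
      then show "norm (G t s *\<^sub>R u s - G t s *\<^sub>R v s) \<le> g * norm (u s - v s)"
        by (simp add: mult_right_mono flip: scaleR_diff_right)
    qed
    finally show ?thesis by (simp add: L1norm_def)
  qed
  \<comment> \<open>\<open>z\<close> carries the boundary data and \<open>Gop u\<close> the
    right-hand side; the fixed summand \<open>z\<close> leaves the Lipschitz constant
    \<open>g\<close> unchanged.\<close>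
  define T where "T u t = Gop u t + 1 *\<^sub>R z t" for u t
  have T: "T u \<in> W21" "AE t in L01. ?L (T u) t = u t"
      "?B (T u) = d1" "?C (T u) = d2" if u: "integrable L01 u" for u
  proof -
    have T_eq: "T u = (\<lambda>t. Gop u t + 1 *\<^sub>R z t)" by (simp add: T_def fun_eq_iff)
    show "T u \<in> W21" unfolding T_eq by (rule W21_add_scaled(1)[OF Gop(1)[OF u] z(1)])
    show "AE t in L01. ?L (T u) t = u t"
      using Lop_add_scaled[OF Gop(1)[OF u] z(1), of a2 a1 a0 1] Gop(2)[OF u] z(2)
      unfolding T_eq by eventually_elim simp
    show "?B (T u) = d1" "?C (T u) = d2"
      unfolding T_eq bop_add_scaled[OF Gop(1)[OF u] z(1)] using Gop(3,4)[OF u] z(3,4) by simp_all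
  qed
  \<comment> \<open>The uniqueness clause for the Green's function gives equality of functions here,
    not merely almost everywhere, so that the retraction can fix solutions exactly.\<close>
  have T_Lop: "T (?L x) = x"
    if x: "x \<in> W21" "?B x = d1" "?C x = d2" for x
  proof -
    define y where "y = (\<lambda>t. x t + (-1) *\<^sub>R z t)"
    have "y \<in> W21" unfolding y_def by (rule W21_add_scaled(1)[OF x(1) z(1)])
    moreover have "AE t in L01. ?L y t = ?L x t"
      using Lop_add_scaled[OF x(1) z(1), of a2 a1 a0 "-1"] z(2) unfolding y_def by eventually_elim simp
    moreover have "?B y = 0" "?C y = 0"
      unfolding y_def bop_add_scaled[OF x(1) z(1)] using x z by simp_all
    ultimately have "y = Gop (?L x)"
      by (intro Gop_unique Lop_integrable[OF cont_a x(1)])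
    then have "x t = T (?L x) t" for t
      by (simp add: T_def y_def fun_eq_iff) (metis diff_add_cancel)
    then show ?thesis by (simp add: fun_eq_iff)
  qed
  obtain C0 where C0: "\<And>t. t \<in> I01 \<Longrightarrow> norm (z t) \<le> C0"
    using continuous_on_I01_bounded[OF W21_continuous_on[OF z(1)]] by blast
  obtain N where N: "{t \<in> space L01. \<not> (\<forall>x y. hausd (F t x) (F t y) \<le> \<mu> t * dist x y)} \<subseteq> N"
      "emeasure L01 N = 0" "N \<in> sets L01"
    using AE_E[OF h3(2)] by blast
  have N_AE: "AE t in L01. t \<notin> N" using N(2,3) by (intro AE_not_in) (simp add: null_setsI)
  \<comment> \<open>changing \<open>F\<close> to \<open>{0}\<close> on the null set \<open>N\<close> makes the Lipschitz condition hold everywhere\<close>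
  define D where "D t x y = (if t \<in> N then norm y else infdist y (F t x))" for t x y
  \<comment> \<open>The Lipschitz weight has to be nonnegative everywhere, hence the absolute value,
    whose integral is also the quantity bounded in \<open>small\<close>.\<close>
  interpret L1_inclusion D T "\<lambda>t. \<bar>\<mu> t\<bar>" \<alpha> g C0
  proof
    show "0 \<le> D t x y" for t x y by (simp add: D_def infdist_nonneg)
    show "(\<lambda>t. D t x y) \<in> borel_measurable L01" for x y
    proof -
      have "(\<lambda>t. infdist y (F t x)) \<in> borel_measurable L01"
        using h1 h2 by (intro infdist_multifunction_measurable) auto
      then show ?thesis unfolding D_def using N(3)
        by (intro measurable_If_set) (auto simp: sets.Int_space_eq2)
    qed
    show "D t x y \<le> D t x' y' + norm (y - y') + \<bar>\<mu> t\<bar> * norm (x - x')" if t: "t \<in> I01" for t x y x' y'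
    proof (cases "t \<in> N")
      case True
      have "norm y \<le> norm y' + norm (y - y')" by (rule norm_triangle_sub)
      moreover have "0 \<le> \<bar>\<mu> t\<bar> * norm (x - x')" by simp
      ultimately have "norm y \<le> norm y' + norm (y - y') + \<bar>\<mu> t\<bar> * norm (x - x')" by linarith
      then show ?thesis using True by (simp add: D_def)
    next
      case False
      then have "hausd (F t x) (F t x') \<le> \<mu> t * dist x x'" using N(1) t by auto
      also have "\<dots> \<le> \<bar>\<mu> t\<bar> * norm (x - x')" by (simp add: dist_norm mult_right_mono)
      finally have "hausd (F t x) (F t x') \<le> \<bar>\<mu> t\<bar> * norm (x - x')" .
      moreover have "infdist y' (F t x) \<le> infdist y' (F t x') + hausd (F t x) (F t x')"
        using h1 t by (intro infdist_le_hausd) auto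
      moreover have "infdist y (F t x) \<le> infdist y' (F t x) + norm (y - y')"
        using infdist_triangle[of y "F t x" y'] by (simp add: dist_norm)
      ultimately show ?thesis using False by (simp add: D_def)
    qed
    show "\<exists>y'. norm (y' - y) < D t x y + e \<and> D t x y' < e" if t: "t \<in> I01" and e: "0 < e" for t e x y
    proof (cases "t \<in> N")
      case True
      then show ?thesis using e by (intro exI[of _ 0]) (simp add: D_def)
    next
      case False
      have "infdist y (F t x) < infdist y (F t x) + e" using e by simp
      then obtain y' where y': "y' \<in> F t x" "dist y y' < infdist y (F t x) + e"
        using infdist_less_iff[of "F t x" y "infdist y (F t x) + e"] h1 t by auto
      then have "infdist y' (F t x) = 0" by simp
      then show ?thesis using y' e False
        by (intro exI[of _ y']) (simp add: D_def dist_norm norm_minus_commute)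
    qed
    show "AE t in L01. D t 0 0 \<le> \<alpha> t" using h4(2) N_AE by eventually_elim (simp add: D_def)
    show "T h \<in> borel_measurable L01" if "integrable L01 h" for h
      by (rule continuous_on_I01_measurable[OF W21_continuous_on[OF T(1)[OF that]]])
    show "norm (T h t - T h' t) \<le> g * L1norm (\<lambda>t. h t - h' t)"
      if "integrable L01 h" "integrable L01 h'" "t \<in> I01" for h h' t
      using Gop_diff[OF that] by (simp add: T_def)
    show "norm (T (\<lambda>t. 0) t) \<le> C0" if "t \<in> I01" for t
      using C0[OF that] by (simp add: T_def Gop_def)
  qed (use h3 h4 g contr in auto)
  obtain \<rho> where \<rho>_int: "\<And>h. integrable L01 h \<Longrightarrow> integrable L01 (\<rho> h)"
    and \<rho>_sol: "\<And>h. integrable L01 h \<Longrightarrow> AE t in L01. D t (T (\<rho> h) t) (\<rho> h t) = 0"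
    and \<rho>_fix: "\<And>h. integrable L01 h \<Longrightarrow> AE t in L01. D t (T h t) (h t) = 0 \<Longrightarrow> \<rho> h = h"
    and \<rho>_cont: "\<And>hs h. (\<And>n. integrable L01 (hs n)) \<Longrightarrow> integrable L01 h \<Longrightarrow>
      L1_tendsto hs h \<Longrightarrow> L1_tendsto (\<lambda>n. \<rho> (hs n)) (\<rho> h)"
    using solution_retraction by blast
  obtain K where K: "0 \<le> K" "\<And>x :: real \<Rightarrow> 'a. x \<in> W21 \<Longrightarrow> L1norm (?L x) \<le> K * W21_norm x"
    using L1norm_Lop_le[OF cont_a] by blast
  obtain K' where K': "0 \<le> K'" "\<And>(x :: real \<Rightarrow> 'a) X. x \<in> W21 \<Longrightarrow> (\<And>t. t \<in> I01 \<Longrightarrow> norm (x t) \<le> X) \<Longrightarrow>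
       W21_norm x \<le> K' * (X + L1norm (?L x))"
    using W21_norm_estimate[OF cont_a a2_nz] by blast
  let ?S = "{x \<in> W21. ?B x = d1 \<and> ?C x = d2 \<and> (AE t in L01. ?L x t \<in> F t (x t))}"
  \<comment> \<open>\<open>?L\<close> forgets boundary data, so \<open>T\<close> inverts it only on
    functions with data \<open>d1\<close> and \<open>d2\<close>. This includes \<open>?S\<close>,
    where \<open>\<rho>\<close> moreover fixes \<open>?L x\<close>.\<close>
  define r where "r x = T (\<rho> (?L x))" for x :: "real \<Rightarrow> 'a"
  have L_int: "integrable L01 (?L x)" if "x \<in> W21" for x :: "real \<Rightarrow> 'a"
    by (rule Lop_integrable[OF cont_a that])
  have r_S: "r x \<in> ?S" if x: "x \<in> W21" for x
  proof -
    define u where "u = \<rho> (?L x)"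
    have u: "integrable L01 u" unfolding u_def by (rule \<rho>_int[OF L_int[OF x]])
    have "AE t in L01. ?L (T u) t \<in> F t (T u t)"
      using T(2)[OF u] \<rho>_sol[OF L_int[OF x], folded u_def] N_AE AE_space
    proof eventually_elim
      case (elim t)
      then have "infdist (u t) (F t (T u t)) = 0" "t \<in> I01" by (simp_all add: D_def)
      then show ?case using h1 elim(1) by (simp add: in_closed_iff_infdist_zero)
    qed
    then show ?thesis using T(1,3,4)[OF u] by (simp add: r_def u_def[symmetric])
  qed
  have r_fix: "r x = x" if x: "x \<in> ?S" for x
  proof -
    have xW: "x \<in> W21" and T_x: "T (?L x) = x" using x T_Lop by auto
    have "AE t in L01. ?L x t \<in> F t (x t)" using x by simp
    then have "AE t in L01. D t (T (?L x) t) (?L x t) = 0"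
      using N_AE unfolding T_x by eventually_elim (simp add: D_def)
    then have "\<rho> (?L x) = ?L x" by (rule \<rho>_fix[OF L_int[OF xW]])
    then show ?thesis by (simp add: r_def T_x)
  qed
  have minus_eq: "y - x = (\<lambda>t. y t + (-1) *\<^sub>R x t)" for x y :: "real \<Rightarrow> 'a" by (simp add: fun_eq_iff)
  have L_diff: "AE t in L01. ?L (y - x) t = ?L y t - ?L x t" if "x \<in> W21" "y \<in> W21" for x y :: "real \<Rightarrow> 'a"
    using Lop_add_scaled[OF that(2,1), of a2 a1 a0 "-1"] unfolding minus_eq by simp
  have W_diff: "y - x \<in> W21" if "x \<in> W21" "y \<in> W21" for x y :: "real \<Rightarrow> 'a"
    unfolding minus_eq by (rule W21_add_scaled(1)[OF that(2,1)])
  have norm_L_diff: "L1norm (?L (y - x)) = L1norm (\<lambda>t. ?L y t - ?L x t)"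
    if "x \<in> W21" "y \<in> W21" for x y :: "real \<Rightarrow> 'a"
    using L_int[OF W_diff[OF that]] L_int[OF that(1)] L_int[OF that(2)]
    by (intro L1norm_cong_AE L_diff that) auto
  have r_bound: "W21_norm (r y - r x) \<le> K' * (g + 1) * L1norm (\<lambda>t. \<rho> (?L y) t - \<rho> (?L x) t)"
    if x: "x \<in> W21" and y: "y \<in> W21" for x y
  proof -
    define u v where "u = \<rho> (?L x)" and "v = \<rho> (?L y)"
    have u: "integrable L01 u" and v: "integrable L01 v" unfolding u_def v_def using \<rho>_int L_int x y by blast+
    note W = T(1)[OF u] T(1)[OF v]
    have "L1norm (?L (T v - T u)) = L1norm (\<lambda>t. ?L (T v) t - ?L (T u) t)" by (rule norm_L_diff[OF W])
    also have "\<dots> = L1norm (\<lambda>t. v t - u t)"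
    proof (rule L1norm_cong_AE)
      show "AE t in L01. ?L (T v) t - ?L (T u) t = v t - u t"
        using T(2)[OF u] T(2)[OF v] by eventually_elim simp
    qed (use u v L_int[OF W(1)] L_int[OF W(2)] in auto)
    finally have 1: "L1norm (?L (T v - T u)) = L1norm (\<lambda>t. v t - u t)" .
    \<comment> \<open>The Green bound controls the supremum of the difference, and the a priori
      estimate supplies its derivatives.\<close>
    have "W21_norm (T v - T u) \<le> K' * (g * L1norm (\<lambda>t. v t - u t) + L1norm (?L (T v - T u)))"
      using Gop_diff[OF v u] by (intro K'(2) W_diff W) (simp add: T_def)
    then show ?thesis unfolding 1 r_def u_def[symmetric] v_def[symmetric] by (simp add: algebra_simps)
  qed
  have "\<exists>d>0. \<forall>y\<in>W21. W21_norm (y - x) < d \<longrightarrow> W21_norm (r y - r x) < e" if x: "x \<in> W21" and e: "0 < e" for x e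
  proof (rule ccontr)
    assume "\<not> ?thesis"
    then have "\<exists>y\<in>W21. W21_norm (y - x) < 1 / real (Suc n) \<and> e \<le> W21_norm (r y - r x)" for n
      using not_less by (metis of_nat_0_less_iff zero_less_Suc zero_less_divide_1_iff)
    then obtain y where y: "\<And>n. y n \<in> W21" "\<And>n. W21_norm (y n - x) < 1 / real (Suc n)"
      "\<And>n. e \<le> W21_norm (r (y n) - r x)" by metis
    have lim0: "(\<lambda>n. K * (1 / real (Suc n))) \<longlonglongrightarrow> 0"
      using tendsto_mult[OF tendsto_const[of K] LIMSEQ_Suc[OF lim_1_over_n]] by simp
    have "L1_tendsto (\<lambda>n. ?L (y n)) (?L x)"
    proof (rule Lim_null_comparison[OF always_eventually lim0], rule allI)
      fix n
      have "L1norm (\<lambda>t. ?L (y n) t - ?L x t) \<le> K * W21_norm (y n - x)"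
        using K(2)[OF W_diff[OF x y(1)[of n]]] norm_L_diff[OF x y(1)[of n]] by simp
      also have "\<dots> \<le> K * (1 / real (Suc n))" using y(2)[of n] K(1) by (intro mult_left_mono) auto
      finally show "norm (L1norm (\<lambda>t. ?L (y n) t - ?L x t)) \<le> K * (1 / real (Suc n))" by simp
    qed
    from \<rho>_cont[OF L_int[OF y(1)] L_int[OF x] this]
    have "(\<lambda>n. K' * (g + 1) * L1norm (\<lambda>t. \<rho> (?L (y n)) t - \<rho> (?L x) t)) \<longlonglongrightarrow> K' * (g + 1) * 0"
      by (intro tendsto_mult tendsto_const)
    then have "(\<lambda>n. K' * (g + 1) * L1norm (\<lambda>t. \<rho> (?L (y n)) t - \<rho> (?L x) t)) \<longlonglongrightarrow> 0" by simp
    from order_tendstoD(2)[OF this e]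
    obtain n where "K' * (g + 1) * L1norm (\<lambda>t. \<rho> (?L (y n)) t - \<rho> (?L x) t) < e"
      by (auto simp: eventually_sequentially)
    then show False using r_bound[OF x y(1)[of n]] y(3)[of n] by linarith
  qed
  then show ?thesis
    unfolding W21_retract_def using r_S r_fix by (intro conjI exI[of _ r]) auto
qed

end
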